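(* Let $\mathbb{K}$ be a (commutative) field with at least three elements, and let $V$ be a maximal linear subspace of $\mathrm{M}_n(\mathbb{K})$ with a trivial spectrum. Then there are positive integers $n_1,\dots,n_p$ with $n_1+\cdots+n_p=n$ and a list $(P_1,\dots,P_p)\in \mathrm{GL}_{n_1}(\mathbb{K})\times\cdots\times \mathrm{GL}_{n_p}(\mathbb{K})$ of non-isotropic matrices such that $$V \simeq P_1\mathrm{A}_{n_1}(\mathbb{K})\vee\cdots\vee P_p\mathrm{A}_{n_p}(\mathbb{K}).$$ The integer $p$ is uniquely determined by $V$ and, for every $k\in\{1,\dots,p\}$, the matrix $P_k$ is uniquely determined by $V$ up to congruence and multiplication by a non-zero scalar (that is, if $(P'_1,\dots,P'_{p'})$ is another list of non-isotropic matrices, of respective sizes $n'_1,\dots,n'_{p'}$, with $V\simeq P'_1\mathrm{A}_{n'_1}(\mathbb{K})\vee\cdots\vee P'_{p'}\mathrm{A}_{n'_{p'}}(\mathbb{K})$, then $p'=p$ and, for every $k$, $n'_k=n_k$ and $P'_k$ is congruent to a non-zero scalar multiple of $P_k$). Moreover, given another list $(Q_1,\dots,Q_p)\in \mathrm{GL}_{n_1}(\mathbb{K})\times\cdots\times \mathrm{GL}_{n_p}(\mathbb{K})$, if $Q_k$ is congruent to a scalar multiple of $P_k$ for each $k\in\{1,\dots,p\}$, then $$V \simeq Q_1\mathrm{A}_{n_1}(\mathbb{K})\vee\cdots\vee Q_p\mathrm{A}_{n_p}(\mathbb{K}).$$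
   Context: $\mathrm{M}_n(\mathbb{K})$ is the algebra of $n\times n$ matrices over $\mathbb{K}$, and $\mathrm{A}_n(\mathbb{K})$ is the space of alternate matrices, i.e. those $A$ with $X^TAX=0$ for all $X\in\mathbb{K}^n$ (skew-symmetric with zero diagonal); $P\,\mathrm{A}_n(\mathbb{K}) = \{PA \mid A \in \mathrm{A}_n(\mathbb{K})\}$. A matrix $P\in \mathrm{M}_n(\mathbb{K})$ is non-isotropic if $X^TPX\neq 0$ for all $X\in\mathbb{K}^n\setminus\{0\}$. Two matrices $A,B\in\mathrm{M}_n(\mathbb{K})$ are congruent if $A=RBR^T$ for some $R\in\mathrm{GL}_n(\mathbb{K})$. A linear subspace $H$ of $\mathrm{M}_n(\mathbb{K})$ has a trivial spectrum if no matrix $M\in H$ has a non-zero vector $X\in\mathbb{K}^n$ with $MX=X$. Such a subspace is called maximal if its dimension is $\binom{n}{2}$. Two linear subspaces $V,W$ of $\mathrm{M}_n(\mathbb{K})$ are similar, written $V\simeq W$, if $W=RVR^{-1}$ for some $R\in\mathrm{GL}_n(\mathbb{K})$. For subsets $V\subset \mathrm{M}_n(\mathbb{K})$ and $W\subset \mathrm{M}_p(\mathbb{K})$, $V\vee W:=\left\{\begin{bmatrix}A&B\\0&C\end{bmatrix} \mid A\in V,\ B\in \mathrm{M}_{n,p}(\mathbb{K}),\ C\in W\right\}\subset \mathrm{M}_{n+p}(\mathbb{K})$, where $\mathrm{M}_{n,p}(\mathbb{K})$ is the space of $n\times p$ matrices; the operation $\vee$ is associative. *)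

theory Defs
  imports "Jordan_Normal_Form.VS_Connect"
begin

definition GL_mat :: "nat \<Rightarrow> 'a::field mat set" where
  "GL_mat n = {R \<in> carrier_mat n n. invertible_mat R}"

definition alternate_mats :: "nat \<Rightarrow> 'a::field mat set" where
  "alternate_mats n = {A \<in> carrier_mat n n. \<forall>X \<in> carrier_vec n. X \<bullet> (A *\<^sub>v X) = 0}"

definition mult_alternate :: "nat \<Rightarrow> 'a::field mat \<Rightarrow> 'a mat set" where
  "mult_alternate n P = {P * A | A. A \<in> alternate_mats n}"

definition non_isotropic :: "nat \<Rightarrow> 'a::field mat \<Rightarrow> bool" where
  "non_isotropic n P \<longleftrightarrow>
     P \<in> carrier_mat n n \<and> (\<forall>X \<in> carrier_vec n. X \<noteq> 0\<^sub>v n \<longrightarrow> X \<bullet> (P *\<^sub>v X) \<noteq> 0)"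

definition congruent_mats :: "nat \<Rightarrow> 'a::field mat \<Rightarrow> 'a mat \<Rightarrow> bool" where
  "congruent_mats n A B \<longleftrightarrow>
     A \<in> carrier_mat n n \<and> B \<in> carrier_mat n n \<and> (\<exists>R \<in> GL_mat n. A = R * B * R\<^sup>T)"

definition mat_subspace :: "nat \<Rightarrow> 'a::field mat set \<Rightarrow> bool" where
  "mat_subspace n H \<longleftrightarrow> subspace (class_ring :: 'a ring) H (module_mat TYPE('a) n n)"

definition mat_subspace_dim :: "nat \<Rightarrow> 'a::field mat set \<Rightarrow> nat" where
  "mat_subspace_dim n H =
     vectorspace.dim (class_ring :: 'a ring) (module_mat TYPE('a) n n \<lparr>carrier := H\<rparr>)"

definition trivial_spectrum :: "nat \<Rightarrow> 'a::field mat set \<Rightarrow> bool" where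
  "trivial_spectrum n H \<longleftrightarrow>
     mat_subspace n H \<and>
     (\<forall>M \<in> H. \<not> (\<exists>X \<in> carrier_vec n. X \<noteq> 0\<^sub>v n \<and> M *\<^sub>v X = X))"

definition maximal_trivial_spectrum :: "nat \<Rightarrow> 'a::field mat set \<Rightarrow> bool" where
  "maximal_trivial_spectrum n H \<longleftrightarrow> trivial_spectrum n H \<and> mat_subspace_dim n H = n choose 2"

text \<open>In the next definition \<open>S\<close> is the inverse of \<open>R\<close>.\<close>

definition similar_subspaces :: "nat \<Rightarrow> 'a::field mat set \<Rightarrow> 'a mat set \<Rightarrow> bool" where
  "similar_subspaces n V W \<longleftrightarrow>
     V \<subseteq> carrier_mat n n \<and> W \<subseteq> carrier_mat n n \<and>
     (\<exists>R \<in> carrier_mat n n. \<exists>S \<in> carrier_mat n n.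
        inverts_mat R S \<and> inverts_mat S R \<and> W = {R * M * S | M. M \<in> V})"

text \<open>The sizes of the blocks are read off from the members of the two sets, so that for
  \<open>V \<subseteq> carrier_mat n n\<close> and \<open>W \<subseteq> carrier_mat p p\<close> the off-diagonal block \<open>B\<close> ranges over all
  \<open>n \<times> p\<close> matrices.\<close>

definition mat_join :: "'a::field mat set \<Rightarrow> 'a mat set \<Rightarrow> 'a mat set" where
  "mat_join V W =
     {four_block_mat A B (0\<^sub>m (dim_row C) (dim_col A)) C | A B C.
        A \<in> V \<and> B \<in> carrier_mat (dim_row A) (dim_col C) \<and> C \<in> W}"

text \<open>The set \<open>carrier_mat 0 0\<close>, whose only member is the empty matrix, is neutral for
  \<^const>\<open>mat_join\<close>.\<close>

definition mat_joins :: "'a::field mat set list \<Rightarrow> 'a mat set" where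
  "mat_joins Vs = foldr mat_join Vs (carrier_mat 0 0)"

definition alternate_join :: "nat list \<Rightarrow> 'a::field mat list \<Rightarrow> 'a mat set" where
  "alternate_join ns Ps = mat_joins (map2 mult_alternate ns Ps)"

definition non_isotropic_list :: "nat list \<Rightarrow> 'a::field mat list \<Rightarrow> bool" where
  "non_isotropic_list ns Ps \<longleftrightarrow>
     length Ps = length ns \<and> (\<forall>k < length ns. 0 < ns ! k \<and> non_isotropic (ns ! k) (Ps ! k))"

end

theory Submission
  imports Defs "Jordan_Normal_Form.Determinant" "HOL-Library.Function_Algebras"
begin

text \<open>
  Let \<open>V\<close> act on \<open>E = K\<^sup>n\<close>. Call \<open>x\<close> good if no non-zero \<open>M \<in> V\<close> has its image inside \<open>K x\<close>.
  Good vectors exist, and for a good \<open>x\<close> the operators of \<open>V\<close> that kill \<open>x\<close> act faithfully on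
  \<open>E / K x\<close>, again with trivial spectrum; since \<open>x \<notin> V x\<close>, induction gives \<open>dim V \<le> n choose 2\<close>.
  If equality holds, then \<open>V x\<close> is a hyperplane and the space induced on \<open>E / K x\<close> is maximal.

  The heart of the existence proof is that a maximal \<open>V\<close> has an invariant subspace \<open>F \<noteq> E\<close> and a bilinear
  form \<open>b\<close> with radical \<open>F\<close> such that \<open>b y (M y) = 0\<close> for all \<open>M \<in> V\<close> and \<open>b y y \<noteq> 0\<close> off \<open>F\<close>: the Gram
  matrix of \<open>b\<close> on \<open>E / F\<close> is then the inverse of the last block \<open>P\<^sub>p\<close>, and the restriction of \<open>V\<close> to \<open>F\<close>
  is again maximal. To find \<open>F\<close> and \<open>b\<close>, identify \<open>E / K x\<close> with \<open>H = V x\<close> for a good \<open>x\<close> and start from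
  \<open>F\<close> and \<open>b\<close> for \<open>H\<close>. Whenever \<open>F\<close> fails to be \<open>V\<close>-invariant, some element of \<open>V\<close> with a fixed vector can be
  written down by solving linear equations, which is where three scalars are needed. If \<open>F \<noteq> 0\<close>, pass to
  \<open>E / F\<close>; if \<open>F = 0\<close>, the same kind of argument shows that \<open>H\<close> is invariant or that \<open>b\<close> extends to \<open>E\<close>.

  For uniqueness, the first block of a join spans the least non-zero invariant subspace, so every similarity
  is block triangular; and \<open>P A\<^sub>n = Q A\<^sub>n\<close> forces \<open>Q\<^sup>-\<^sup>1 P\<close> to be scalar.
\<close>

section \<open>Finite-dimensional subspaces\<close>

text \<open>Peeling off the last block rather than the first makes the reducible case cheap: a form
  on a quotient pulls back to \<open>E\<close>, with its invariance and its radical. The obstacle is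
  the way back from \<open>E / K x\<close> to \<open>E\<close>: operators killing \<open>x\<close>
  are known on \<open>H\<close> only modulo \<open>x\<close>, so their components along
  \<open>x\<close>, and the operators that move \<open>x\<close>, must be tamed. Taking
  \<open>V x\<close> itself as the complement \<open>H\<close> gives the needed freedom, since every
  \<open>h\<close> in \<open>H\<close> is \<open>M x\<close> for some \<open>M\<close> in
  \<open>V\<close>; most constraints come from asking when \<open>M\<close> plus an operator killing
  \<open>x\<close> would fix some \<open>y + t *s x\<close>. Maximality enters through tight counts:
  \<open>V\<close> has no room for a further operator that creates no fixed vector, and beside an
  invariant subspace the restriction, the quotient and the corner block all have full dimension. The
  third scalar \<open>c0\<close> separates polynomials: a quadratic with leading coefficient -1
  cannot vanish at 0, 1 and \<open>c0\<close>; terms linear and quadratic in \<open>M\<close> are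
  told apart by scaling with \<open>c0\<close>; two affine functions are compared at 1 and
  \<open>c0\<close>.\<close>

text \<open>A locale of its own, since definitions made in \<^locale>\<open>vector_space\<close> itself would be shadowed by their
  instances for \<^class>\<open>real_vector\<close>.\<close>

locale lin_space = vector_space scale
  for scale :: "'a::field \<Rightarrow> 'b::ab_group_add \<Rightarrow> 'b" (infixr \<open>*s\<close> 75)
begin

text \<open>\<open>dim\<close> is the cardinality of a basis and hence 0 for an infinite-dimensional
  subspace, so dimension counts need this extra condition. It is imposed on subspaces because the
  ambient type, in particular that of all operators, may be infinite-dimensional.\<close>

definition fd :: "'b set \<Rightarrow> bool" where
  "fd S \<longleftrightarrow> subspace S \<and> (\<exists>B. finite B \<and> S \<subseteq> span B)"

lemma fd_subspace: "fd S \<Longrightarrow> subspace S"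
  by (simp add: fd_def)

lemma fd_subset: "fd S \<Longrightarrow> subspace T \<Longrightarrow> T \<subseteq> S \<Longrightarrow> fd T"
  unfolding fd_def by blast

lemma fd_span: "finite B \<Longrightarrow> fd (span B)"
  unfolding fd_def by (auto simp: subspace_span)

lemma fd_extend_basis:
  assumes "fd S" "B \<subseteq> S" "independent B"
  obtains C where "B \<subseteq> C" "finite C" "independent C" "span C = S" "card C = dim S"
proof -
  obtain C where C: "B \<subseteq> C" "C \<subseteq> S" "independent C" "S \<subseteq> span C"
    using maximal_independent_subset_extend assms(2,3) by blast
  obtain D where D: "finite D" "S \<subseteq> span D" using assms(1) fd_def by auto
  have "finite C" using independent_span_bound[OF D(1) C(3)] C(2) D(2) by auto
  moreover have "span C = S"
    using C(2,4) span_minimal[OF C(2)] fd_subspace[OF assms(1)] by auto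
  moreover have "card C = dim S" using basis_card_eq_dim[OF C(2,4,3)] .
  ultimately show ?thesis using that C by blast
qed

lemma fd_basis:
  assumes "fd S"
  obtains B where "finite B" "independent B" "span B = S" "card B = dim S"
  using fd_extend_basis[OF assms, of "{}"] by (auto simp: independent_empty)

lemma dim_mono_fd:
  assumes "fd S" "subspace T" "T \<subseteq> S"
  shows "dim T \<le> dim S"
proof -
  obtain B where "finite B" "independent B" "span B = S" "card B = dim S" by (rule fd_basis[OF assms(1)])
  then show ?thesis using dim_le_card[of T B] assms(3) by auto
qed

lemma dim_eq_fd:
  assumes "fd S" "subspace T" "T \<subseteq> S" "dim S \<le> dim T"
  shows "T = S"
proof -
  have T: "fd T" using fd_subset assms by blast
  obtain B where B: "finite B" "independent B" "span B = T" "card B = dim T" by (rule fd_basis[OF T])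
  have "B \<subseteq> S" using span_superset[of B] assms(3) unfolding B(3) by blast
  then obtain C where C: "B \<subseteq> C" "finite C" "independent C" "span C = S" "card C = dim S"
    by (rule fd_extend_basis[OF assms(1) _ B(2)])
  have "B = C" by (rule card_seteq[OF C(2,1)]) (use B C assms in auto)
  then show ?thesis using B C by simp
qed

lemma dim_insert_fd:
  assumes "fd S" "a \<notin> S"
  shows "dim (span (insert a S)) = dim S + 1"
proof -
  obtain B where B: "finite B" "independent B" "span B = S" "card B = dim S" by (rule fd_basis[OF assms(1)])
  have "span (insert a S) = span (insert a B)"
    unfolding span_insert B(3)[symmetric] span_span ..
  moreover have "independent (insert a B)" using B assms by (simp add: independent_insertI)
  moreover have "a \<notin> B" using span_superset[of B] assms unfolding B(3) by blast
  ultimately show ?thesis using B dim_span_eq_card_independent[of "insert a B"] by simp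
qed

lemma subspace_zero: "subspace {0}"
  by (auto simp: subspace_def)

lemma fd_dim0: "fd S \<Longrightarrow> dim S = 0 \<longleftrightarrow> S = {0}"
proof
  assume S: "fd S" "dim S = 0"
  obtain B where "finite B" "independent B" "span B = S" "card B = dim S" by (rule fd_basis[OF S(1)])
  then show "S = {0}" using S(2) by auto
next
  assume "S = {0}" then show "dim S = 0"
    by (metis dim_span_eq_card_independent card.empty independent_empty span_empty)
qed

end

section \<open>Linear maps on subspaces and rank-nullity\<close>

definition lin_on :: "('a \<Rightarrow> 'b \<Rightarrow> 'b) \<Rightarrow> ('a \<Rightarrow> 'c \<Rightarrow> 'c) \<Rightarrow> 'b::plus set \<Rightarrow> ('b \<Rightarrow> 'c::plus) \<Rightarrow> bool" where
  "lin_on s1 s2 S f \<longleftrightarrow>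
    (\<forall>u\<in>S. \<forall>v\<in>S. f (u + v) = f u + f v) \<and> (\<forall>c. \<forall>u\<in>S. f (s1 c u) = s2 c (f u))"

locale lin_pair = vs1: lin_space s1 + vs2: lin_space s2
  for s1 :: "'a::field \<Rightarrow> 'b::ab_group_add \<Rightarrow> 'b" and s2 :: "'a \<Rightarrow> 'c::ab_group_add \<Rightarrow> 'c"
begin

lemma lin_on_zero: "lin_on s1 s2 S f \<Longrightarrow> vs1.subspace S \<Longrightarrow> f 0 = 0"
  unfolding lin_on_def by (metis vs1.subspace_0 vs2.scale_zero_left vs1.scale_zero_left)

lemma lin_on_sum:
  assumes "lin_on s1 s2 S f" "vs1.subspace S" "\<And>i. i \<in> I \<Longrightarrow> x i \<in> S"
  shows "f (\<Sum>i\<in>I. s1 (a i) (x i)) = (\<Sum>i\<in>I. s2 (a i) (f (x i)))"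
  using assms(3)
proof (induction I rule: infinite_finite_induct)
  case (insert i I)
  have "(\<Sum>i\<in>I. s1 (a i) (x i)) \<in> S"
    using insert.prems by (intro vs1.subspace_sum vs1.subspace_scale assms(2)) auto
  moreover have "s1 (a i) (x i) \<in> S" using insert.prems assms(2) by (simp add: vs1.subspace_scale)
  ultimately have "f (s1 (a i) (x i) + (\<Sum>i\<in>I. s1 (a i) (x i)))
      = f (s1 (a i) (x i)) + f (\<Sum>i\<in>I. s1 (a i) (x i))"
    using assms(1) unfolding lin_on_def by blast
  moreover have "f (s1 (a i) (x i)) = s2 (a i) (f (x i))"
    using assms(1) insert.prems unfolding lin_on_def by blast
  ultimately show ?case using insert by simp
qed (use lin_on_zero assms in auto)

lemma lin_on_diff:
  assumes "lin_on s1 s2 S f" "vs1.subspace S" "u \<in> S" "v \<in> S"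
  shows "f (u - v) = f u - f v"
proof -
  have "f (u + s1 (-1) v) = f u + s2 (-1) (f v)"
    using assms vs1.subspace_scale[OF assms(2,4)] unfolding lin_on_def by metis
  then show ?thesis by simp
qed

lemma subspace_lin_image:
  assumes "lin_on s1 s2 S f" "vs1.subspace S"
  shows "vs2.subspace (f ` S)"
  unfolding vs2.subspace_def
proof (intro conjI ballI allI)
  show "0 \<in> f ` S" using lin_on_zero[OF assms] vs1.subspace_0[OF assms(2)] by (metis image_eqI)
next
  fix x y assume "x \<in> f ` S" "y \<in> f ` S"
  then obtain u v where "u \<in> S" "v \<in> S" "x = f u" "y = f v" by blast
  then show "x + y \<in> f ` S"
    using assms(1) vs1.subspace_add[OF assms(2)] unfolding lin_on_def by (metis image_eqI)
next
  fix c x assume "x \<in> f ` S"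
  then obtain u where "u \<in> S" "x = f u" by blast
  then show "s2 c x \<in> f ` S"
    using assms(1) vs1.subspace_scale[OF assms(2)] unfolding lin_on_def by (metis image_eqI)
qed

lemma subspace_lin_kernel:
  assumes "lin_on s1 s2 S f" "vs1.subspace S"
  shows "vs1.subspace {v \<in> S. f v = 0}"
  using lin_on_zero[OF assms] assms unfolding vs1.subspace_def lin_on_def by auto

text \<open>Finite dimension of \<open>S\<close> is a conclusion: spaces of operators sit inside a
  possibly infinite-dimensional function space, and this is how they are shown to be
  finite-dimensional.\<close>

lemma rank_nullity:
  assumes f: "lin_on s1 s2 S f" and S: "vs1.subspace S"
    and K: "vs1.fd {v \<in> S. f v = 0}" and I: "vs2.fd (f ` S)"
  shows "vs1.fd S" "vs1.dim S = vs1.dim {v \<in> S. f v = 0} + vs2.dim (f ` S)"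
proof -
  obtain B where B: "finite B" "vs1.independent B" "vs1.span B = {v \<in> S. f v = 0}"
      "card B = vs1.dim {v \<in> S. f v = 0}"
    by (rule vs1.fd_basis[OF K])
  obtain C where C: "finite C" "vs2.independent C" "vs2.span C = f ` S" "card C = vs2.dim (f ` S)"
    by (rule vs2.fd_basis[OF I])
  have "\<forall>c\<in>C. \<exists>v\<in>S. f v = c" using vs2.span_superset[of C] unfolding C(3) by blast
  then obtain g where g: "\<And>c. c \<in> C \<Longrightarrow> g c \<in> S \<and> f (g c) = c" by metis
  \<comment> \<open>Upper bound for \<open>dim S\<close>: the kernel basis \<open>B\<close> and
    preimages \<open>g c\<close> of an image basis span \<open>S\<close>.\<close>
  have sp: "S \<subseteq> vs1.span (B \<union> g ` C)"
  proof
    fix v assume v: "v \<in> S"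
    have "f v \<in> vs2.span C" using v C(3) by simp
    then obtain a where a: "f v = (\<Sum>c\<in>C. s2 (a c) c)"
      using vs2.span_finite[OF C(1)] by auto
    define u where "u = (\<Sum>c\<in>C. s1 (a c) (g c))"
    have u: "u \<in> S" unfolding u_def using g by (intro vs1.subspace_sum vs1.subspace_scale S) auto
    have "f u = (\<Sum>c\<in>C. s2 (a c) (f (g c)))" unfolding u_def
      by (rule lin_on_sum[OF f S]) (use g in auto)
    also have "\<dots> = f v" unfolding a by (rule sum.cong) (use g in auto)
    finally have "f (v - u) = 0" using lin_on_diff[OF f S v u] by simp
    then have "v - u \<in> vs1.span B" using B(3) vs1.subspace_diff[OF S v u] by simp
    then have 1: "v - u \<in> vs1.span (B \<union> g ` C)" using vs1.span_mono[of B "B \<union> g ` C"] by auto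
    have 2: "u \<in> vs1.span (B \<union> g ` C)" unfolding u_def
      by (intro vs1.span_sum vs1.span_scale vs1.span_base) auto
    show "v \<in> vs1.span (B \<union> g ` C)" using vs1.span_add[OF 1 2] by simp
  qed
  moreover have fin: "finite (B \<union> g ` C)" using B C by simp
  ultimately show fd: "vs1.fd S" unfolding vs1.fd_def using S by blast
  have "vs1.dim S \<le> card (B \<union> g ` C)" by (rule vs1.dim_le_card[OF sp fin])
  also have "\<dots> \<le> card B + card C"
    using card_Un_le[of B "g ` C"] card_image_le[OF C(1), of g] by linarith
  finally have le: "vs1.dim S \<le> card B + card C" .
  \<comment> \<open>Lower bound: after extending \<open>B\<close> to a basis \<open>D\<close> of
    \<open>S\<close>, the image is spanned by the values on \<open>D - B\<close>, because
    \<open>f\<close> kills \<open>B\<close>.\<close>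
  have "B \<subseteq> S" using vs1.span_superset[of B] unfolding B(3) by blast
  then obtain D where D: "B \<subseteq> D" "finite D" "vs1.independent D" "vs1.span D = S" "card D = vs1.dim S"
    by (rule vs1.fd_extend_basis[OF fd _ B(2)])
  have DS: "D \<subseteq> S" using vs1.span_superset[of D] unfolding D(4) .
  have "f ` S \<subseteq> vs2.span (f ` (D - B))"
  proof
    fix y assume "y \<in> f ` S"
    then obtain v where v: "v \<in> S" "y = f v" by blast
    then obtain a where a: "v = (\<Sum>d\<in>D. s1 (a d) d)"
      using vs1.span_finite[OF D(2)] D(4) by auto
    have "y = (\<Sum>d\<in>D. s2 (a d) (f d))" unfolding v(2) a
      by (rule lin_on_sum[OF f S]) (use DS in auto)
    also have "\<dots> \<in> vs2.span (f ` (D - B))"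
    proof (rule vs2.span_sum)
      fix d assume d: "d \<in> D"
      show "s2 (a d) (f d) \<in> vs2.span (f ` (D - B))"
      proof (cases "d \<in> B")
        case True
        then have "f d = 0" using vs1.span_base[of d B] unfolding B(3) by blast
        then show ?thesis by (simp add: vs2.span_zero)
      next
        case False
        then show ?thesis using d by (intro vs2.span_scale vs2.span_base) auto
      qed
    qed
    finally show "y \<in> vs2.span (f ` (D - B))" .
  qed
  then have "vs2.dim (f ` S) \<le> card (f ` (D - B))"
    using D(2) by (intro vs2.dim_le_card) auto
  also have "\<dots> \<le> card (D - B)" using D(2) by (intro card_image_le) auto
  also have "\<dots> = card D - card B" using D B by (intro card_Diff_subset) auto
  \<comment> \<open>The second disjunct absorbs the truncated subtraction of natural numbers and is
    excluded next.\<close>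
  finally have "card C + card B \<le> vs1.dim S \<or> card D < card B" using D C by linarith
  moreover have "card B \<le> card D" using D by (intro card_mono) auto
  ultimately show "vs1.dim S = vs1.dim {v \<in> S. f v = 0} + vs2.dim (f ` S)"
    using le B C by linarith
qed

lemma dim_inj_image:
  assumes f: "lin_on s1 s2 S f" and S: "vs1.subspace S"
    and K: "\<And>v. v \<in> S \<Longrightarrow> f v = 0 \<Longrightarrow> v = 0" and I: "vs2.fd (f ` S)"
  shows "vs1.fd S" "vs1.dim S = vs2.dim (f ` S)"
proof -
  have eq: "{v \<in> S. f v = 0} = {0}"
    using K lin_on_zero[OF f S] vs1.subspace_0[OF S] by auto
  have "vs1.fd {v \<in> S. f v = 0}" unfolding eq using vs1.fd_span[of "{}"] by simp
  note rn = rank_nullity[OF f S this I]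
  show "vs1.fd S" by (rule rn(1))
  have "vs1.dim {v \<in> S. f v = 0} = 0"
    unfolding eq using vs1.fd_dim0[of "{0}"] vs1.fd_span[of "{}"] by simp
  then show "vs1.dim S = vs2.dim (f ` S)" using rn(2) by simp
qed

end

section \<open>Spaces of endomorphisms with trivial spectrum\<close>

locale endo_space = lin_space scale
  for scale :: "'a::field \<Rightarrow> 'b::ab_group_add \<Rightarrow> 'b" (infixr \<open>*s\<close> 75)
begin

definition opscale :: "'a \<Rightarrow> ('b \<Rightarrow> 'b) \<Rightarrow> 'b \<Rightarrow> 'b" where
  "opscale c f = (\<lambda>v. c *s f v)"

lemma opscale_apply [simp]: "opscale c f v = c *s f v"
  by (simp add: opscale_def)

end

sublocale endo_space \<subseteq> op: lin_space opscale
  by unfold_locales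
    (auto simp: fun_eq_iff plus_fun_def scale_right_distrib scale_left_distrib)

context endo_space
begin

lemma pair_bb: "lin_pair scale scale" ..
lemma pair_ob: "lin_pair opscale scale" ..
lemma pair_oo: "lin_pair opscale opscale" ..

lemmas lin_zero = lin_pair.lin_on_zero[OF pair_bb]
lemmas lin_sum = lin_pair.lin_on_sum[OF pair_bb]
lemmas lin_diff = lin_pair.lin_on_diff[OF pair_bb]

lemma lin_add: "lin_on scale scale E f \<Longrightarrow> u \<in> E \<Longrightarrow> v \<in> E \<Longrightarrow> f (u + v) = f u + f v"
  and lin_scale: "lin_on scale scale E f \<Longrightarrow> u \<in> E \<Longrightarrow> f (c *s u) = c *s f u"
  by (auto simp: lin_on_def)

lemma sum_fun_apply: "(\<Sum>i\<in>I. f i) x = (\<Sum>i\<in>I. f i x)"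
  by (induction I rule: infinite_finite_induct) (auto simp: plus_fun_def zero_fun_def)

text \<open>An endomorphism of a subspace \<open>E\<close> is a total function that is linear on \<open>E\<close> and zero outside, so that
  distinct elements differ on \<open>E\<close> and pointwise operations are the vector space operations.\<close>

definition End :: "'b set \<Rightarrow> ('b \<Rightarrow> 'b) set" where
  "End E = {f. lin_on scale scale E f \<and> f ` E \<subseteq> E \<and> (\<forall>v. v \<notin> E \<longrightarrow> f v = 0)}"

lemma End_lin: "M \<in> End E \<Longrightarrow> lin_on scale scale E M"
  and End_in: "M \<in> End E \<Longrightarrow> v \<in> E \<Longrightarrow> M v \<in> E"
  and End_out: "M \<in> End E \<Longrightarrow> v \<notin> E \<Longrightarrow> M v = 0"
  by (auto simp: End_def)

definition triv :: "'b set \<Rightarrow> ('b \<Rightarrow> 'b) set \<Rightarrow> bool" where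
  "triv E V \<longleftrightarrow> op.subspace V \<and> V \<subseteq> End E \<and> (\<forall>M\<in>V. \<forall>x\<in>E. M x = x \<longrightarrow> x = 0)"

lemma trivD:
  assumes "triv E V"
  shows "op.subspace V" "\<And>M. M \<in> V \<Longrightarrow> M \<in> End E"
    "\<And>M x. M \<in> V \<Longrightarrow> x \<in> E \<Longrightarrow> M x = x \<Longrightarrow> x = 0"
  using assms by (auto simp: triv_def)

lemma op_addI: "op.subspace V \<Longrightarrow> M \<in> V \<Longrightarrow> N \<in> V \<Longrightarrow> (\<lambda>v. M v + N v) \<in> V"
  using op.subspace_add[of V M N] by (simp add: plus_fun_def)

lemma op_diffI: "op.subspace V \<Longrightarrow> M \<in> V \<Longrightarrow> N \<in> V \<Longrightarrow> (\<lambda>v. M v - N v) \<in> V"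
  using op.subspace_diff[of V M N] by (simp add: fun_diff_def)

lemma op_scaleI: "op.subspace V \<Longrightarrow> M \<in> V \<Longrightarrow> (\<lambda>v. c *s M v) \<in> V"
  using op.subspace_scale[of V M c] by (simp add: opscale_def)

lemma lin_eval: "lin_on opscale scale V (\<lambda>M. M x)"
  by (auto simp: lin_on_def plus_fun_def)

definition good :: "'b set \<Rightarrow> ('b \<Rightarrow> 'b) set \<Rightarrow> 'b \<Rightarrow> bool" where
  "good E V x \<longleftrightarrow> x \<in> E \<and> x \<noteq> 0 \<and> (\<forall>M\<in>V. M ` E \<subseteq> span {x} \<longrightarrow> M = 0)"

text \<open>If all elements of a basis are bad, each of them, \<open>b\<close>, carries a rank one operator \<open>v \<mapsto> k b v *s b\<close> in \<open>V\<close>.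
  In a least non-empty set \<open>S\<close> of basis vectors such that every \<open>k b\<close> with \<open>b \<in> S\<close> is non-zero somewhere on \<open>S\<close>,
  every \<open>k b\<close> is non-zero at exactly one point, so a combination of the operators fixes the sum of \<open>S\<close>.\<close>

lemma good_exists:
  assumes E: "fd E" "E \<noteq> {0}" and V: "triv E V"
  shows "\<exists>x. good E V x"
proof (rule ccontr)
  assume "\<nexists>x. good E V x"
  then have bad: "\<not> good E V x" for x by blast
  note VD = trivD[OF V]
  have sE: "subspace E" by (rule fd_subspace[OF E(1)])
  obtain B where B: "finite B" "independent B" "span B = E" "card B = dim E"
    by (rule fd_basis[OF E(1)])
  have BE: "B \<subseteq> E" using span_superset[of B] unfolding B(3) .
  have B0: "b \<noteq> 0" if "b \<in> B" for b using that B(2) dependent_zero by blast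
  have "\<exists>M\<in>V. M ` E \<subseteq> span {b} \<and> M \<noteq> 0" if "b \<in> B" for b
    using bad[of b] B0[OF that] BE that unfolding good_def by auto
  then obtain R where R: "\<And>b. b \<in> B \<Longrightarrow> R b \<in> V \<and> R b ` E \<subseteq> span {b} \<and> R b \<noteq> 0"
    by metis
  have "\<exists>k. R b v = k *s b" if "b \<in> B" "v \<in> E" for b v
    using R[OF that(1)] that(2) unfolding span_singleton by blast
  then obtain k where k: "\<And>b v. b \<in> B \<Longrightarrow> v \<in> E \<Longrightarrow> R b v = k b v *s b" by metis
  have self: "k b b = 0" if b: "b \<in> B" for b
  proof (rule ccontr)
    assume nz: "k b b \<noteq> 0"
    have "(\<lambda>v. inverse (k b b) *s R b v) \<in> V" using op_scaleI VD(1) R[OF b] by blast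
    moreover have "inverse (k b b) *s R b b = b" using k[OF b, of b] b BE nz by auto
    ultimately have "b = 0" using VD(3)[of "\<lambda>v. inverse (k b b) *s R b v" b] b BE by auto
    then show False using B0[OF b] by simp
  qed
  have nxt: "\<exists>c\<in>B. k b c \<noteq> 0" if b: "b \<in> B" for b
  proof (rule ccontr)
    assume "\<not> (\<exists>c\<in>B. k b c \<noteq> 0)"
    then have z: "R b c = 0" if "c \<in> B" for c using k[OF b, of c] BE that by auto
    have RE: "R b \<in> End E" using R[OF b] VD(2) by blast
    have "R b v = 0" for v
    proof (cases "v \<in> E")
      case True
      then obtain a where a: "v = (\<Sum>c\<in>B. a c *s c)" using span_finite[OF B(1)] B(3) by auto
      have "R b v = (\<Sum>c\<in>B. a c *s R b c)" unfolding a
        by (rule lin_sum[OF End_lin[OF RE] sE]) (use BE in auto)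
      then show ?thesis using z by simp
    next
      case False
      then show ?thesis using End_out[OF RE] by simp
    qed
    then have "R b = 0" by (simp add: fun_eq_iff)
    then show False using R[OF b] by simp
  qed
  define P where "P S \<longleftrightarrow> S \<subseteq> B \<and> S \<noteq> {} \<and> (\<forall>b\<in>S. \<exists>c\<in>S. k b c \<noteq> 0)" for S
  have "B \<noteq> {}" using B(3) E(2) by auto
  then have "P B" unfolding P_def using nxt by blast
  then obtain S where S: "P S" and Smin: "\<And>T. P T \<Longrightarrow> card S \<le> card T"
    using ex_has_least_nat[of P B card] by blast
  have SB: "S \<subseteq> B" and S0: "S \<noteq> {}" and Snxt: "\<And>b. b \<in> S \<Longrightarrow> \<exists>c\<in>S. k b c \<noteq> 0"
    using S unfolding P_def by auto
  have fS: "finite S" using SB B(1) finite_subset by blast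
  have "\<exists>b\<in>S. k b c \<noteq> 0 \<and> (\<forall>d\<in>S - {c}. k b d = 0)" if c: "c \<in> S" for c
  proof -
    have "card (S - {c}) < card S" using card_Diff1_less[OF fS c] .
    then have "\<not> P (S - {c})" using Smin[of "S - {c}"] by linarith
    \<comment> \<open>Since \<open>k c c = 0\<close>, the successor \<open>c'\<close> of
      \<open>c\<close> differs from \<open>c\<close>; so of the three clauses of \<open>P\<close>
      only the last can fail for \<open>S - {c}\<close>.\<close>
    moreover obtain c' where "c' \<in> S" "k c c' \<noteq> 0" using Snxt[OF c] by blast
    then have "S - {c} \<noteq> {}" using self c SB by blast
    ultimately obtain b where b: "b \<in> S - {c}" "\<forall>d\<in>S - {c}. k b d = 0"
      unfolding P_def using SB by blast
    then have "k b c \<noteq> 0" using Snxt[of b] by blast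
    then show ?thesis using b by blast
  qed
  then obtain h where h: "\<And>c. c \<in> S \<Longrightarrow> h c \<in> S \<and> k (h c) c \<noteq> 0 \<and> (\<forall>d\<in>S - {c}. k (h c) d = 0)"
    by metis
  have "inj_on h S" by (rule inj_onI) (metis h Diff_iff singletonD)
  then have hS: "h ` S = S" using fS h by (intro endo_inj_surj) auto
  \<comment> \<open>The coefficient \<open>1\<close> only puts the sum into the shape that
    \<open>lin_sum\<close> and \<open>independentD\<close> expect.\<close>
  define x where "x = (\<Sum>c\<in>S. 1 *s c)"
  have SE: "S \<subseteq> E" using SB BE by blast
  have xE: "x \<in> E" unfolding x_def using SE by (intro subspace_sum subspace_scale sE) auto
  have ex: "\<exists>q. q \<noteq> 0 \<and> R b x = q *s b" if b: "b \<in> S" for b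
  proof -
    obtain c where c: "c \<in> S" "b = h c" using hS b by blast
    have bB: "b \<in> B" using b SB by blast
    have "R b x = (\<Sum>d\<in>S. 1 *s R b d)" unfolding x_def
      by (rule lin_sum[OF End_lin[OF VD(2)] sE]) (use SE R[OF bB] in auto)
    also have "\<dots> = (\<Sum>d\<in>S. if d = c then k b c *s b else 0)"
      by (rule sum.cong) (use k[OF bB] SE h[OF c(1)] c(2) in auto)
    also have "\<dots> = k b c *s b" using fS c(1) by simp
    finally show ?thesis using h[OF c(1)] c(2) by blast
  qed
  then obtain q where q: "\<And>b. b \<in> S \<Longrightarrow> q b \<noteq> 0 \<and> R b x = q b *s b" by metis
  define M where "M = (\<Sum>b\<in>S. opscale (inverse (q b)) (R b))"
  have MV: "M \<in> V" unfolding M_def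
    using R SB by (intro op.subspace_sum op.subspace_scale VD(1)) auto
  have "M x = (\<Sum>b\<in>S. inverse (q b) *s R b x)" unfolding M_def sum_fun_apply by simp
  also have "\<dots> = x" unfolding x_def using q[unfolded x_def] by (intro sum.cong) auto
  finally have "x = 0" using VD(3)[OF MV xE] by simp
  then have "(\<Sum>c\<in>S. 1 *s c) = 0" unfolding x_def .
  moreover obtain c where "c \<in> S" using S0 by blast
  ultimately have "(1::'a) = 0"
    using independentD[OF B(2) fS SB, of "\<lambda>_. 1" c] by blast
  then show False by simp
qed

section \<open>Complements, projections, restricted and induced operators\<close>

definition dsum :: "'b set \<Rightarrow> 'b set \<Rightarrow> 'b set \<Rightarrow> bool" where
  "dsum E F G \<longleftrightarrow> subspace E \<and> subspace F \<and> subspace G \<and> F \<subseteq> E \<and> G \<subseteq> E \<and> F \<inter> G \<subseteq> {0} \<and>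
    (\<forall>v\<in>E. \<exists>g\<in>G. v - g \<in> F)"

text \<open>The quotient map by \<open>F\<close>, once the quotient is identified with the
  complement \<open>G\<close>. Complements keep quotients inside the same type, so that inductions
  over subspaces can pass to them.\<close>

definition prj :: "'b set \<Rightarrow> 'b set \<Rightarrow> 'b \<Rightarrow> 'b" where
  "prj F G v = (THE g. g \<in> G \<and> v - g \<in> F)"

lemma prj_eq:
  assumes "dsum E F G" "g \<in> G" "v - g \<in> F"
  shows "prj F G v = g"
  unfolding prj_def
proof (rule the_equality)
  fix g' assume g': "g' \<in> G \<and> v - g' \<in> F"
  have "(v - g) - (v - g') \<in> F" using assms g' unfolding dsum_def by (blast intro: subspace_diff)
  then have "g' - g \<in> F \<inter> G" using assms g' unfolding dsum_def by (auto intro: subspace_diff)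
  then show "g' = g" using assms unfolding dsum_def by auto
qed (use assms in auto)

lemma prj_props:
  assumes "dsum E F G" "v \<in> E"
  shows "prj F G v \<in> G" "v - prj F G v \<in> F"
proof -
  obtain g where "g \<in> G" "v - g \<in> F" using assms unfolding dsum_def by blast
  then show "prj F G v \<in> G" "v - prj F G v \<in> F" using prj_eq[OF assms(1)] by metis+
qed

lemma prj_lin:
  assumes d: "dsum E F G"
  shows "lin_on scale scale E (prj F G)"
  unfolding lin_on_def
proof (intro conjI ballI allI)
  fix u v assume u: "u \<in> E" and v: "v \<in> E"
  note pu = prj_props[OF d u] and pv = prj_props[OF d v]
  have "(u - prj F G u) + (v - prj F G v) \<in> F"
    using pu pv d unfolding dsum_def by (blast intro: subspace_add)
  then have "u + v - (prj F G u + prj F G v) \<in> F" by (simp add: algebra_simps)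
  moreover have "prj F G u + prj F G v \<in> G" using pu pv d unfolding dsum_def by (blast intro: subspace_add)
  ultimately show "prj F G (u + v) = prj F G u + prj F G v" using prj_eq[OF d] by blast
next
  fix c u assume u: "u \<in> E"
  note pu = prj_props[OF d u]
  have "c *s (u - prj F G u) \<in> F" using pu d unfolding dsum_def by (blast intro: subspace_scale)
  then have "c *s u - c *s prj F G u \<in> F" by (simp add: scale_right_diff_distrib)
  moreover have "c *s prj F G u \<in> G" using pu d unfolding dsum_def by (blast intro: subspace_scale)
  ultimately show "prj F G (c *s u) = c *s prj F G u" using prj_eq[OF d] by blast
qed

lemma prj_id: "dsum E F G \<Longrightarrow> v \<in> G \<Longrightarrow> prj F G v = v"
  using prj_eq[of E F G v v] unfolding dsum_def by (auto simp: subspace_0)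

lemma prj_zero: "dsum E F G \<Longrightarrow> v \<in> F \<Longrightarrow> prj F G v = 0"
  using prj_eq[of E F G 0 v] unfolding dsum_def by (auto simp: subspace_0)

lemma prj_zeroD: "dsum E F G \<Longrightarrow> v \<in> E \<Longrightarrow> prj F G v = 0 \<Longrightarrow> v \<in> F"
  using prj_props(2)[of E F G v] by auto

lemma complement_exists:
  assumes "fd E" "subspace F" "F \<subseteq> E"
  shows "\<exists>G. dsum E F G"
proof -
  have fF: "fd F" using fd_subset assms by blast
  obtain B where B: "finite B" "independent B" "span B = F" "card B = dim F" by (rule fd_basis[OF fF])
  have "B \<subseteq> E" using span_superset[of B] assms(3) unfolding B(3) by blast
  then obtain C where C: "B \<subseteq> C" "finite C" "independent C" "span C = E" "card C = dim E"
    by (rule fd_extend_basis[OF assms(1) _ B(2)])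
  have CE: "C = B \<union> (C - B)" using C(1) by blast
  have "dsum E F (span (C - B))"
    unfolding dsum_def
  proof (intro conjI ballI)
    show "subspace E" using fd_subspace[OF assms(1)] .
    show "subspace F" by fact
    show "subspace (span (C - B))" by (rule subspace_span)
    show "F \<subseteq> E" by fact
    show "span (C - B) \<subseteq> E" unfolding C(4)[symmetric] by (rule span_mono) auto
    show "F \<inter> span (C - B) \<subseteq> {0}"
    proof
      fix v assume "v \<in> F \<inter> span (C - B)"
      then have v: "v \<in> span B" "v \<in> span (C - B)" using B(3) by auto
      obtain a where a: "v = (\<Sum>c\<in>B. a c *s c)" using v(1) span_finite[OF B(1)] by auto
      obtain a' where a': "v = (\<Sum>c\<in>C - B. a' c *s c)" using v(2) span_finite[of "C - B"] C(2) by auto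
      \<comment> \<open>The two expansions of \<open>v\<close>, one with its sign reversed, combine
        to a single relation on the basis \<open>C\<close>.\<close>
      define e where "e c = (if c \<in> B then a c else - a' c)" for c
      have "(\<Sum>c\<in>C. e c *s c) = (\<Sum>c\<in>C - B. e c *s c) + (\<Sum>c\<in>B. e c *s c)"
        using sum.subset_diff[OF C(1,2)] .
      also have "(\<Sum>c\<in>B. e c *s c) = v" unfolding a by (rule sum.cong) (auto simp: e_def)
      also have "(\<Sum>c\<in>C - B. e c *s c) = - v" unfolding a' sum_negf[symmetric]
        by (rule sum.cong) (auto simp: e_def)
      finally have "(\<Sum>c\<in>C. e c *s c) = 0" by simp
      then have "\<forall>c\<in>C. e c = 0" using independentD[OF C(3,2) order_refl] by blast
      then have "\<forall>c\<in>B. a c = 0" using C(1) unfolding e_def by (metis subsetD)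
      then show "v \<in> {0}" unfolding a by simp
    qed
    fix v assume "v \<in> E"
    then have "v \<in> span (B \<union> (C - B))" using C(4) CE by simp
    then obtain x y where "v = x + y" "x \<in> span B" "y \<in> span (C - B)" unfolding span_Un by auto
    then show "\<exists>g\<in>span (C - B). v - g \<in> F" using B(3) by auto
  qed
  then show ?thesis by blast
qed

lemma dim_dsum:
  assumes "fd E" "dsum E F G"
  shows "dim E = dim F + dim G"
proof -
  have sE: "subspace E" using fd_subspace assms by blast
  have k: "{v \<in> E. prj F G v = 0} = F"
    using prj_zero[OF assms(2)] prj_zeroD[OF assms(2)] assms(2) unfolding dsum_def by auto
  have "x \<in> prj F G ` E" if "x \<in> G" for x
    using that prj_id[OF assms(2) that] assms(2) unfolding dsum_def by (metis image_eqI subsetD)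
  then have i: "prj F G ` E = G" using prj_props(1)[OF assms(2)] by auto
  have "fd F" "fd G" using fd_subset[OF assms(1)] assms(2) unfolding dsum_def by auto
  then show ?thesis
    using lin_pair.rank_nullity(2)[OF pair_bb prj_lin[OF assms(2)] sE] unfolding k i by blast
qed

definition restr :: "'b set \<Rightarrow> ('b \<Rightarrow> 'b) \<Rightarrow> 'b \<Rightarrow> 'b" where
  "restr F M = (\<lambda>v. if v \<in> F then M v else 0)"

text \<open>\<open>ind F G M\<close> is the operator that \<open>M\<close> induces on the quotient by \<open>F\<close>, transported to the complement \<open>G\<close>.\<close>

definition ind :: "'b set \<Rightarrow> 'b set \<Rightarrow> ('b \<Rightarrow> 'b) \<Rightarrow> 'b \<Rightarrow> 'b" where
  "ind F G M = (\<lambda>v. if v \<in> G then prj F G (M v) else 0)"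

lemma restr_lin: "lin_on opscale opscale V (restr F)"
  by (auto simp: lin_on_def restr_def fun_eq_iff plus_fun_def)

lemma ind_lin:
  assumes d: "dsum E F G" and V: "V \<subseteq> End E"
  shows "lin_on opscale opscale V (ind F G)"
proof -
  have "M v \<in> E" if "M \<in> V" "v \<in> G" for M v
    using that V d End_in unfolding dsum_def by blast
  then show ?thesis
    using lin_add[OF prj_lin[OF d]] lin_scale[OF prj_lin[OF d]]
    by (auto simp: lin_on_def ind_def fun_eq_iff plus_fun_def)
qed

lemma lin_on_subset: "lin_on s1 s2 E f \<Longrightarrow> F \<subseteq> E \<Longrightarrow> lin_on s1 s2 F f"
  unfolding lin_on_def by blast

lemma triv_restr:
  assumes V: "triv E V" and F: "subspace F" "F \<subseteq> E" and inv0: "\<forall>M\<in>V. \<forall>v\<in>F. M v \<in> F"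
  shows "triv F (restr F ` V)"
  unfolding triv_def
proof (intro conjI ballI impI subsetI)
  note inv = inv0[rule_format]
  note VD = trivD[OF V]
  show "op.subspace (restr F ` V)"
    by (rule lin_pair.subspace_lin_image[OF pair_oo restr_lin VD(1)])
  fix M assume "M \<in> restr F ` V"
  then obtain N where N: "N \<in> V" "M = restr F N" by blast
  have l: "lin_on scale scale F N" using lin_on_subset[OF End_lin[OF VD(2)[OF N(1)]] F(2)] .
  have "lin_on scale scale F M" using l F(1) unfolding N(2) restr_def lin_on_def
    by (auto simp: subspace_add subspace_scale)
  then show "M \<in> End F" unfolding End_def using inv[OF N(1)] N(2) by (auto simp: restr_def)
  fix x assume "x \<in> F" "M x = x"
  then show "x = 0" using VD(3)[OF N(1)] N(2) F(2) by (auto simp: restr_def)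
qed

text \<open>A fixed vector \<open>x\<close> of the induced operator satisfies
  \<open>N x = x + f\<close> with \<open>f\<close> in \<open>F\<close>. As \<open>1 - N\<close> is
  injective on \<open>F\<close>, it is onto by finite dimension, so \<open>f = f' - N f'\<close> and
  \<open>x + f'\<close> is fixed by \<open>N\<close>; hence \<open>x\<close> lies in both
  \<open>F\<close> and \<open>G\<close>.\<close>

lemma triv_ind:
  assumes V: "triv E V" and E: "fd E" and d: "dsum E F G"
    and inv0: "\<forall>M\<in>V. \<forall>v\<in>F. M v \<in> F"
  shows "triv G (ind F G ` V)"
  unfolding triv_def
proof (intro conjI ballI impI subsetI)
  note inv = inv0[rule_format]
  note VD = trivD[OF V]
  have sub: "subspace E" "subspace F" "subspace G" "F \<subseteq> E" "G \<subseteq> E" using d unfolding dsum_def by auto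
  show "op.subspace (ind F G ` V)"
    by (rule lin_pair.subspace_lin_image[OF pair_oo ind_lin[OF d] VD(1)]) (use VD(2) in auto)
  fix M assume "M \<in> ind F G ` V"
  then obtain N where N: "N \<in> V" "M = ind F G N" by blast
  note NE = VD(2)[OF N(1)]
  have NG: "N v \<in> E" if "v \<in> G" for v using End_in[OF NE] that sub by blast
  have "lin_on scale scale G M"
    using lin_add[OF End_lin[OF NE]] lin_scale[OF End_lin[OF NE]]
      lin_add[OF prj_lin[OF d]] lin_scale[OF prj_lin[OF d]] NG sub
    unfolding N(2) ind_def lin_on_def
    by (auto simp: subspace_add subspace_scale subset_iff)
  then show "M \<in> End G" unfolding End_def N(2) using prj_props(1)[OF d] NG by (auto simp: ind_def)
  fix x assume x: "x \<in> G" "M x = x"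
  define f where "f = N x - x"
  have xE: "x \<in> E" using x sub by blast
  have "prj F G (N x) = x" using x N(2) by (simp add: ind_def)
  then have f: "f \<in> F" using prj_props(2)[OF d NG[OF x(1)]] unfolding f_def by simp
  define g where "g v = v - N v" for v
  have gl: "lin_on scale scale F g"
    using lin_on_subset[OF End_lin[OF NE] sub(4)] unfolding lin_on_def g_def
    by (auto simp: algebra_simps scale_right_diff_distrib)
  have gF: "g ` F \<subseteq> F" unfolding g_def using inv[OF N(1)] sub(2) by (auto intro: subspace_diff)
  have fF: "fd F" using fd_subset[OF E sub(2,4)] .
  have sg: "subspace (g ` F)" by (rule lin_pair.subspace_lin_image[OF pair_bb gl sub(2)])
  have "v = 0" if "v \<in> F" "g v = 0" for v
    using VD(3)[OF N(1), of v] that sub unfolding g_def by auto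
  then have "dim F = dim (g ` F)"
    using lin_pair.dim_inj_image(2)[OF pair_bb gl sub(2)] fd_subset[OF fF sg gF] by blast
  then have "g ` F = F" using dim_eq_fd[OF fF sg gF] by simp
  then obtain f' where f': "f' \<in> F" "g f' = f" using f by (metis imageE)
  have f'E: "f' \<in> E" using f' sub by blast
  have "N (x + f') = N x + N f'" using lin_add[OF End_lin[OF NE] xE f'E] .
  also have "N x = x + f" unfolding f_def by simp
  also have "N f' = f' - f" using f'(2) unfolding g_def by (simp add: algebra_simps)
  finally have "N (x + f') = x + f'" by (simp add: algebra_simps)
  then have "x + f' = 0" using VD(3)[OF N(1)] subspace_add[OF sub(1) xE f'E] by blast
  then have "x = - f'" by (simp add: eq_neg_iff_add_eq_0)
  then have "x \<in> F" using f'(1) sub(2) by (simp add: subspace_neg)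
  then show "x = 0" using x d unfolding dsum_def by blast
qed

section \<open>The dimension bound and maximal spaces\<close>

definition ann :: "('b \<Rightarrow> 'b) set \<Rightarrow> 'b \<Rightarrow> ('b \<Rightarrow> 'b) set" where
  "ann V x = {M \<in> V. M x = 0}"

definition orb :: "('b \<Rightarrow> 'b) set \<Rightarrow> 'b \<Rightarrow> 'b set" where
  "orb V x = (\<lambda>M. M x) ` V"

lemma subspace_orb: "op.subspace V \<Longrightarrow> subspace (orb V x)"
  unfolding orb_def by (rule lin_pair.subspace_lin_image[OF pair_ob lin_eval])

text \<open>Goodness yields the faithfulness claim: an operator that kills \<open>x\<close> and
  induces zero has its image in the line of \<open>x\<close>. The last claim is the trivial spectrum
  at \<open>x\<close>.\<close>

lemma ann_props:
  assumes V: "triv E V" and E: "fd E" and x: "good E V x" and d: "dsum E (span {x}) G"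
  shows "triv E (ann V x)" "triv G (ind (span {x}) G ` ann V x)"
    "\<And>M. M \<in> ann V x \<Longrightarrow> ind (span {x}) G M = 0 \<Longrightarrow> M = 0"
    "subspace (orb V x)" "orb V x \<subseteq> E" "x \<notin> orb V x"
proof -
  note VD = trivD[OF V]
  have x': "x \<in> E" "x \<noteq> 0" "\<And>M. M \<in> V \<Longrightarrow> M ` E \<subseteq> span {x} \<Longrightarrow> M = 0"
    using x unfolding good_def by auto
  have s: "op.subspace (ann V x)" unfolding ann_def
    by (rule lin_pair.subspace_lin_kernel[OF pair_ob lin_eval VD(1)])
  then show t: "triv E (ann V x)" using V unfolding triv_def ann_def by blast
  have inv: "M v \<in> span {x}" if Mx: "M \<in> ann V x" and v: "v \<in> span {x}" for M v
  proof -
    obtain k where "v = k *s x" using v unfolding span_singleton by blast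
    moreover have "M x = 0" "lin_on scale scale E M"
      using Mx End_lin VD(2) unfolding ann_def by auto
    ultimately show ?thesis using lin_scale[of E M x k] x'(1) span_zero by simp
  qed
  show "triv G (ind (span {x}) G ` ann V x)" by (rule triv_ind[OF t E d]) (use inv in blast)
  show "M = 0" if M: "M \<in> ann V x" "ind (span {x}) G M = 0" for M
  proof (rule x'(3))
    show MV: "M \<in> V" using M unfolding ann_def by blast
    have ME: "M \<in> End E" using VD(2)[OF MV] .
    have sub: "subspace E" "span {x} \<subseteq> E" "G \<subseteq> E" using d unfolding dsum_def by auto
    show "M ` E \<subseteq> span {x}"
    proof
      fix y assume "y \<in> M ` E"
      then obtain v where v: "v \<in> E" "y = M v" by blast
      note p = prj_props[OF d v(1)]
      have "prj (span {x}) G (M (prj (span {x}) G v)) = 0"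
        using M(2) p(1) unfolding ind_def fun_eq_iff by (metis zero_fun_apply)
      then have 1: "M (prj (span {x}) G v) \<in> span {x}"
        using prj_zeroD[OF d] End_in[OF ME] p(1) sub by blast
      have 2: "M (v - prj (span {x}) G v) \<in> span {x}" using inv[OF M(1) p(2)] .
      have "M v = M (prj (span {x}) G v) + M (v - prj (span {x}) G v)"
        using lin_add[OF End_lin[OF ME], of "prj (span {x}) G v" "v - prj (span {x}) G v"] p sub
        by (auto simp: subset_iff)
      then show "y \<in> span {x}" using 1 2 v(2) span_add by metis
    qed
  qed
  show "subspace (orb V x)" by (rule subspace_orb[OF VD(1)])
  show "orb V x \<subseteq> E" unfolding orb_def using VD(2) End_in x'(1) by blast
  show "x \<notin> orb V x"
  proof
    assume "x \<in> orb V x"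
    then obtain M where "M \<in> V" "M x = x" unfolding orb_def by auto
    then show False using VD(3) x' by blast
  qed
qed

lemma dim_line: "x \<noteq> 0 \<Longrightarrow> dim (span {x}) = 1"
  using dim_span_eq_card_independent[of "{x}"] by simp

text \<open>Rank-nullity for evaluation at \<open>x\<close>: the kernel \<open>ann V x\<close> is
  measured by its faithful image on \<open>G\<close>, and the orbit is a proper subspace because it
  misses \<open>x\<close>.\<close>

lemma dim_orb_ann:
  assumes V: "triv E V" and E: "fd E" and x: "good E V x" and d: "dsum E (span {x}) G"
    and f: "op.fd (ind (span {x}) G ` ann V x)"
  shows "op.fd V" "op.dim V = dim (orb V x) + op.dim (ind (span {x}) G ` ann V x)"
    "dim (orb V x) < dim E" "dim G + 1 = dim E"
proof -
  note a = ann_props[OF V E x d]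
  note VD = trivD[OF V]
  have AE: "ann V x \<subseteq> End E" using a(1) unfolding triv_def by blast
  note inj = lin_pair.dim_inj_image[OF pair_oo ind_lin[OF d AE] trivD(1)[OF a(1)] a(3) f]
  have fo: "fd (orb V x)" using fd_subset[OF E a(4,5)] .
  note rn = lin_pair.rank_nullity[OF pair_ob lin_eval[of V x] VD(1), folded ann_def orb_def, OF inj(1) fo]
  show "op.fd V" by (rule rn(1))
  show "op.dim V = dim (orb V x) + op.dim (ind (span {x}) G ` ann V x)" using rn(2) inj(2) by simp
  have "dim (orb V x) \<noteq> dim E"
    using dim_eq_fd[OF E a(4,5)] a(6) x unfolding good_def by auto
  then show "dim (orb V x) < dim E" using dim_mono_fd[OF E a(4,5)] by simp
  have "x \<noteq> 0" using x unfolding good_def by blast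
  then have "dim (span {x}) = 1" by (rule dim_line)
  then show "dim G + 1 = dim E" using dim_dsum[OF E d] by simp
qed

lemma choose2_Suc: "Suc m choose 2 = m + (m choose 2)"
  by (simp add: numeral_2_eq_2)

lemma dsum_line:
  assumes "fd E" "good E V x"
  shows "\<exists>G. dsum E (span {x}) G"
proof (rule complement_exists[OF assms(1) subspace_span])
  show "span {x} \<subseteq> E" using assms unfolding good_def
    by (intro span_minimal fd_subspace[OF assms(1)]) auto
qed

theorem triv_dim_bound:
  assumes "fd E" "triv E V"
  shows "op.fd V \<and> op.dim V \<le> dim E choose 2"
  using assms
proof (induction "dim E" arbitrary: E V)
  case 0
  then have E: "E = {0}" using fd_dim0 by metis
  have "M = 0" if "M \<in> V" for M
  proof
    fix v show "M v = 0 v"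
      using trivD(2)[OF 0(3) that] End_in[of M E v] End_out[of M E v] E by (cases "v \<in> E") auto
  qed
  then have "V = {0}" using op.subspace_0[OF trivD(1)[OF 0(3)]] by auto
  moreover have "op.fd {0}" using op.fd_span[of "{}"] by simp
  moreover have "op.dim {0} = 0" using op.fd_dim0[of "{0}"] calculation(2) by blast
  ultimately show ?case by (metis le0)
next
  case (Suc n)
  have "E \<noteq> {0}" using Suc(2) fd_dim0[OF Suc(3)] by auto
  then obtain x where x: "good E V x" using good_exists[OF Suc(3) _ Suc(4)] by blast
  obtain G where d: "dsum E (span {x}) G" using dsum_line[OF Suc(3) x] by blast
  have "dim (span {x}) = 1" using x dim_line unfolding good_def by blast
  then have n: "n = dim G" using dim_dsum[OF Suc(3) d] Suc(2) by simp
  have G: "fd G" using fd_subset[OF Suc(3)] d unfolding dsum_def by blast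
  note IH = Suc(1)[OF n G ann_props(2)[OF Suc(4,3) x d]]
  note dd = dim_orb_ann[OF Suc(4,3) x d conjunct1[OF IH]]
  show ?case using IH dd n choose2_Suc[of n] Suc(2) by simp
qed

definition maxt :: "'b set \<Rightarrow> ('b \<Rightarrow> 'b) set \<Rightarrow> bool" where
  "maxt E V \<longleftrightarrow> fd E \<and> triv E V \<and> op.dim V = dim E choose 2"

lemma maxtD:
  assumes "maxt E V"
  shows "fd E" "triv E V" "op.dim V = dim E choose 2" "op.fd V"
  using assms triv_dim_bound unfolding maxt_def by auto

text \<open>The bounds \<open>dim G\<close> for the orbit and \<open>dim G choose 2\<close> for the
  induced space add up to \<open>dim E choose 2\<close>, so equality for the sum forces equality in
  both.\<close>

lemma maxt_good:
  assumes V: "maxt E V" and x: "good E V x" and d: "dsum E (span {x}) G"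
  shows "dim (orb V x) + 1 = dim E" "maxt G (ind (span {x}) G ` ann V x)"
proof -
  note M = maxtD[OF V]
  have G: "fd G" using fd_subset[OF M(1)] d unfolding dsum_def by blast
  note a = ann_props[OF M(2,1) x d]
  note b = triv_dim_bound[OF G a(2)]
  note dd = dim_orb_ann[OF M(2,1) x d conjunct1[OF b]]
  have "dim E choose 2 = dim G + (dim G choose 2)" using choose2_Suc[of "dim G"] dd(4) by simp
  then have "dim (orb V x) = dim G" "op.dim (ind (span {x}) G ` ann V x) = dim G choose 2"
    using dd b M(3) by linarith+
  then show "dim (orb V x) + 1 = dim E" "maxt G (ind (span {x}) G ` ann V x)"
    unfolding maxt_def using G a(2) dd(4) by auto
qed

text \<open>By \<open>t\<close> the span of \<open>V\<close> and \<open>N\<close> still has trivial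
  spectrum, and the dimension bound leaves it no room to exceed \<open>V\<close>.\<close>

lemma maxt_add:
  assumes V: "maxt E V" and N: "N \<in> End E"
    and t: "\<And>M c x. M \<in> V \<Longrightarrow> x \<in> E \<Longrightarrow> M x + c *s N x = x \<Longrightarrow> x = 0"
  shows "N \<in> V"
proof -
  note M = maxtD[OF V]
  define V' where "V' = op.span (insert N V)"
  have sV: "op.subspace V" using trivD(1)[OF M(2)] .
  have spV: "op.span V = V" using sV by (simp add: op.span_eq_iff)
  have "triv E V'"
    unfolding triv_def
  proof (intro conjI ballI impI subsetI)
    show "op.subspace V'" unfolding V'_def by (rule op.subspace_span)
    fix A assume "A \<in> V'"
    then obtain c where "A - opscale c N \<in> V" unfolding V'_def op.span_insert spV by blast
    then obtain B where B: "B \<in> V" "A = B + opscale c N" by (metis diff_add_cancel)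
    have BE: "B \<in> End E" using trivD(2)[OF M(2) B(1)] .
    have sE: "subspace E" using fd_subspace[OF M(1)] .
    show "A \<in> End E" using BE N sE unfolding B(2) End_def lin_on_def
      by (auto simp: plus_fun_def algebra_simps scale_right_distrib subspace_add subspace_scale image_subset_iff)
    fix x assume "x \<in> E" "A x = x"
    then show "x = 0" using t[OF B(1), of x c] B(2) by (simp add: plus_fun_def)
  qed
  then have b: "op.fd V'" "op.dim V' \<le> op.dim V" using triv_dim_bound[OF M(1)] M(3) by auto
  have "V \<subseteq> V'" unfolding V'_def using op.span_superset[of "insert N V"] by auto
  then have "V = V'" using op.dim_eq_fd[OF b(1) sV _ b(2)] by blast
  then show ?thesis unfolding V'_def using op.span_base[of N "insert N V"] by auto
qed


text \<open>Lines are peeled off \<open>G\<close>: evaluation at \<open>x\<close> takes values in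
  \<open>F\<close>, and a map killing \<open>x\<close> is determined by its restriction to a
  complement of the line of \<open>x\<close>.\<close>

lemma hom_dim_bound:
  assumes "fd G" "fd F" "op.subspace S"
    and "\<And>N. N \<in> S \<Longrightarrow> lin_on scale scale G N \<and> N ` G \<subseteq> F \<and> (\<forall>v. v \<notin> G \<longrightarrow> N v = 0)"
  shows "op.fd S \<and> op.dim S \<le> dim G * dim F"
  using assms(1,3,4)
proof (induction "dim G" arbitrary: G S)
  case 0
  then have G: "G = {0}" using fd_dim0 by metis
  have "N = 0" if N: "N \<in> S" for N
  proof
    fix v show "N v = 0 v"
      using 0(4)[OF N] lin_zero[of G N] G subspace_zero by (cases "v \<in> G") auto
  qed
  then have "S = {0}" using op.subspace_0[OF 0(3)] by auto
  moreover have "op.fd {0}" using op.fd_span[of "{}"] by simp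
  moreover have "op.dim {0} = 0" using op.fd_dim0[of "{0}"] calculation(2) by blast
  ultimately show ?case by (metis le0)
next
  case (Suc n)
  have "G \<noteq> {0}" using Suc(2) fd_dim0[OF Suc(3)] by auto
  then obtain x where x: "x \<in> G" "x \<noteq> 0" using subspace_0[OF fd_subspace[OF Suc(3)]] by blast
  have "span {x} \<subseteq> G" using x by (intro span_minimal fd_subspace[OF Suc(3)]) auto
  then obtain G' where d: "dsum G (span {x}) G'"
    using complement_exists[OF Suc(3) subspace_span] by blast
  have n: "n = dim G'" using dim_dsum[OF Suc(3) d] Suc(2) dim_line[OF x(2)] by simp
  have sub: "subspace G" "G' \<subseteq> G" "subspace G'" "span {x} \<subseteq> G" using d unfolding dsum_def by auto
  have G': "fd G'" using fd_subset[OF Suc(3) sub(3,2)] .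
  define K where "K = {N \<in> S. N x = 0}"
  have sK: "op.subspace K" unfolding K_def
    by (rule lin_pair.subspace_lin_kernel[OF pair_ob lin_eval Suc(4)])
  have sR: "op.subspace (restr G' ` K)"
    by (rule lin_pair.subspace_lin_image[OF pair_oo restr_lin sK])
  have "lin_on scale scale G' N \<and> N ` G' \<subseteq> F \<and> (\<forall>v. v \<notin> G' \<longrightarrow> N v = 0)"
    if N: "N \<in> restr G' ` K" for N
  proof -
    obtain N' where N': "N' \<in> S" "N = restr G' N'" using N unfolding K_def by blast
    show ?thesis using Suc(5)[OF N'(1)] sub unfolding N'(2) lin_on_def
      by (auto simp: restr_def subset_iff subspace_add subspace_scale image_subset_iff)
  qed
  note IH = Suc(1)[OF n G' sR this]
  have inj: "N = 0" if N: "N \<in> K" "restr G' N = 0" for N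
  proof
    fix v show "N v = 0 v"
    proof (cases "v \<in> G")
      case True
      note p = prj_props[OF d True]
      obtain k where k: "v - prj (span {x}) G' v = k *s x"
        using p(2) unfolding span_singleton by blast
      have NS: "N \<in> S" "N x = 0" using N(1) unfolding K_def by auto
      have l: "lin_on scale scale G N" using Suc(5)[OF NS(1)] by blast
      have 1: "N (prj (span {x}) G' v) = 0" using N(2) p(1) unfolding restr_def fun_eq_iff
        by (metis zero_fun_apply)
      have "v = prj (span {x}) G' v + k *s x" using k by (simp add: algebra_simps)
      then have "N v = N (prj (span {x}) G' v) + N (k *s x)"
        using lin_add[OF l, of "prj (span {x}) G' v" "k *s x"] p(1) x sub
        by (metis subsetD subspace_scale)
      then show ?thesis using 1 lin_scale[OF l x(1)] NS(2) by simp
    next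
      case False
      then show ?thesis using Suc(5) N(1) unfolding K_def by auto
    qed
  qed
  note ii = lin_pair.dim_inj_image[OF pair_oo restr_lin sK inj conjunct1[OF IH]]
  have im: "(\<lambda>N. N x) ` S \<subseteq> F" using Suc(5) x(1) by blast
  have sim: "subspace ((\<lambda>N. N x) ` S)"
    by (rule lin_pair.subspace_lin_image[OF pair_ob lin_eval Suc(4)])
  note rn = lin_pair.rank_nullity[OF pair_ob lin_eval[of S x] Suc(4), folded K_def,
      OF ii(1) fd_subset[OF assms(2) sim im]]
  have "op.dim S \<le> n * dim F + dim F"
    using rn(2) ii(2) IH n dim_mono_fd[OF assms(2) sim im] by simp
  then show ?case using rn(1) Suc(2) by (metis mult_Suc add.commute)
qed

text \<open>The product is the dimension of a full off-diagonal block beside two maximal diagonal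
  blocks.\<close>

lemma choose2_add: "(f + g) choose 2 = (f choose 2) + (g choose 2) + f * g"
proof (induction f)
  case (Suc f)
  then show ?case using choose2_Suc[of f] choose2_Suc[of "f + g"] by simp
qed simp

text \<open>\<open>K1\<close> and \<open>K2\<close> are the kernels of restriction and of passage to
  the quotient; their intersection \<open>K3\<close> embeds into the maps from \<open>G\<close> to
  \<open>F\<close>. Filtering \<open>V\<close> through \<open>K1\<close> or through
  \<open>K2\<close> bounds \<open>dim V\<close> by the three summands of \<open>choose2_add\<close>,
  and maximality makes each bound tight.\<close>

lemma maxt_invariant:
  assumes V: "maxt E V" and d: "dsum E F G"
    and inv0: "\<forall>M\<in>V. \<forall>v\<in>F. M v \<in> F"
  shows "maxt F (restr F ` V)" "maxt G (ind F G ` V)"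
proof -
  note inv = inv0[rule_format]
  note M = maxtD[OF V]
  note VD = trivD[OF M(2)]
  have sub: "subspace E" "subspace F" "subspace G" "F \<subseteq> E" "G \<subseteq> E" using d unfolding dsum_def by auto
  have fF: "fd F" and fG: "fd G" using fd_subset[OF M(1)] sub by auto
  note tr = triv_restr[OF M(2) sub(2,4) inv0]
  note ti = triv_ind[OF M(2,1) d inv0]
  note br = triv_dim_bound[OF fF tr] and bi = triv_dim_bound[OF fG ti]
  have VE: "V \<subseteq> End E" using VD(2) by blast
  define K1 where "K1 = {M \<in> V. restr F M = 0}"
  define K2 where "K2 = {M \<in> V. ind F G M = 0}"
  define K3 where "K3 = {M \<in> K1. ind F G M = 0}"
  have K3': "K3 = {M \<in> K2. restr F M = 0}" unfolding K1_def K2_def K3_def by blast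
  have s1: "op.subspace K1" unfolding K1_def
    by (rule lin_pair.subspace_lin_kernel[OF pair_oo restr_lin VD(1)])
  have s2: "op.subspace K2" unfolding K2_def
    by (rule lin_pair.subspace_lin_kernel[OF pair_oo ind_lin[OF d VE] VD(1)])
  have K1V: "K1 \<subseteq> V" and K2V: "K2 \<subseteq> V" unfolding K1_def K2_def by auto
  have l1: "lin_on opscale opscale K1 (ind F G)" using ind_lin[OF d] K1V VE by blast
  have s3: "op.subspace K3" unfolding K3_def
    by (rule lin_pair.subspace_lin_kernel[OF pair_oo l1 s1])
  have K3p: "M v = 0" if "M \<in> K3" "v \<in> F" for M v
    using that unfolding K3_def K1_def restr_def fun_eq_iff by (auto split: if_splits)
  have K3q: "M v \<in> F" if "M \<in> K3" "v \<in> G" for M v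
  proof -
    have "prj F G (M v) = 0" using that unfolding K3_def ind_def fun_eq_iff by (auto split: if_splits)
    moreover have "M v \<in> E" using that VE K1V sub(5) End_in unfolding K3_def by blast
    ultimately show ?thesis using prj_zeroD[OF d] by blast
  qed
  have K3E: "M \<in> End E" if "M \<in> K3" for M using that K1V VE unfolding K3_def by blast
  have "op.subspace (restr G ` K3)" by (rule lin_pair.subspace_lin_image[OF pair_oo restr_lin s3])
  moreover have "lin_on scale scale G N \<and> N ` G \<subseteq> F \<and> (\<forall>v. v \<notin> G \<longrightarrow> N v = 0)"
    if N: "N \<in> restr G ` K3" for N
  proof -
    obtain N' where N': "N' \<in> K3" "N = restr G N'" using N by blast
    have "lin_on scale scale G N'" using lin_on_subset[OF End_lin[OF K3E[OF N'(1)]] sub(5)] .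
    then show ?thesis using K3q[OF N'(1)] sub(3) unfolding N'(2) lin_on_def
      by (auto simp: restr_def subspace_add subspace_scale image_subset_iff)
  qed
  ultimately have hb: "op.fd (restr G ` K3)" "op.dim (restr G ` K3) \<le> dim G * dim F"
    using hom_dim_bound[OF fG fF] by blast+
  have inj: "M = 0" if N: "M \<in> K3" "restr G M = 0" for M
  proof
    fix v show "M v = 0 v"
    proof (cases "v \<in> E")
      case True
      note p = prj_props[OF d True]
      have 1: "M (prj F G v) = 0" using N(2) p(1) unfolding restr_def fun_eq_iff
        by (metis zero_fun_apply)
      have 2: "M (v - prj F G v) = 0" using K3p[OF N(1) p(2)] .
      have "M v = M (prj F G v) + M (v - prj F G v)"
        using lin_add[OF End_lin[OF K3E[OF N(1)]], of "prj F G v" "v - prj F G v"] p sub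
        by (auto simp: subset_iff)
      then show ?thesis using 1 2 by simp
    next
      case False
      then show ?thesis using End_out[OF K3E[OF N(1)]] by simp
    qed
  qed
  note d3 = lin_pair.dim_inj_image[OF pair_oo restr_lin s3 inj hb(1)]
  have si1: "op.subspace (ind F G ` K1)" by (rule lin_pair.subspace_lin_image[OF pair_oo l1 s1])
  have fi1: "op.fd (ind F G ` K1)"
    by (rule op.fd_subset[OF conjunct1[OF bi] si1]) (use K1V in blast)
  have si2: "op.subspace (restr F ` K2)" by (rule lin_pair.subspace_lin_image[OF pair_oo restr_lin s2])
  have fi2: "op.fd (restr F ` K2)"
    by (rule op.fd_subset[OF conjunct1[OF br] si2]) (use K2V in blast)
  note r1 = lin_pair.rank_nullity[OF pair_oo l1 s1, folded K3_def, OF d3(1) fi1]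
  note r2 = lin_pair.rank_nullity[OF pair_oo restr_lin s2, of F, folded K3', OF d3(1) fi2]
  have q1: "op.dim (ind F G ` K1) \<le> dim G choose 2"
    using op.dim_mono_fd[OF conjunct1[OF bi] si1] bi K1V by (meson image_mono order_trans)
  have q2: "op.dim (restr F ` K2) \<le> dim F choose 2"
    using op.dim_mono_fd[OF conjunct1[OF br] si2] br K2V by (meson image_mono order_trans)
  note R1 = lin_pair.rank_nullity[OF pair_oo restr_lin[of V F] VD(1), folded K1_def, OF r1(1) conjunct1[OF br]]
  note R2 = lin_pair.rank_nullity[OF pair_oo ind_lin[OF d VE] VD(1), folded K2_def, OF r2(1) conjunct1[OF bi]]
  have tot: "op.dim V = (dim F choose 2) + (dim G choose 2) + dim F * dim G"
    using M(3) dim_dsum[OF M(1) d] choose2_add by simp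
  have h: "op.dim K3 \<le> dim F * dim G" using d3(2) hb(2) by (simp add: mult.commute)
  have "op.dim (restr F ` V) = dim F choose 2" using R1(2) r1(2) q1 h tot br by linarith
  then show "maxt F (restr F ` V)" unfolding maxt_def using fF tr by blast
  have "op.dim (ind F G ` V) = dim G choose 2" using R2(2) r2(2) q2 h tot bi by linarith
  then show "maxt G (ind F G ` V)" unfolding maxt_def using fG ti by blast
qed

section \<open>Invariant forms\<close>

definition bil :: "'b set \<Rightarrow> ('b \<Rightarrow> 'b \<Rightarrow> 'a) \<Rightarrow> bool" where
  "bil E b \<longleftrightarrow> (\<forall>y\<in>E. lin_on scale (*) E (b y)) \<and> (\<forall>y\<in>E. lin_on scale (*) E (\<lambda>z. b z y))"

text \<open>\<open>F\<close> is the sum of all blocks but the last one, and \<open>b\<close> comes from the inverse of the last block.\<close>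

definition flagform :: "'b set \<Rightarrow> ('b \<Rightarrow> 'b) set \<Rightarrow> 'b set \<Rightarrow> ('b \<Rightarrow> 'b \<Rightarrow> 'a) \<Rightarrow> bool" where
  "flagform E V F b \<longleftrightarrow> subspace F \<and> F \<subseteq> E \<and> F \<noteq> E \<and> (\<forall>M\<in>V. \<forall>v\<in>F. M v \<in> F) \<and> bil E b \<and>
    (\<forall>f\<in>F. \<forall>y\<in>E. b f y = 0 \<and> b y f = 0) \<and> (\<forall>y\<in>E. y \<notin> F \<longrightarrow> b y y \<noteq> 0) \<and>
    (\<forall>M\<in>V. \<forall>y\<in>E. b y (M y) = 0)"

lemma flagformD:
  assumes "flagform E V F b"
  shows "subspace F" "F \<subseteq> E" "F \<noteq> E" "\<And>M v. M \<in> V \<Longrightarrow> v \<in> F \<Longrightarrow> M v \<in> F" "bil E b"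
    "\<And>f y. f \<in> F \<Longrightarrow> y \<in> E \<Longrightarrow> b f y = 0" "\<And>f y. f \<in> F \<Longrightarrow> y \<in> E \<Longrightarrow> b y f = 0"
    "\<And>y. y \<in> E \<Longrightarrow> y \<notin> F \<Longrightarrow> b y y \<noteq> 0" "\<And>M y. M \<in> V \<Longrightarrow> y \<in> E \<Longrightarrow> b y (M y) = 0"
  using assms unfolding flagform_def by auto

lemma bilD:
  assumes "bil E b"
  shows "u \<in> E \<Longrightarrow> v \<in> E \<Longrightarrow> w \<in> E \<Longrightarrow> b w (u + v) = b w u + b w v"
    "u \<in> E \<Longrightarrow> v \<in> E \<Longrightarrow> w \<in> E \<Longrightarrow> b (u + v) w = b u w + b v w"
    "u \<in> E \<Longrightarrow> w \<in> E \<Longrightarrow> b w (c *s u) = c * b w u"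
    "u \<in> E \<Longrightarrow> w \<in> E \<Longrightarrow> b (c *s u) w = c * b u w"
  using assms unfolding bil_def lin_on_def by auto

lemma bil_diff:
  assumes "bil E b" "subspace E" "u \<in> E" "v \<in> E" "w \<in> E"
  shows "b w (u - v) = b w u - b w v" "b (u - v) w = b u w - b v w"
proof -
  have "- v \<in> E" using assms subspace_neg by blast
  then show "b w (u - v) = b w u - b w v" "b (u - v) w = b u w - b v w"
    using bilD(1,2)[OF assms(1), of u "- v" w] bilD(3,4)[OF assms(1,4,5), of "- 1"] assms by auto
qed

text \<open>Adding \<open>N\<close> to \<open>V\<close> does not create fixed vectors, so the dimension bound forces \<open>N \<in> V\<close>.\<close>

lemma flagform_saturated:
  assumes V: "maxt E V" and F: "flagform E V F b" and N: "N \<in> End E"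
    and NF: "\<And>f. f \<in> F \<Longrightarrow> N f = 0" and Nb: "\<And>w. w \<in> E \<Longrightarrow> b w (N w) = 0"
  shows "N \<in> V"
proof (rule maxt_add[OF V N])
  note M = maxtD[OF V]
  note FD = flagformD[OF F]
  fix A c x assume A: "A \<in> V" and x: "x \<in> E" and eq: "A x + c *s N x = x"
  have AE: "A x \<in> E" "N x \<in> E" using End_in[OF trivD(2)[OF M(2) A] x] End_in[OF N x] .
  have sE: "subspace E" using fd_subspace[OF M(1)] .
  show "x = 0"
  proof (cases "x \<in> F")
    case True
    then have "A x = x" using eq NF by simp
    then show ?thesis using trivD(3)[OF M(2) A x] by blast
  next
    case False
    have "b x x = b x (A x) + c * b x (N x)"
      using bilD(1)[OF FD(5) AE(1) subspace_scale[OF sE AE(2)] x, of c] bilD(3)[OF FD(5) AE(2) x, of c] eq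
      by simp
    also have "\<dots> = 0" using FD(9)[OF A x] Nb[OF x] by simp
    finally show ?thesis using FD(8)[OF x False] by simp
  qed
qed

text \<open>The operator \<open>w \<mapsto> b w y *s z - b w z *s y\<close> is alternating for
  \<open>b\<close> and kills the radical, so saturation puts it into \<open>V\<close>; at
  \<open>y\<close> it takes the value \<open>b y y *s z\<close>.\<close>

lemma flagform_hit:
  assumes V: "maxt E V" and F: "flagform E V F b"
    and y: "y \<in> E" "y \<notin> F" and z: "z \<in> E" "b y z = 0"
  shows "\<exists>N\<in>V. N y = z \<and> (\<forall>f\<in>F. N f = 0)"
proof -
  note M = maxtD[OF V]
  note FD = flagformD[OF F]
  have sE: "subspace E" using fd_subspace[OF M(1)] .
  define N where "N w = (if w \<in> E then b w y *s z - b w z *s y else 0)" for w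
  have NE: "N \<in> End E"
    unfolding End_def lin_on_def N_def using y z sE bilD[OF FD(5)]
    by (auto simp: subspace_add subspace_scale subspace_diff scale_left_distrib
        scale_right_diff_distrib algebra_simps)
  have "N \<in> V"
  proof (rule flagform_saturated[OF V F NE])
    fix f assume "f \<in> F" then show "N f = 0" unfolding N_def using FD(6) y z by simp
  next
    fix w assume w: "w \<in> E"
    show "b w (N w) = 0" unfolding N_def
      using w y z bil_diff(1)[OF FD(5) sE] bilD(3)[OF FD(5)] by (simp add: subspace_scale[OF sE])
  qed
  then have "opscale (inverse (b y y)) N \<in> V"
    by (rule op.subspace_scale[OF trivD(1)[OF M(2)]])
  moreover have "opscale (inverse (b y y)) N y = z" using FD(8)[OF y] y z by (simp add: N_def)
  moreover have "opscale (inverse (b y y)) N f = 0" if "f \<in> F" for f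
    using that FD(2,6) y z by (auto simp: N_def)
  ultimately show ?thesis by blast
qed

text \<open>Pulling \<open>b'\<close> back along the projection works because, by invariance of
  \<open>F\<close>, the projection intertwines \<open>M\<close> with the induced operator; this is
  \<open>pM\<close>.\<close>

lemma flagform_quotient:
  assumes V: "triv E V" and d: "dsum E F G"
    and inv0: "\<forall>M\<in>V. \<forall>v\<in>F. M v \<in> F"
    and q: "flagform G (ind F G ` V) F' b'"
  shows "\<exists>F b. flagform E V F b"
proof -
  note inv = inv0[rule_format]
  note FD = flagformD[OF q]
  note VD = trivD[OF V]
  note pl = prj_lin[OF d] and pG = prj_props(1)[OF d]
  have sub: "subspace E" "subspace F" "subspace G" "F \<subseteq> E" "G \<subseteq> E" using d unfolding dsum_def by auto
  have pM: "prj F G (M v) = ind F G M (prj F G v)" if M: "M \<in> V" and v: "v \<in> E" for M v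
  proof -
    note p = prj_props[OF d v]
    note ME = VD(2)[OF M]
    have in': "prj F G v \<in> E" "v - prj F G v \<in> E" using p sub by auto
    have "M v = M (prj F G v) + M (v - prj F G v)" using lin_add[OF End_lin[OF ME] in'] by simp
    then have "prj F G (M v) = prj F G (M (prj F G v)) + prj F G (M (v - prj F G v))"
      using lin_add[OF pl] End_in[OF ME] in' by simp
    then show ?thesis using prj_zero[OF d inv[OF M p(2)]] p(1) by (simp add: ind_def)
  qed
  define K where "K = {v \<in> E. prj F G v \<in> F'}"
  define b where "b u v = b' (prj F G u) (prj F G v)" for u v
  have "flagform E V K b"
    unfolding flagform_def
  proof (intro conjI ballI impI)
    show "subspace K" unfolding K_def subspace_def
      using sub lin_add[OF pl] lin_scale[OF pl] lin_zero[OF pl sub(1)] FD(1)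
      by (auto simp: subspace_0 subspace_add subspace_scale)
    show "K \<subseteq> E" unfolding K_def by blast
    obtain g where "g \<in> G" "g \<notin> F'" using FD(2,3) by blast
    then have "g \<in> E" "g \<notin> K" using prj_id[OF d, of g] sub(5) unfolding K_def by auto
    then show "K \<noteq> E" by blast
    show "bil E b" unfolding bil_def b_def lin_on_def
      using bilD[OF FD(5)] pG lin_add[OF pl] lin_scale[OF pl] by auto
    fix M assume M: "M \<in> V"
    show "M v \<in> K" if v: "v \<in> K" for v
    proof -
      have "v \<in> E" "prj F G v \<in> F'" using v unfolding K_def by auto
      then show ?thesis unfolding K_def using pM[OF M] FD(4)[of "ind F G M"] M End_in[OF VD(2)[OF M]] by auto
    qed
    show "b y (M y) = 0" if y: "y \<in> E" for y
      unfolding b_def pM[OF M y] using FD(9) M pG[OF y] by blast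
  next
    fix f y assume "f \<in> K" "y \<in> E"
    then show "b f y = 0" "b y f = 0" unfolding b_def K_def using FD(6,7) pG by auto
  next
    fix y assume "y \<in> E" "y \<notin> K"
    then show "b y y \<noteq> 0" unfolding b_def K_def using FD(8) pG by auto
  qed
  then show ?thesis by blast
qed

end

section \<open>The invariant form of a maximal space\<close>

text \<open>The situation of the induction step: \<open>E\<close> is the direct sum of the line of \<open>x\<close> and \<open>H = V x\<close>, with coordinate
  \<open>\<phi>\<close> and projection \<open>\<pi>\<close>; \<open>F\<close> and \<open>b\<close> belong to the space induced on \<open>H\<close> by the operators killing \<open>x\<close>.\<close>

locale peel_step = endo_space scale
  for scale :: "'a::field \<Rightarrow> 'b::ab_group_add \<Rightarrow> 'b" (infixr \<open>*s\<close> 75) +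
  fixes E :: "'b set" and V :: "('b \<Rightarrow> 'b) set" and x :: 'b and H F :: "'b set"
    and b :: "'b \<Rightarrow> 'b \<Rightarrow> 'a" and \<phi> :: "'b \<Rightarrow> 'a" and \<pi> :: "'b \<Rightarrow> 'b" and c0 :: 'a
  assumes sE: "subspace E" and sH: "subspace H" and HE: "H \<subseteq> E" and xE: "x \<in> E"
    and V: "triv E V"
    and split: "\<And>v. v \<in> E \<Longrightarrow> \<pi> v \<in> H \<and> v = \<phi> v *s x + \<pi> v"
    and pi_lin: "lin_on scale scale E \<pi>" and phi_lin: "lin_on scale (*) E \<phi>"
    and pi_H: "\<And>h. h \<in> H \<Longrightarrow> \<pi> h = h \<and> \<phi> h = 0" and x_split: "\<pi> x = 0" "\<phi> x = 1"
    and orbit: "\<And>M. M \<in> V \<Longrightarrow> M x \<in> H" "\<And>h. h \<in> H \<Longrightarrow> \<exists>M\<in>V. M x = h"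
    and sF: "subspace F" and FH: "F \<subseteq> H" "F \<noteq> H" and bil: "bil H b"
    and bF: "\<And>f y. f \<in> F \<Longrightarrow> y \<in> H \<Longrightarrow> b f y = 0 \<and> b y f = 0"
    and aniso: "\<And>y. y \<in> H \<Longrightarrow> y \<notin> F \<Longrightarrow> b y y \<noteq> 0"
    and hit: "\<And>y z. y \<in> H \<Longrightarrow> y \<notin> F \<Longrightarrow> z \<in> H \<Longrightarrow> b y z = 0 \<Longrightarrow>
      \<exists>N\<in>V. N x = 0 \<and> \<pi> (N y) = z \<and> (\<forall>f\<in>F. \<pi> (N f) = 0)"
    and c0: "c0 \<noteq> 0" "c0 \<noteq> 1"
begin

lemmas VD = trivD[OF V]

lemma H_closed [simp]: "0 \<in> H" "u \<in> H \<Longrightarrow> v \<in> H \<Longrightarrow> u + v \<in> H" "u \<in> H \<Longrightarrow> v \<in> H \<Longrightarrow> u - v \<in> H"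
    "u \<in> H \<Longrightarrow> c *s u \<in> H"
  and E_closed [simp]: "0 \<in> E" "u \<in> E \<Longrightarrow> v \<in> E \<Longrightarrow> u + v \<in> E" "u \<in> E \<Longrightarrow> v \<in> E \<Longrightarrow> u - v \<in> E"
    "u \<in> E \<Longrightarrow> c *s u \<in> E"
  and HE' [simp]: "u \<in> H \<Longrightarrow> u \<in> E" and xE' [simp]: "x \<in> E"
  using sH sE HE xE by (auto simp: subspace_0 subspace_add subspace_diff subspace_scale)

lemma VE [simp]: "M \<in> V \<Longrightarrow> v \<in> E \<Longrightarrow> M v \<in> E"
  using VD(2) End_in by blast

lemma V_lin [simp]:
  assumes "M \<in> V"
  shows "u \<in> E \<Longrightarrow> v \<in> E \<Longrightarrow> M (u + v) = M u + M v" "u \<in> E \<Longrightarrow> M (c *s u) = c *s M u"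
    "u \<in> E \<Longrightarrow> v \<in> E \<Longrightarrow> M (u - v) = M u - M v"
  using lin_add[OF End_lin[OF VD(2)[OF assms]]] lin_scale[OF End_lin[OF VD(2)[OF assms]]]
    lin_diff[OF End_lin[OF VD(2)[OF assms]] sE] by auto

lemma pi_simps [simp]:
  "u \<in> E \<Longrightarrow> v \<in> E \<Longrightarrow> \<pi> (u + v) = \<pi> u + \<pi> v" "u \<in> E \<Longrightarrow> \<pi> (c *s u) = c *s \<pi> u"
  "u \<in> E \<Longrightarrow> v \<in> E \<Longrightarrow> \<pi> (u - v) = \<pi> u - \<pi> v" "u \<in> E \<Longrightarrow> \<pi> u \<in> H"
  "u \<in> H \<Longrightarrow> \<pi> u = u" "u \<in> H \<Longrightarrow> \<phi> u = 0" "\<pi> x = 0" "\<phi> x = 1"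
  using lin_add[OF pi_lin] lin_scale[OF pi_lin] lin_diff[OF pi_lin sE] split pi_H x_split by auto

lemma phi_simps [simp]:
  "u \<in> E \<Longrightarrow> v \<in> E \<Longrightarrow> \<phi> (u + v) = \<phi> u + \<phi> v" "u \<in> E \<Longrightarrow> \<phi> (c *s u) = c * \<phi> u"
  using phi_lin by (auto simp: lin_on_def)

lemma phi_diff [simp]: "u \<in> E \<Longrightarrow> v \<in> E \<Longrightarrow> \<phi> (u - v) = \<phi> u - \<phi> v"
  using phi_simps(1)[of u "(-1) *s v"] phi_simps(2)[of v "-1"] subspace_neg[OF sE, of v] by simp

lemma orbit_H [simp]: "M \<in> V \<Longrightarrow> M x \<in> H"
  by (rule orbit(1))

lemma b_simps [simp]:
  "u \<in> H \<Longrightarrow> v \<in> H \<Longrightarrow> w \<in> H \<Longrightarrow> b w (u + v) = b w u + b w v"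
  "u \<in> H \<Longrightarrow> v \<in> H \<Longrightarrow> w \<in> H \<Longrightarrow> b (u + v) w = b u w + b v w"
  "u \<in> H \<Longrightarrow> w \<in> H \<Longrightarrow> b w (c *s u) = c * b w u"
  "u \<in> H \<Longrightarrow> w \<in> H \<Longrightarrow> b (c *s u) w = c * b u w"
  "u \<in> H \<Longrightarrow> v \<in> H \<Longrightarrow> w \<in> H \<Longrightarrow> b w (u - v) = b w u - b w v"
  "u \<in> H \<Longrightarrow> v \<in> H \<Longrightarrow> w \<in> H \<Longrightarrow> b (u - v) w = b u w - b v w"
  using bilD[OF bil] bil_diff[OF bil sH] by auto

lemma V_closed [simp]:
  "M \<in> V \<Longrightarrow> N \<in> V \<Longrightarrow> (\<lambda>v. M v + N v) \<in> V" "M \<in> V \<Longrightarrow> N \<in> V \<Longrightarrow> (\<lambda>v. M v - N v) \<in> V"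
  "M \<in> V \<Longrightarrow> (\<lambda>v. c *s M v) \<in> V"
  using op_addI op_diffI op_scaleI VD(1) by auto

lemma nonfixed: "M \<in> V \<Longrightarrow> v \<in> E \<Longrightarrow> \<pi> v \<noteq> 0 \<Longrightarrow> M v \<noteq> v"
  using VD(3)[of M v] pi_simps(5)[of 0] by auto

lemma not_F_nonzero: "y \<notin> F \<Longrightarrow> y \<noteq> 0"
  using subspace_0[OF sF] by auto

text \<open>Subtracting an operator that kills \<open>x\<close> leaves the value at \<open>x\<close>
  alone, and \<open>hit\<close> supplies one that removes from \<open>\<pi> (A y)\<close> its part
  orthogonal to \<open>y\<close>. What remains of \<open>A y\<close> lies in the plane of
  \<open>y\<close> and \<open>x\<close>.\<close>

lemma adjust:
  assumes y: "y \<in> H" "y \<notin> F" and A: "A \<in> V"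
  shows "\<exists>A'\<in>V. A' x = A x \<and> (\<exists>p q. A' y = p *s y + q *s x)"
proof -
  define p where "p = b y (\<pi> (A y)) / b y y"
  define z where "z = \<pi> (A y) - p *s y"
  have z: "z \<in> H" unfolding z_def using y A by simp
  have "b y z = 0" unfolding z_def using y A aniso[OF y] by (simp add: p_def)
  then obtain N where N: "N \<in> V" "N x = 0" "\<pi> (N y) = z" using hit[OF y z] by blast
  let ?A = "\<lambda>v. A v - N v"
  have AV: "?A \<in> V" using A N by simp
  have "\<pi> (?A y) = p *s y" using N A y by (simp add: z_def)
  then have "?A y = p *s y + \<phi> (?A y) *s x" using split[OF VE[OF AV, of y]] y by (simp add: add.commute)
  then show ?thesis using AV N(2) by (intro bexI[of _ ?A]) auto
qed

text \<open>A quadratic in \<open>l\<close> with leading coefficient -1 has at most two roots, while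
  0, 1 and \<open>c0\<close> are three points. Over the field with two elements
  \<open>l * (1 - l)\<close> vanishes identically.\<close>

lemma exists_nonroot:
  fixes a d e :: 'a
  shows "\<exists>l. (a + l) * (d - l) - e \<noteq> 0"
proof (rule ccontr)
  assume "\<not> ?thesis"
  then have q: "(a + l) * (d - l) - e = 0" for l by blast
  have "d - a - 1 = 0" using q[of 0] q[of 1] by (simp add: algebra_simps)
  moreover have "c0 * (d - a - c0) = 0" using q[of 0] q[of c0] by (simp add: algebra_simps)
  ultimately show False using c0 by auto
qed

text \<open>An operator \<open>M0\<close> killing \<open>x\<close> with \<open>M0 y = x + z\<close> yields a fixed vector \<open>y + l *s x\<close>: with \<open>A x = y\<close> and \<open>B x = z\<close>,
  both adjusted at \<open>y\<close>, the equations for a combination of \<open>A\<close>, \<open>B\<close>, \<open>M0\<close> have a determinant that is quadratic in \<open>l\<close>.\<close>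

lemma ann_image_H:
  assumes M: "M \<in> V" "M x = 0" and y: "y \<in> H"
  shows "\<phi> (M y) = 0"
proof -
  have main: "\<phi> (M y) = 0" if y: "y \<in> H" "y \<notin> F" for y
  proof (rule ccontr)
    assume nz: "\<phi> (M y) \<noteq> 0"
    define M0 where "M0 = (\<lambda>v. inverse (\<phi> (M y)) *s M v)"
    have M0: "M0 \<in> V" "M0 x = 0" "\<phi> (M0 y) = 1" unfolding M0_def using M y nz by auto
    define z where "z = \<pi> (M0 y)"
    have z: "z \<in> H" unfolding z_def using M0 y by simp
    have M0y: "M0 y = x + z" using split[OF VE[OF M0(1), of y]] y M0(3) unfolding z_def by simp
    obtain A0 where A0: "A0 \<in> V" "A0 x = y" using orbit(2)[OF y(1)] by blast
    obtain A p q where A: "A \<in> V" "A x = y" "A y = p *s y + q *s x" using adjust[OF y A0(1)] A0(2) by auto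
    obtain B0 where B0: "B0 \<in> V" "B0 x = z" using orbit(2)[OF z] by blast
    obtain B r s where B: "B \<in> V" "B x = z" "B y = r *s y + s *s x" using adjust[OF y B0(1)] B0(2) by auto
    obtain l where l: "(p + l) * (s - l) - r * q \<noteq> 0" using exists_nonroot by blast
    define D where "D = (p + l) * (s - l) - r * q"
    \<comment> \<open>Cramer's rule, with determinant \<open>D\<close>, for the equations
      \<open>e1\<close> and \<open>e2\<close>, which compare the coefficients of \<open>y\<close>
      and of \<open>x\<close> in \<open>T v = v\<close>.\<close>
    define \<alpha> where "\<alpha> = ((s - l) - r * l) / D"
    define \<beta> where "\<beta> = ((p + l) * l - q) / D"
    have D0: "D \<noteq> 0" using l D_def by simp
    have "\<alpha> * (p + l) + \<beta> * r = (((s - l) - r * l) * (p + l) + ((p + l) * l - q) * r) / D"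
      unfolding \<alpha>_def \<beta>_def by (simp add: add_divide_distrib)
    also have "((s - l) - r * l) * (p + l) + ((p + l) * l - q) * r = D" unfolding D_def
      by (simp add: algebra_simps)
    finally have e1: "\<alpha> * (p + l) + \<beta> * r = 1" using D0 by simp
    have "\<alpha> * q + \<beta> * (s - l) = (((s - l) - r * l) * q + ((p + l) * l - q) * (s - l)) / D"
      unfolding \<alpha>_def \<beta>_def by (simp add: add_divide_distrib)
    also have "((s - l) - r * l) * q + ((p + l) * l - q) * (s - l) = l * D" unfolding D_def
      by (simp add: algebra_simps)
    finally have e2: "\<alpha> * q + \<beta> * (s - l) = l" using D0 by simp
    define v where "v = y + l *s x"
    \<comment> \<open>The multiple of \<open>M0\<close> cancels the \<open>z\<close>-term of
      \<open>B v\<close> and accounts for the \<open>- l\<close> in \<open>s - l\<close>.\<close>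
    define T where "T = (\<lambda>v. (\<alpha> *s A v + \<beta> *s B v) - (l * \<beta>) *s M0 v)"
    have TV: "T \<in> V" unfolding T_def using A B M0 by simp
    have vE: "v \<in> E" unfolding v_def using y by simp
    have Av: "A v = (p + l) *s y + q *s x" unfolding v_def using A y by (simp add: scale_left_distrib algebra_simps)
    have Bv: "B v = r *s y + s *s x + l *s z" unfolding v_def using B y by simp
    have Mv: "M0 v = x + z" unfolding v_def using M0 y M0y by simp
    have "T v = (\<alpha> * (p + l) + \<beta> * r) *s y + (\<alpha> * q + \<beta> * (s - l)) *s x"
      unfolding T_def Av Bv Mv
      by (simp add: scale_right_distrib scale_left_distrib scale_right_diff_distrib
          scale_left_diff_distrib algebra_simps)
    then have "T v = v" unfolding e1 e2 v_def by simp
    moreover have "\<pi> v \<noteq> 0" unfolding v_def using y not_F_nonzero by simp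
    ultimately show False using nonfixed[OF TV vE] by blast
  qed
  show ?thesis
  proof (cases "y \<in> F")
    case True
    \<comment> \<open>Both \<open>y + h\<close> and \<open>h\<close> lie outside \<open>F\<close>,
      where the claim is already known.\<close>
    obtain h where h: "h \<in> H" "h \<notin> F" using FH by blast
    have "y + h \<notin> F" using h(2) True subspace_diff[OF sF, of "y + h" y] by auto
    then have "\<phi> (M (y + h)) = 0" using main[of "y + h"] y h(1) by simp
    then show ?thesis using main[OF h] M y h by simp
  qed (use main y in blast)
qed

text \<open>Operators killing \<open>x\<close> now map \<open>H\<close> into itself, so the
  projection in \<open>hit\<close> disappears.\<close>

lemma hit_H:
  assumes y: "y \<in> H" "y \<notin> F" and z: "z \<in> H" "b y z = 0"
  shows "\<exists>N\<in>V. N x = 0 \<and> N y = z"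
proof -
  obtain N where N: "N \<in> V" "N x = 0" "\<pi> (N y) = z" using hit[OF y z] by blast
  have "N y = z" using split[OF VE[OF N(1), of y]] ann_image_H[OF N(1,2) y(1)] N(3) y by simp
  then show ?thesis using N by blast
qed

text \<open>Otherwise \<open>M\<close> plus an operator killing \<open>x\<close> would fix \<open>y + \<phi> (M y) *s x\<close>.\<close>

lemma unsolvable:
  assumes y: "y \<in> H" "y \<notin> F" and M: "M \<in> V"
  shows "b y (\<pi> (M y)) + \<phi> (M y) * b y (M x) \<noteq> b y y"
proof
  assume eq: "b y (\<pi> (M y)) + \<phi> (M y) * b y (M x) = b y y"
  define t where "t = \<phi> (M y)"
  define v where "v = y + t *s x"
  \<comment> \<open>What an operator killing \<open>x\<close> must contribute at \<open>y\<close> in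
    order that \<open>v\<close> becomes fixed; the assumed equation says that it is orthogonal to
    \<open>y\<close>.\<close>
  define D where "D = y - (\<pi> (M y) + t *s M x)"
  have D: "D \<in> H" unfolding D_def using y M by simp
  have "b y D = 0" unfolding D_def using y M eq by (simp add: t_def)
  then obtain N where N: "N \<in> V" "N x = 0" "N y = D" using hit_H[OF y D] by blast
  have vE: "v \<in> E" unfolding v_def using y by simp
  have My: "M y = t *s x + \<pi> (M y)" using split[OF VE[OF M, of y]] y unfolding t_def by simp
  have "M v + N v = M y + t *s M x + D" unfolding v_def using M N y by simp
  also have "\<dots> = v" unfolding D_def v_def by (subst My) simp
  finally have "M v + N v = v" .
  moreover have "(\<lambda>v. M v + N v) \<in> V" using M N by simp
  moreover have "\<pi> v \<noteq> 0" unfolding v_def using y not_F_nonzero by simp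
  ultimately show False using nonfixed[OF _ vE] by blast
qed

lemma kernel_F:
  assumes "z \<in> H" "\<And>w. w \<in> H \<Longrightarrow> b w z = 0"
  shows "z \<in> F"
  using assms aniso by blast

text \<open>Apply the previous constraint to all \<open>w + t *s f\<close>: the form does not see \<open>f\<close>, so the coefficient of \<open>t\<close> vanishes.\<close>

lemma F_almost_invariant:
  assumes M: "M \<in> V" and f: "f \<in> F"
  shows "\<pi> (M f) + \<phi> (M f) *s M x \<in> F"
proof (rule kernel_F)
  have fH: "f \<in> H" using f FH by blast
  show "\<pi> (M f) + \<phi> (M f) *s M x \<in> H" using M fH by simp
  fix w assume w: "w \<in> H"
  show "b w (\<pi> (M f) + \<phi> (M f) *s M x) = 0"
  proof (cases "w \<in> F")
    case True
    then show ?thesis using bF M fH by simp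
  next
    case False
    define P where "P v = b w (\<pi> (M v)) + \<phi> (M v) * b w (M x)" for v
    have ne: "P w + t * P f \<noteq> b w w" for t
    proof -
      define y where "y = w + t *s f"
      have y: "y \<in> H" "y \<notin> F"
        using w fH f False subspace_diff[OF sF, of y "t *s f"] subspace_scale[OF sF f]
        unfolding y_def by auto
      have byw: "b y z = b w z" if "z \<in> H" for z using that w fH bF[OF f that] unfolding y_def by simp
      have "b w y = b w w" unfolding y_def using w fH bF[OF f w] by simp
      then have "b y (\<pi> (M y)) + \<phi> (M y) * b y (M x) = P y" "b y y = b w w"
        unfolding P_def using byw y M by simp_all
      then have "P y \<noteq> b w w" using unsolvable[OF y M] by simp
      moreover have "P y = P w + t * P f" unfolding P_def y_def using w fH M
        by (simp add: algebra_simps)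
      ultimately show ?thesis by simp
    qed
    have "P f = 0"
    proof (rule ccontr)
      assume "P f \<noteq> 0"
      then have "P w + ((b w w - P w) / P f) * P f = b w w" by simp
      then show False using ne by blast
    qed
    then show ?thesis unfolding P_def using w fH M by simp
  qed
qed

text \<open>The second summand of the previous lemma is quadratic in \<open>M\<close>; replacing \<open>M\<close> by a multiple isolates it.\<close>

lemma F_invariant:
  assumes M: "M \<in> V" and f: "f \<in> F"
  shows "M f \<in> F"
proof -
  have fH: "f \<in> H" using f FH by blast
  have 1: "\<phi> (M f) *s M x \<in> F" if M: "M \<in> V" for M
  proof -
    let ?u = "\<pi> (M f)" and ?w = "\<phi> (M f) *s M x"
    have a: "?u + ?w \<in> F" using F_almost_invariant[OF M f] .
    have "\<pi> (c0 *s M f) + \<phi> (c0 *s M f) *s (c0 *s M x) \<in> F"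
      using F_almost_invariant[OF V_closed(3)[OF M, of c0] f] by simp
    then have bb: "c0 *s ?u + (c0 * c0) *s ?w \<in> F" using M fH by (simp add: ac_simps)
    have "(c0 *s ?u + (c0 * c0) *s ?w) - c0 *s (?u + ?w) \<in> F"
      by (rule subspace_diff[OF sF bb subspace_scale[OF sF a]])
    moreover have "(c0 *s ?u + (c0 * c0) *s ?w) - c0 *s (?u + ?w) = (c0 * (c0 - 1)) *s ?w"
      by (simp add: scale_right_distrib algebra_simps scale_left_diff_distrib)
    ultimately have "inverse (c0 * (c0 - 1)) *s ((c0 * (c0 - 1)) *s ?w) \<in> F"
      using subspace_scale[OF sF] by metis
    moreover have "c0 * (c0 - 1) \<noteq> 0" using c0 by simp
    ultimately show ?thesis by (metis left_inverse scale_scale scale_one)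
  qed
  have 2: "\<phi> (M f) = 0" if M: "M \<in> V" "M x \<notin> F" for M
  proof (rule ccontr)
    assume nz: "\<phi> (M f) \<noteq> 0"
    have "inverse (\<phi> (M f)) *s (\<phi> (M f) *s M x) \<in> F" using subspace_scale[OF sF 1[OF M(1)]] .
    then show False using nz M(2) by simp
  qed
  have "\<phi> (M f) = 0"
  proof (cases "M x \<in> F")
    case True
    \<comment> \<open>Perturb \<open>M\<close> by some \<open>N\<close> with \<open>N x\<close>
      outside \<open>F\<close>; both \<open>M + N\<close> and \<open>N\<close> then fall under the
      previous claim.\<close>
    obtain h where h: "h \<in> H" "h \<notin> F" using FH by blast
    obtain N where N: "N \<in> V" "N x = h" using orbit(2)[OF h(1)] by blast
    have "M x + N x \<notin> F" using N h subspace_diff[OF sF, of "M x + h" "M x"] True by auto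
    then have "\<phi> (M f + N f) = 0" using 2[of "\<lambda>v. M v + N v"] M N by simp
    moreover have "\<phi> (N f) = 0" using 2[OF N(1)] N h by simp
    ultimately show ?thesis using M N fH by simp
  qed (use 2 M in blast)
  then show ?thesis using F_almost_invariant[OF M f] split[OF VE[OF M, of f]] fH by simp
qed

end

section \<open>The case where the form is anisotropic on all of \<open>H\<close>\<close>

locale peel_final = peel_step +
  assumes F0: "F = {0}"
begin

lemma nz: "y \<noteq> 0 \<Longrightarrow> y \<notin> F"
  using F0 by simp

lemma b_nz: "y \<in> H \<Longrightarrow> y \<noteq> 0 \<Longrightarrow> b y y \<noteq> 0"
  using aniso nz by blast

lemma b_0 [simp]: "w \<in> H \<Longrightarrow> b 0 w = 0" "w \<in> H \<Longrightarrow> b w 0 = 0"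
  using bF F0 by auto

text \<open>Otherwise \<open>unsolvable\<close> would be violated: with \<open>A\<close> normalised
  by \<open>\<phi> (A y) = 1\<close> and with \<open>B x = y\<close>, some combination of
  \<open>A\<close> and \<open>B\<close> solves its equation.\<close>

lemma phi_vanishes:
  assumes y: "y \<in> H" and M: "M \<in> V" and z: "b y (M x) = 0"
  shows "\<phi> (M y) = 0"
proof (rule ccontr)
  assume n: "\<phi> (M y) \<noteq> 0"
  have y0: "y \<noteq> 0" using n M V_lin(2)[OF M, of x 0] by auto
  define A where "A = (\<lambda>v. inverse (\<phi> (M y)) *s M v)"
  have A: "A \<in> V" "b y (A x) = 0" "\<phi> (A y) = 1" unfolding A_def using M y z n by auto
  obtain B where B: "B \<in> V" "B x = y" using orbit(2)[OF y] by blast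
  define \<beta> where "\<beta> = b y y"
  have \<beta>: "\<beta> \<noteq> 0" unfolding \<beta>_def using b_nz[OF y y0] .
  define k1 where "k1 = b y (\<pi> (A y))"
  define k2 where "k2 = b y (\<pi> (B y))"
  define r where "r = \<phi> (B y)"
  \<comment> \<open>The coefficient of \<open>g\<close> below is affine in \<open>t\<close> with
    slope \<open>\<beta>\<close>, hence non-zero at 0 or at 1.\<close>
  obtain t where t: "k2 - r * k1 + t * \<beta> \<noteq> 0"
  proof (cases "k2 - r * k1 = 0")
    case True then show ?thesis using that[of 1] \<beta> by simp
  next
    case False then show ?thesis using that[of 0] by simp
  qed
  define g where "g = (\<beta> - t * k1) / (k2 - r * k1 + t * \<beta>)"
  have g: "t * k1 + g * (k2 - r * k1 + t * \<beta>) = \<beta>" unfolding g_def using t by simp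
  \<comment> \<open>The coefficients are arranged so that \<open>\<phi> (T y) = t\<close> and
    \<open>b y (T x) = g * \<beta>\<close>; the choice of \<open>g\<close> solves the linear
    equation that is left.\<close>
  define T where "T = (\<lambda>v. (t - g * r) *s A v + g *s B v)"
  have TV: "T \<in> V" unfolding T_def using A B by simp
  have 1: "\<phi> (T y) = t" unfolding T_def using A B y by (simp add: r_def)
  have 2: "b y (T x) = g * \<beta>" unfolding T_def using A B y by (simp add: \<beta>_def)
  have 3: "b y (\<pi> (T y)) = (t - g * r) * k1 + g * k2" unfolding T_def using A B y
    by (simp add: k1_def k2_def)
  have "b y (\<pi> (T y)) + \<phi> (T y) * b y (T x) = \<beta>" unfolding 1 2 3 using g by (simp add: algebra_simps)
  then show False using unsolvable[OF y nz[OF y0] TV] \<beta>_def by simp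
qed

text \<open>For fixed \<open>y\<close> the functional \<open>M \<mapsto> \<phi> (M y)\<close>
  vanishes on the kernel of \<open>M \<mapsto> b y (M x)\<close>, so it is a multiple
  \<open>s y\<close> of it. Additivity in \<open>y\<close> and anisotropy of \<open>b\<close> then
  force \<open>s\<close> to be the same at all non-zero vectors.\<close>

lemma phi_proportional: "\<exists>s. \<forall>M\<in>V. \<forall>y\<in>H. \<phi> (M y) = s * b y (M x)"
proof -
  have "\<exists>s. \<forall>M\<in>V. \<phi> (M y) = s * b y (M x)" if y: "y \<in> H" "y \<noteq> 0" for y
  proof -
    obtain B where B: "B \<in> V" "B x = y" using orbit(2)[OF y(1)] by blast
    have "\<phi> (M y) = (\<phi> (B y) / b y y) * b y (M x)" if M: "M \<in> V" for M
    proof -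
      define k where "k = b y (M x) / b y y"
      have "\<phi> ((\<lambda>v. M v - k *s B v) y) = 0"
        by (rule phi_vanishes[OF y(1)]) (use M B y b_nz[OF y] k_def in auto)
      then show ?thesis using M B y by (simp add: k_def)
    qed
    then show ?thesis by blast
  qed
  then obtain s where s: "\<And>y M. y \<in> H \<Longrightarrow> y \<noteq> 0 \<Longrightarrow> M \<in> V \<Longrightarrow> \<phi> (M y) = s y * b y (M x)" by metis
  have sconst: "s y = s z" if y: "y \<in> H" "y \<noteq> 0" and z: "z \<in> H" "z \<noteq> 0" for y z
  \<comment> \<open>\<open>s\<close> is controlled only at non-zero vectors, so
    \<open>y + z = 0\<close> joins the case of dependent vectors.\<close>
  proof (cases "y + z = 0 \<or> (\<exists>k. z = k *s y)")
    case True
    have "\<exists>k. z = k *s y"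
    proof (cases "y + z = 0")
      case True
      then have "z = (-1) *s y" by (simp add: eq_neg_iff_add_eq_0 add.commute)
      then show ?thesis by blast
    qed (use True in blast)
    then obtain k where k: "z = k *s y" by blast
    then have k0: "k \<noteq> 0" using z by auto
    obtain B where B: "B \<in> V" "B x = y" using orbit(2)[OF y(1)] by blast
    have "\<phi> (B z) = s z * b z (B x)" using s[OF z B(1)] .
    then have "k * (s y * b y y) = s z * (k * b y y)"
      using s[OF y B(1)] B y unfolding k by simp
    then show ?thesis using k0 b_nz[OF y] by simp
  next
    case False
    \<comment> \<open>Comparing \<open>\<phi>\<close> at \<open>y\<close>, \<open>z\<close> and
      \<open>y + z\<close> gives \<open>\<alpha> * b y (M x) + \<beta> * b z (M x) = 0\<close> for
      all \<open>M\<close> in \<open>V\<close>; the choice \<open>M x = u\<close> turns this into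
      \<open>b u u = 0\<close>.\<close>
    define \<alpha> where "\<alpha> = s (y + z) - s y"
    define \<beta> where "\<beta> = s (y + z) - s z"
    have w: "y + z \<in> H" "y + z \<noteq> 0" using y z False by auto
    define u where "u = \<alpha> *s y + \<beta> *s z"
    have u: "u \<in> H" unfolding u_def using y z by simp
    obtain B where B: "B \<in> V" "B x = u" using orbit(2)[OF u] by blast
    have "s (y + z) * b (y + z) u = s y * b y u + s z * b z u"
      using s[OF y B(1)] s[OF z B(1)] s[OF w B(1)] B y z by simp
    then have "\<alpha> * b y u + \<beta> * b z u = 0" unfolding \<alpha>_def \<beta>_def using y z u by (simp add: algebra_simps)
    moreover have "b u u = \<alpha> * b y u + \<beta> * b z u"
    proof -
      have "b u u = b (\<alpha> *s y + \<beta> *s z) u" by (simp add: u_def)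
      also have "\<dots> = \<alpha> * b y u + \<beta> * b z u" using y z u by simp
      finally show ?thesis .
    qed
    ultimately have "u = 0" using b_nz[OF u] by auto
    have "\<beta> = 0"
    proof (rule ccontr)
      assume n: "\<beta> \<noteq> 0"
      have "\<beta> *s z = - (\<alpha> *s y)" using \<open>u = 0\<close> unfolding u_def by (simp add: eq_neg_iff_add_eq_0 add.commute)
      then have "inverse \<beta> *s (\<beta> *s z) = inverse \<beta> *s ((- \<alpha>) *s y)" by simp
      then have "z = (inverse \<beta> * (- \<alpha>)) *s y" using n by (metis left_inverse scale_scale scale_one)
      then show False using False by blast
    qed
    then have "\<alpha> = 0" using \<open>u = 0\<close> y unfolding u_def by simp
    then show ?thesis using \<open>\<beta> = 0\<close> unfolding \<alpha>_def \<beta>_def by simp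
  qed
  obtain h where h: "h \<in> H" "h \<noteq> 0" using FH F0 by auto
  have "\<phi> (M y) = s h * b y (M x)" if M: "M \<in> V" and y: "y \<in> H" for M y
  proof (cases "y = 0")
    case True
    then show ?thesis using M V_lin(2)[OF M, of x 0] by simp
  next
    case False
    then show ?thesis using s[OF y False M] sconst[OF y False h] by simp
  qed
  then show ?thesis by blast
qed

text \<open>Rescaling \<open>M\<close> in \<open>unsolvable\<close> shows that
  \<open>b y (\<pi> (M y))\<close> vanishes along with \<open>b y (M x)\<close>, so it equals
  \<open>m y * b y (M x)\<close>. The core is that \<open>m\<close> is linear on \<open>H\<close>;
  then the extended form is explicit, and \<open>unsolvable\<close> gives its anisotropy.\<close>

lemma form_exists:
  assumes s: "\<And>M y. M \<in> V \<Longrightarrow> y \<in> H \<Longrightarrow> \<phi> (M y) = s * b y (M x)" and s0: "s \<noteq> 0"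
  shows "\<exists>b'. flagform E V {0} b'"
proof -
  have k0: "b y (\<pi> (M y)) = 0" if y: "y \<in> H" and M: "M \<in> V" and z: "b y (M x) = 0" for y M
  proof (rule ccontr)
    assume n: "b y (\<pi> (M y)) \<noteq> 0"
    have y0: "y \<noteq> 0" using n M V_lin(2)[OF M, of x 0] by auto
    define k where "k = b y y / b y (\<pi> (M y))"
    have "b y (\<pi> ((\<lambda>v. k *s M v) y)) + \<phi> ((\<lambda>v. k *s M v) y) * b y ((\<lambda>v. k *s M v) x) = b y y"
      using y M z n by (simp add: k_def)
    then show False using unsolvable[OF y nz[OF y0] V_closed(3)[OF M, of k]] by blast
  qed
  have "\<exists>m. \<forall>M\<in>V. b y (\<pi> (M y)) = m * b y (M x)" if y: "y \<in> H" "y \<noteq> 0" for y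
  proof -
    obtain B where B: "B \<in> V" "B x = y" using orbit(2)[OF y(1)] by blast
    have "b y (\<pi> (M y)) = (b y (\<pi> (B y)) / b y y) * b y (M x)" if M: "M \<in> V" for M
    proof -
      define k where "k = b y (M x) / b y y"
      have "b y (\<pi> ((\<lambda>v. M v - k *s B v) y)) = 0"
        by (rule k0[OF y(1)]) (use M B y b_nz[OF y] k_def in auto)
      then show ?thesis using M B y by (simp add: k_def)
    qed
    then show ?thesis by blast
  qed
  then obtain m0 where m0: "\<And>y M. y \<in> H \<Longrightarrow> y \<noteq> 0 \<Longrightarrow> M \<in> V \<Longrightarrow> b y (\<pi> (M y)) = m0 y * b y (M x)"
    by metis
  \<comment> \<open>The factor \<open>m0\<close> is arbitrary at 0; linearity requires the value 0
    there.\<close>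
  define m where "m y = (if y = 0 then 0 else m0 y)" for y
  have m: "b y (\<pi> (M y)) = m y * b y (M x)" if "y \<in> H" "M \<in> V" for y M
    using that m0 by (auto simp: m_def)
  have m_scale: "m (k *s y) = k * m y" if y: "y \<in> H" for y k
  proof (cases "y = 0 \<or> k = 0")
    case True
    then show ?thesis by (auto simp: m_def)
  next
    case False
    obtain B where B: "B \<in> V" "B x = y" using orbit(2)[OF y] by blast
    have "b (k *s y) (\<pi> (B (k *s y))) = m (k *s y) * b (k *s y) (B x)"
      by (rule m) (use B y in auto)
    then have "k * (k * (m y * b y y)) = m (k *s y) * (k * b y y)" using m[OF y B(1)] B y by simp
    then show ?thesis using False b_nz[OF y] by simp
  qed
  \<comment> \<open>One step of orthogonalisation: \<open>C\<close> is \<open>y\<close> minus its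
    component along \<open>z\<close>, so that \<open>b C C = b y C\<close>.\<close>
  have dual: "\<exists>C\<in>H. b z C = 0 \<and> b y C \<noteq> 0" if y: "y \<in> H" and z: "z \<in> H" "z \<noteq> 0" and ind: "\<And>k. y \<noteq> k *s z" for y z
  proof -
    define k where "k = b z y / b z z"
    define C where "C = y - k *s z"
    have C: "C \<in> H" "C \<noteq> 0" unfolding C_def using y z ind[of k] by auto
    have zC: "b z C = 0" unfolding C_def k_def using y z b_nz[OF z] by simp
    have "b C C = b y C - k * b z C"
    proof -
      have "b C C = b (y - k *s z) C" by (simp add: C_def)
      then show ?thesis using y z C by simp
    qed
    then show ?thesis using zC b_nz[OF C] C(1) by auto
  qed
  have m_add: "m (y + z) = m y + m z" if y: "y \<in> H" and z: "z \<in> H" for y z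
  proof (cases "\<exists>k. y = k *s z \<or> z = k *s y")
    case True
    then obtain k where "y = k *s z \<or> z = k *s y" by blast
    then show ?thesis
    proof
      assume k: "y = k *s z"
      have "y + z = (k + 1) *s z" unfolding k by (simp add: scale_left_distrib)
      then show ?thesis using m_scale[OF z, of "k + 1"] m_scale[OF z, of k] k by (simp add: algebra_simps)
    next
      assume k: "z = k *s y"
      have "y + z = (1 + k) *s y" unfolding k by (simp add: scale_left_distrib)
      then show ?thesis using m_scale[OF y, of "1 + k"] m_scale[OF y, of k] k by (simp add: algebra_simps)
    qed
  next
    case False
    then have n0: "y \<noteq> 0" "z \<noteq> 0" by (metis scale_zero_left)+
    obtain C where C: "C \<in> H" "b z C = 0" "b y C \<noteq> 0" using dual[OF y z n0(2)] False by blast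
    obtain C' where C': "C' \<in> H" "b y C' = 0" "b z C' \<noteq> 0" using dual[OF z y n0(1)] False by blast
    obtain A where A: "A \<in> V" "A x = C" using orbit(2)[OF C(1)] by blast
    obtain B where B: "B \<in> V" "B x = C'" using orbit(2)[OF C'(1)] by blast
    \<comment> \<open>The mixed term of \<open>b v (\<pi> (M v))\<close> on the line
      \<open>v = y + l *s z\<close>. Evaluation at \<open>A\<close>, where
      \<open>b z (A x) = 0\<close>, and at \<open>B\<close>, where \<open>b y (B x) = 0\<close>,
      yields two affine formulas for \<open>m (y + l *s z)\<close>.\<close>
    define p where "p M = b y (\<pi> (M z)) + b z (\<pi> (M y))" for M
    have exp: "m (y + l *s z) * (b y (M x) + l * b z (M x))
        = m y * b y (M x) + l * p M + l * l * (m z * b z (M x))" if M: "M \<in> V" for M l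
    proof -
      have w: "y + l *s z \<in> H" using y z by simp
      have e: "b (y + l *s z) (\<pi> (M (y + l *s z))) = b y (\<pi> (M y)) + l * p M + l * l * b z (\<pi> (M z))"
        using y z M by (simp add: p_def algebra_simps)
      have "b (y + l *s z) (M x) = b y (M x) + l * b z (M x)" using y z M by simp
      then show ?thesis using e unfolding m[OF w M] m[OF y M] m[OF z M] by simp
    qed
    define \<delta> where "\<delta> = p A / b y C"
    define \<delta>' where "\<delta>' = p B / b z C'"
    have 1: "m (y + l *s z) = m y + l * \<delta>" for l
    proof -
      have "m (y + l *s z) * b y C = (m y + l * \<delta>) * b y C"
        using exp[OF A(1), of l] A C by (simp add: \<delta>_def algebra_simps)
      then show ?thesis using C by simp
    qed
    have 2: "m (y + l *s z) = \<delta>' + l * m z" if "l \<noteq> 0" for l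
    proof -
      have "l * (m (y + l *s z) * b z C') = l * ((\<delta>' + l * m z) * b z C')"
        using exp[OF B(1), of l] B C' by (simp add: \<delta>'_def algebra_simps)
      then show ?thesis using C' that by simp
    qed
    \<comment> \<open>The second formula came from a division by \<open>l\<close>, so the slopes
      \<open>\<delta>\<close> and \<open>m z\<close> are compared at 1 and \<open>c0\<close> instead
      of 0.\<close>
    have e1: "m y + \<delta> = \<delta>' + m z" using 1[of 1] 2[of 1] by simp
    have e2: "m y + c0 * \<delta> = \<delta>' + c0 * m z" using 1[of c0] 2[OF c0(1)] by simp
    have "(c0 - 1) * \<delta> = (m y + c0 * \<delta>) - (m y + \<delta>)" by (simp add: algebra_simps)
    also have "\<dots> = (c0 - 1) * m z" unfolding e1 e2 by (simp add: algebra_simps)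
    finally have "(c0 - 1) * \<delta> = (c0 - 1) * m z" .
    then have "\<delta> = m z" using c0 by simp
    then show ?thesis using 1[of 1] by simp
  qed
  define \<alpha> where "\<alpha> = - inverse s"
  \<comment> \<open>The only bilinear extension of \<open>b\<close> compatible with \<open>\<phi> (M y) = s * b y (M x)\<close> and \<open>b y (\<pi> (M y)) = m y * b y (M x)\<close>.\<close>
  define b' where "b' u v = \<alpha> * (\<phi> u + m (\<pi> u)) * \<phi> v + b (\<pi> u) (\<pi> v)" for u v
  have "flagform E V {0} b'"
    unfolding flagform_def
  proof (intro conjI ballI impI)
    show "subspace {0}" by (rule subspace_zero)
    show "{0} \<subseteq> E" by simp
    obtain h where "h \<in> H" "h \<noteq> 0" using FH F0 by auto
    then show "{0} \<noteq> E" by auto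
    show "bil E b'" unfolding bil_def lin_on_def b'_def
      by (auto simp: m_add m_scale algebra_simps)
    have "\<pi> 0 = 0" "\<phi> 0 = 0" using pi_simps(5,6)[of 0] by auto
    then show "b' f y = 0" "b' y f = 0" if "f \<in> {0}" "y \<in> E" for f y
      using that by (auto simp: b'_def m_def)
  next
    fix M and v :: 'b assume M: "M \<in> V" "v \<in> {0}"
    then show "M v \<in> {0}" using V_lin(2)[OF M(1), of x 0] by simp
  next
    fix M v assume M: "M \<in> V" and v: "v \<in> E"
    define y where "y = \<pi> v"
    define t where "t = \<phi> v"
    have y: "y \<in> H" unfolding y_def using v by simp
    have v': "v = t *s x + y" using split[OF v] unfolding y_def t_def by simp
    have Mv: "M v = t *s M x + M y" unfolding v' using M y by simp
    have "b' v (M v) = \<alpha> * (t + m y) * (s * b y (M x)) + (t * b y (M x) + m y * b y (M x))"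
      unfolding b'_def y_def[symmetric] t_def[symmetric] Mv using M y s[OF M y] m[OF y M] by simp
    also have "\<dots> = 0" unfolding \<alpha>_def using s0 by (simp add: field_simps)
    finally show "b' v (M v) = 0" .
  next
    fix v assume v: "v \<in> E" "v \<notin> {0}"
    define y where "y = \<pi> v"
    define t where "t = \<phi> v"
    have y: "y \<in> H" unfolding y_def using v by simp
    have v': "v = t *s x + y" using split[OF v(1)] unfolding y_def t_def by simp
    have b'v: "b' v v = \<alpha> * (t + m y) * t + b y y" unfolding b'_def y_def t_def by simp
    show "b' v v \<noteq> 0"
    proof (cases "y = 0")
      case True
      then have "t \<noteq> 0" using v v' by auto
      then show ?thesis unfolding b'v True using s0 by (simp add: m_def \<alpha>_def)
    next
      case False
      \<comment> \<open>Chosen so that \<open>b y C = t / s\<close>, hence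
        \<open>\<phi> (M y) = t\<close>; the inequality in \<open>unsolvable\<close> for this
        \<open>M\<close> is then exactly \<open>b' v v \<noteq> 0\<close>.\<close>
      define C where "C = (t / (s * b y y)) *s y"
      have C: "C \<in> H" unfolding C_def using y by simp
      obtain M where M: "M \<in> V" "M x = C" using orbit(2)[OF C] by blast
      have bC: "b y C = t / s" unfolding C_def using y b_nz[OF y False] by simp
      have "m y * (t / s) + t * (t / s) \<noteq> b y y"
        using unsolvable[OF y nz[OF False] M(1)] m[OF y M(1)] s[OF M(1) y] M(2) bC s0 by simp
      then show ?thesis unfolding b'v \<alpha>_def
        by (auto simp: field_simps add_divide_distrib)
    qed
  qed
  then show ?thesis by blast
qed

end

section \<open>Existence of the invariant form by induction on the dimension\<close>

context endo_space
begin

text \<open>The orbit has codimension one and misses \<open>x\<close>, so adding \<open>x\<close> to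
  it fills \<open>E\<close>.\<close>

lemma orb_dsum:
  assumes V: "maxt E V" and x: "good E V x"
  shows "dsum E (span {x}) (orb V x)"
proof -
  note M = maxtD[OF V]
  obtain G where d: "dsum E (span {x}) G" using dsum_line[OF M(1) x] by blast
  note dm = maxt_good(1)[OF V x d]
  note a = ann_props[OF M(2,1) x d]
  have xE: "x \<in> E" using x unfolding good_def by blast
  have sE: "subspace E" using fd_subspace[OF M(1)] .
  have fo: "fd (orb V x)" using fd_subset[OF M(1) a(4,5)] .
  have "span (insert x (orb V x)) \<subseteq> E" using xE a(5) sE by (intro span_minimal) auto
  then have sp: "span (insert x (orb V x)) = E"
    using dim_eq_fd[OF M(1) subspace_span] dim_insert_fd[OF fo a(6)] dm by simp
  have so: "span (orb V x) = orb V x" using a(4) by (simp add: span_eq_iff)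
  show ?thesis unfolding dsum_def
  proof (intro conjI ballI)
    show "span {x} \<subseteq> E" using d unfolding dsum_def by blast
    show "span {x} \<inter> orb V x \<subseteq> {0}"
    proof
      fix v assume "v \<in> span {x} \<inter> orb V x"
      then obtain k where k: "v = k *s x" "k *s x \<in> orb V x" unfolding span_singleton by auto
      show "v \<in> {0}"
      proof (cases "k = 0")
        case False
        then have "inverse k *s (k *s x) \<in> orb V x" using subspace_scale[OF a(4) k(2)] by blast
        then show ?thesis using a(6) False by simp
      qed (use k in simp)
    qed
    fix v assume "v \<in> E"
    then have "v \<in> span (insert x (orb V x))" unfolding sp .
    then obtain k where k: "v - k *s x \<in> orb V x" unfolding span_insert so by blast
    have "v - (v - k *s x) \<in> span {x}"
      unfolding span_singleton using rangeI[of "\<lambda>k. k *s x" k] by simp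
    then show "\<exists>g\<in>orb V x. v - g \<in> span {x}" using k by blast
  qed (use sE a(4,5) subspace_span in auto)
qed

lemma line_coefficient:
  assumes d: "dsum E (span {x}) H" and x0: "x \<noteq> 0"
  obtains \<phi> where "\<And>v. v \<in> E \<Longrightarrow> v = \<phi> v *s x + prj (span {x}) H v" "lin_on scale (*) E \<phi>"
    "\<And>h. h \<in> H \<Longrightarrow> \<phi> h = 0" "\<phi> x = 1"
proof -
  have sub: "subspace E" "span {x} \<subseteq> E" "H \<subseteq> E" using d unfolding dsum_def by auto
  have xE: "x \<in> E" using sub(2) span_base[of x "{x}"] by auto
  have "\<exists>k. v - prj (span {x}) H v = k *s x" if "v \<in> E" for v
    using prj_props(2)[OF d that] unfolding span_singleton by blast
  then obtain \<phi> where \<phi>: "\<And>v. v \<in> E \<Longrightarrow> v - prj (span {x}) H v = \<phi> v *s x" by metis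
  have eq: "v = \<phi> v *s x + prj (span {x}) H v" if "v \<in> E" for v using \<phi>[OF that] by (simp add: algebra_simps)
  have u: "\<phi> v = k" if "v \<in> E" "v - prj (span {x}) H v = k *s x" for v k
    using \<phi>[OF that(1)] that(2) x0 by simp
  note pl = prj_lin[OF d]
  show ?thesis
  proof (rule that[OF eq])
    show "lin_on scale (*) E \<phi>" unfolding lin_on_def
    proof (intro conjI ballI allI)
      fix v w assume v: "v \<in> E" and w: "w \<in> E"
      show "\<phi> (v + w) = \<phi> v + \<phi> w"
      proof (rule u)
        show "v + w \<in> E" using sub(1) v w by (rule subspace_add)
        have "v + w - prj (span {x}) H (v + w) = (v - prj (span {x}) H v) + (w - prj (span {x}) H w)"
          using lin_add[OF pl v w] by simp
        then show "v + w - prj (span {x}) H (v + w) = (\<phi> v + \<phi> w) *s x"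
          using \<phi>[OF v] \<phi>[OF w] by (simp add: scale_left_distrib)
      qed
    next
      fix c v assume v: "v \<in> E"
      show "\<phi> (c *s v) = c * \<phi> v"
      proof (rule u)
        show "c *s v \<in> E" using sub(1) v by (rule subspace_scale)
        have "c *s v - prj (span {x}) H (c *s v) = c *s (v - prj (span {x}) H v)"
          using lin_scale[OF pl v] by (simp add: scale_right_diff_distrib)
        then show "c *s v - prj (span {x}) H (c *s v) = (c * \<phi> v) *s x" using \<phi>[OF v] by simp
      qed
    qed
    show "\<phi> h = 0" if "h \<in> H" for h using u[of h 0] prj_id[OF d that] that sub(3) by auto
    have "x - prj (span {x}) H x = 1 *s x" using prj_zero[OF d span_base[of x]] by simp
    then show "\<phi> x = 1" using u[OF xE] by blast
  qed simp
qed

theorem flagform_exists: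
  assumes c0: "c0 \<noteq> (0::'a)" "c0 \<noteq> 1" and "maxt E V" "E \<noteq> {0}"
  shows "\<exists>F b. flagform E V F b"
  using assms(3,4)
proof (induction "dim E" arbitrary: E V rule: less_induct)
  case less
  note M = maxtD[OF less(2)]
  note VD = trivD[OF M(2)]
  have sE: "subspace E" using fd_subspace[OF M(1)] .
  obtain x where x: "good E V x" using good_exists[OF M(1) less(3) M(2)] by blast
  have x': "x \<in> E" "x \<noteq> 0" using x unfolding good_def by auto
  define H where "H = orb V x"
  note d = orb_dsum[OF less(2) x, folded H_def]
  have sub: "subspace H" "H \<subseteq> E" "subspace E" using d unfolding dsum_def by auto
  note mg = maxt_good[OF less(2) x d, folded H_def]
  define W where "W = ind (span {x}) H ` ann V x"
  define \<pi> where "\<pi> = prj (span {x}) H"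
  obtain \<phi> where \<phi>: "\<And>v. v \<in> E \<Longrightarrow> v = \<phi> v *s x + \<pi> v" "lin_on scale (*) E \<phi>"
    "\<And>h. h \<in> H \<Longrightarrow> \<phi> h = 0" "\<phi> x = 1"
    using line_coefficient[OF d x'(2)] unfolding \<pi>_def by metis
  have orbH: "M x \<in> H" if "M \<in> V" for M using that unfolding H_def orb_def by blast
  \<comment> \<open>A proper non-zero invariant subspace is enough: the quotient is maximal and
    smaller, and its form pulls back.\<close>
  have reducible: "\<exists>F b. flagform E V F b"
    if F: "subspace F" "F \<subseteq> E" "F \<noteq> {0}" "F \<noteq> E" and inv: "\<forall>M\<in>V. \<forall>v\<in>F. M v \<in> F" for F
  proof -
    obtain G where dG: "dsum E F G" using complement_exists[OF M(1) F(1,2)] by blast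
    have fF: "fd F" using fd_subset[OF M(1) F(1,2)] .
    have "G \<noteq> {0}"
    proof
      assume G: "G = {0}"
      have "v \<in> F" if "v \<in> E" for v using dG that unfolding dsum_def G by auto
      then show False using F(2,4) by blast
    qed
    moreover have "dim F \<noteq> 0" using fd_dim0[OF fF] F(3) by blast
    then have "dim G < dim E" using dim_dsum[OF M(1) dG] by simp
    ultimately obtain F' b' where "flagform G (ind F G ` V) F' b'"
      using less(1)[OF _ maxt_invariant(2)[OF less(2) dG inv]] by blast
    then show ?thesis using flagform_quotient[OF M(2) dG inv] by blast
  qed
  show ?case
  proof (cases "H = {0}")
    case True
    \<comment> \<open>Here \<open>E\<close> is the line of \<open>x\<close> and \<open>V\<close>
      acts as zero, so a product of coordinates serves as the form; the induction hypothesis applies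
      only to \<open>H \<noteq> {0}\<close>.\<close>
    have Mz: "M v = 0" if N: "M \<in> V" and v: "v \<in> E" for M v
    proof -
      have "\<pi> v = 0" using prj_props(1)[OF d v] True unfolding \<pi>_def by auto
      then have "v = \<phi> v *s x" using \<phi>(1)[OF v] by simp
      then have "M v = \<phi> v *s M x" using lin_scale[OF End_lin[OF VD(2)[OF N]] x'(1)] by metis
      then show ?thesis using orbH[OF N] True by simp
    qed
    have v0: "\<phi> v \<noteq> 0" if v: "v \<in> E" "v \<noteq> 0" for v
      using \<phi>(1)[OF v(1)] v(2) prj_props(1)[OF d v(1)] True unfolding \<pi>_def by auto
    have p0: "\<phi> 0 = 0" using \<phi>(3) True by blast
    have "flagform E V {0} (\<lambda>u v. \<phi> u * \<phi> v)"
      unfolding flagform_def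
    proof (intro conjI ballI impI)
      show "subspace {0}" by (rule subspace_zero)
      show "{0} \<subseteq> E" using subspace_0[OF sE] by simp
      show "{0} \<noteq> E" using less(3) by blast
      show "bil E (\<lambda>u v. \<phi> u * \<phi> v)" using \<phi>(2) unfolding bil_def lin_on_def by (auto simp: algebra_simps)
      show "\<phi> y * \<phi> (M y) = 0" if "M \<in> V" "y \<in> E" for M y using Mz[OF that] p0 by simp
    qed (use Mz v0 p0 subspace_0[OF sE] in auto)
    then show ?thesis by blast
  next
    case False
    have dH: "dim H < dim E" using mg(1) by simp
    obtain F b where FW: "flagform H W F b"
      using less(1)[OF dH mg(2) False] unfolding W_def by blast
    note FD = flagformD[OF FW]
    interpret ps: peel_step scale E V x H F b \<phi> \<pi> c0
    proof unfold_locales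
      show "subspace E" "subspace H" "H \<subseteq> E" "x \<in> E" using sub x' by auto
      show "triv E V" by (rule M(2))
      show "\<pi> v \<in> H \<and> v = \<phi> v *s x + \<pi> v" if "v \<in> E" for v
        using prj_props(1)[OF d that] \<phi>(1)[OF that] unfolding \<pi>_def by blast
      show "lin_on scale scale E \<pi>" unfolding \<pi>_def by (rule prj_lin[OF d])
      show "lin_on scale (*) E \<phi>" by (rule \<phi>(2))
      show "\<pi> h = h \<and> \<phi> h = 0" if "h \<in> H" for h using prj_id[OF d that] \<phi>(3)[OF that] unfolding \<pi>_def by blast
      show "\<pi> x = 0" unfolding \<pi>_def by (rule prj_zero[OF d span_base]) simp
      show "\<phi> x = 1" by (rule \<phi>(4))
      show "\<And>M. M \<in> V \<Longrightarrow> M x \<in> H" by (rule orbH)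
      show "\<exists>M\<in>V. M x = h" if "h \<in> H" for h using that unfolding H_def orb_def by auto
      show "subspace F" "F \<subseteq> H" "F \<noteq> H" "bil H b" using FD by auto
      show "b f y = 0 \<and> b y f = 0" if "f \<in> F" "y \<in> H" for f y using FD(6,7)[OF that] by blast
      show "b y y \<noteq> 0" if "y \<in> H" "y \<notin> F" for y using FD(8)[OF that] .
      show "c0 \<noteq> 0" "c0 \<noteq> 1" using c0 .
      fix y z assume yz: "y \<in> H" "y \<notin> F" "z \<in> H" "b y z = 0"
      \<comment> \<open>\<open>flagform_hit\<close> is applied to the maximal space \<open>W\<close>
        on \<open>H\<close>; an operator of \<open>V\<close> behind \<open>N\<close> agrees with it
        on \<open>H\<close> only after \<open>\<pi>\<close>.\<close>
      obtain N where N: "N \<in> W" "N y = z" "\<forall>f\<in>F. N f = 0"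
        using flagform_hit[OF mg(2)[folded W_def] FW yz] by blast
      then obtain A where A: "A \<in> ann V x" "N = ind (span {x}) H A" unfolding W_def by blast
      have NA: "N h = \<pi> (A h)" if "h \<in> H" for h using that unfolding A(2) ind_def \<pi>_def by simp
      show "\<exists>N\<in>V. N x = 0 \<and> \<pi> (N y) = z \<and> (\<forall>f\<in>F. \<pi> (N f) = 0)"
      proof (rule bexI[of _ A])
        show "A \<in> V" using A(1) unfolding ann_def by blast
        have "\<pi> (A f) = 0" if "f \<in> F" for f using N(3) NA[of f] FD(2) that by (metis subsetD)
        then show "A x = 0 \<and> \<pi> (A y) = z \<and> (\<forall>f\<in>F. \<pi> (A f) = 0)"
          using A(1) N NA yz unfolding ann_def by auto
      qed
    qed
    have HE: "H \<noteq> E" using dH by auto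
    show ?thesis
    proof (cases "F = {0}")
      case False
      show ?thesis
      proof (rule reducible[of F])
        show "F \<noteq> E" using FD(2) HE sub by blast
        show "\<forall>M\<in>V. \<forall>v\<in>F. M v \<in> F" using ps.F_invariant by blast
      qed (use FD sub False in auto)
    next
      case True
      then interpret pf: peel_final scale E V x H F b \<phi> \<pi> c0
        by unfold_locales
      obtain s where s: "\<And>M y. M \<in> V \<Longrightarrow> y \<in> H \<Longrightarrow> \<phi> (M y) = s * b y (M x)"
        using pf.phi_proportional by blast
      show ?thesis
      \<comment> \<open>For \<open>s = 0\<close> all of \<open>V\<close> maps \<open>H\<close> into
        \<open>H\<close>, which is then a proper non-zero invariant subspace.\<close>
      proof (cases "s = 0")
        case True
        have "M v \<in> H" if N: "M \<in> V" and v: "v \<in> H" for M v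
        proof -
          have "M v \<in> E" using N v sub by simp
          then have "M v = \<phi> (M v) *s x + \<pi> (M v)" "\<pi> (M v) \<in> H"
            using \<phi>(1) prj_props(1)[OF d] unfolding \<pi>_def by auto
          then show ?thesis using s[OF N v] True by simp
        qed
        then show ?thesis using reducible[of H] sub False HE by blast
      next
        case False
        then show ?thesis using pf.form_exists[OF s] by blast
      qed
    qed
  qed
qed

end

section \<open>Alternate matrices and congruence\<close>

text \<open>Both matrices are kept as data, so that a conjugation reads \<open>R * M * S\<close> and
  is reversed by swapping the pair.\<close>

definition mutual_inverse :: "nat \<Rightarrow> 'a::field mat \<Rightarrow> 'a mat \<Rightarrow> bool" where
  "mutual_inverse n R S \<longleftrightarrow> R \<in> carrier_mat n n \<and> S \<in> carrier_mat n n \<and> R * S = 1\<^sub>m n \<and> S * R = 1\<^sub>m n"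

lemma mutual_inverseD:
  assumes "mutual_inverse n R S"
  shows "R \<in> carrier_mat n n" "S \<in> carrier_mat n n" "R * S = 1\<^sub>m n" "S * R = 1\<^sub>m n"
  using assms by (auto simp: mutual_inverse_def)

lemma mutual_inverse_sym: "mutual_inverse n R S \<Longrightarrow> mutual_inverse n S R"
  by (auto simp: mutual_inverse_def)

lemma square_mult:
  assumes "A \<in> carrier_mat n n" "B \<in> carrier_mat n n"
  shows "A * B \<in> carrier_mat n n" "C \<in> carrier_mat n n \<Longrightarrow> A * B * C = A * (B * C)"
    "x \<in> carrier_vec n \<Longrightarrow> (A * B) *\<^sub>v x = A *\<^sub>v (B *\<^sub>v x)"
  using assms by auto

lemma GL_mat_iff: "R \<in> GL_mat n \<longleftrightarrow> (\<exists>S. mutual_inverse n R S)"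
proof
  assume "R \<in> GL_mat n"
  then obtain S where S: "R \<in> carrier_mat n n" "R * S = 1\<^sub>m n" "S * R = 1\<^sub>m (dim_row S)"
    unfolding GL_mat_def invertible_mat_def inverts_mat_def by auto
  have "dim_col S = n" using arg_cong[OF S(2), of dim_col] S(1) by simp
  moreover have "dim_row S = n" using arg_cong[OF S(3), of dim_col] S(1) by simp
  ultimately show "\<exists>S. mutual_inverse n R S" using S unfolding mutual_inverse_def by auto
next
  assume "\<exists>S. mutual_inverse n R S"
  then show "R \<in> GL_mat n"
    unfolding GL_mat_def invertible_mat_def inverts_mat_def mutual_inverse_def by auto
qed

lemma inverse_exists:
  assumes A: "(A :: 'a::field mat) \<in> carrier_mat n n"
    and inj: "\<And>x. x \<in> carrier_vec n \<Longrightarrow> A *\<^sub>v x = 0\<^sub>v n \<Longrightarrow> x = 0\<^sub>v n"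
  shows "\<exists>S. mutual_inverse n A S"
proof -
  have "det A \<noteq> 0" using det_0_iff_vec_prod_zero_field[OF A] inj by blast
  then have "A \<in> Units (ring_mat TYPE('a) n ())" by (rule det_non_zero_imp_unit[OF A])
  then show ?thesis unfolding Units_def ring_mat_def mutual_inverse_def by auto
qed

lemma mutual_inverse_vec:
  assumes "mutual_inverse n R S" "x \<in> carrier_vec n"
  shows "R *\<^sub>v (S *\<^sub>v x) = x"
  using mutual_inverseD[OF assms(1)] assms(2)
  by (metis assoc_mult_mat_vec one_mult_mat_vec)

lemma mutual_inverse_conj:
  assumes R: "mutual_inverse n R S" and M: "M \<in> carrier_mat n n"
  shows "R * (S * M * R) * S = M"
proof -
  note D = mutual_inverseD[OF R]
  have "R * (S * M * R) * S = (R * S) * (M * (R * S))" using D(1,2) M by (simp add: square_mult[where n = n])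
  then show ?thesis using D M by simp
qed

definition conj_mats :: "'a::field mat \<Rightarrow> 'a mat \<Rightarrow> 'a mat set \<Rightarrow> 'a mat set" where
  "conj_mats R S V = (\<lambda>M. R * M * S) ` V"

lemma similar_subspaces_iff:
  "similar_subspaces n V W \<longleftrightarrow> V \<subseteq> carrier_mat n n \<and> W \<subseteq> carrier_mat n n \<and>
    (\<exists>R S. mutual_inverse n R S \<and> W = conj_mats R S V)"
  unfolding similar_subspaces_def mutual_inverse_def inverts_mat_def conj_mats_def Setcompr_eq_image
  by auto

lemma conj_mats_inverse:
  assumes "mutual_inverse n R S" "V \<subseteq> carrier_mat n n"
  shows "conj_mats S R (conj_mats R S V) = V"
proof -
  have "S * (R * M * S) * R = M" if "M \<in> V" for M
    using mutual_inverse_conj[OF mutual_inverse_sym[OF assms(1)]] that assms(2) by blast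
  then show ?thesis unfolding conj_mats_def image_image by simp
qed

lemma conj_mats_comp:
  assumes "mutual_inverse n R S" "mutual_inverse n R' S'" "V \<subseteq> carrier_mat n n"
  shows "conj_mats R' S' (conj_mats R S V) = conj_mats (R' * R) (S * S') V"
proof -
  note D = mutual_inverseD[OF assms(1)] and D' = mutual_inverseD[OF assms(2)]
  have "R' * (R * M * S) * S' = R' * R * M * (S * S')" if "M \<in> V" for M
    using that assms(3) D(1,2) D'(1,2) by (auto simp: square_mult[where n = n] subset_iff)
  then show ?thesis unfolding conj_mats_def image_image by simp
qed

lemma mutual_inverse_mult:
  assumes "mutual_inverse n R S" "mutual_inverse n R' S'"
  shows "mutual_inverse n (R' * R) (S * S')"
proof -
  note D = mutual_inverseD[OF assms(1)] and D' = mutual_inverseD[OF assms(2)]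
  have "R' * R * (S * S') = R' * (R * S * S')" using D(1,2) D'(1,2) by (simp add: square_mult[where n = n])
  moreover have "S * S' * (R' * R) = S * (S' * R' * R)" using D(1,2) D'(1,2) by (simp add: square_mult[where n = n])
  ultimately show ?thesis unfolding mutual_inverse_def using D D' by (simp add: square_mult[where n = n])
qed

lemma similar_subspaces_sym: "similar_subspaces n V W \<Longrightarrow> similar_subspaces n W V"
  unfolding similar_subspaces_iff using conj_mats_inverse mutual_inverse_sym by metis

lemma similar_subspaces_trans:
  "similar_subspaces n V W \<Longrightarrow> similar_subspaces n W X \<Longrightarrow> similar_subspaces n V X"
  unfolding similar_subspaces_iff using conj_mats_comp mutual_inverse_mult by metis

lemma mat_eq_if_mult_vec_eq:
  assumes "(A :: 'a::field mat) \<in> carrier_mat n m" "B \<in> carrier_mat n m"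
    "\<And>x. x \<in> carrier_vec m \<Longrightarrow> A *\<^sub>v x = B *\<^sub>v x"
  shows "A = B"
proof (rule eq_matI)
  fix i j assume ij: "i < dim_row B" "j < dim_col B"
  have "(A *\<^sub>v unit_vec m j) $ i = (B *\<^sub>v unit_vec m j) $ i" using assms(3) by simp
  then show "A $$ (i, j) = B $$ (i, j)" using assms(1,2) ij by simp
qed (use assms in auto)

lemma mult_vec_zero:
  "(A :: 'a::field mat) \<in> carrier_mat n m \<Longrightarrow> A *\<^sub>v 0\<^sub>v m = 0\<^sub>v n"
  "x \<in> carrier_vec m \<Longrightarrow> 0\<^sub>m n m *\<^sub>v x = (0\<^sub>v n :: 'a vec)"
  by (intro eq_vecI; auto simp: scalar_prod_def)+

lemma zero_mat_if_mult_vec_zero: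
  assumes "(A :: 'a::field mat) \<in> carrier_mat n m" "\<And>x. x \<in> carrier_vec m \<Longrightarrow> A *\<^sub>v x = 0\<^sub>v n"
  shows "A = 0\<^sub>m n m"
  by (rule mat_eq_if_mult_vec_eq[OF assms(1)]) (use assms(2) mult_vec_zero(2) in auto)

lemma dual_vec_exists:
  assumes "(x :: 'a::field vec) \<in> carrier_vec n" "x \<noteq> 0\<^sub>v n"
  shows "\<exists>u\<in>carrier_vec n. u \<bullet> x = 1"
proof -
  obtain i where i: "i < n" "x $ i \<noteq> 0" using assms by (metis eq_vecI carrier_vecD index_zero_vec)
  have "(inverse (x $ i) \<cdot>\<^sub>v unit_vec n i) \<bullet> x = 1" using assms(1) i by simp
  then show ?thesis by (intro bexI[of _ "inverse (x $ i) \<cdot>\<^sub>v unit_vec n i"]) auto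
qed

text \<open>The rank one matrix \<open>z u^T\<close>.\<close>

definition outer :: "'a::field vec \<Rightarrow> 'a vec \<Rightarrow> 'a mat" where
  "outer z u = mat (dim_vec z) (dim_vec u) (\<lambda>(i, j). z $ i * u $ j)"

lemma outer_carrier: "z \<in> carrier_vec n \<Longrightarrow> u \<in> carrier_vec m \<Longrightarrow> outer z u \<in> carrier_mat n m"
  by (auto simp: outer_def)

lemma outer_mult_vec:
  assumes "z \<in> carrier_vec n" "u \<in> carrier_vec m" "x \<in> carrier_vec m"
  shows "outer z u *\<^sub>v x = (u \<bullet> x) \<cdot>\<^sub>v z"
  using assms by (intro eq_vecI) (auto simp: outer_def scalar_prod_def sum_distrib_right sum_distrib_left ac_simps)

lemma alternate_matsD: "A \<in> alternate_mats n \<Longrightarrow> A \<in> carrier_mat n n"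
  "A \<in> alternate_mats n \<Longrightarrow> x \<in> carrier_vec n \<Longrightarrow> x \<bullet> (A *\<^sub>v x) = 0"
  by (auto simp: alternate_mats_def)

lemma zero_alternate: "0\<^sub>m n n \<in> alternate_mats n"
  by (auto simp: alternate_mats_def scalar_prod_def)

lemma scalar_prod_mult_unit_vec:
  assumes "A \<in> carrier_mat n n" "i < n" "j < n"
  shows "unit_vec n i \<bullet> (A *\<^sub>v unit_vec n j) = (A $$ (i, j) :: 'a::field)"
  using assms by (simp add: scalar_prod_left_unit)

text \<open>Polarisation: the quadratic condition is evaluated at unit vectors and at a sum of two
  of them.\<close>

lemma alternate_entries:
  assumes A: "(A :: 'a::field mat) \<in> alternate_mats n" and i: "i < n" and j: "j < n"
  shows "A $$ (i, i) = 0" "A $$ (i, j) = - A $$ (j, i)"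
proof -
  note C = alternate_matsD(1)[OF A]
  have d: "A $$ (i, i) = 0" if "i < n" for i
    using alternate_matsD(2)[OF A, of "unit_vec n i"] scalar_prod_mult_unit_vec[OF C that that] by simp
  show "A $$ (i, i) = 0" using d[OF i] .
  let ?u = "unit_vec n i :: 'a vec" and ?v = "unit_vec n j :: 'a vec"
  have "(?u + ?v) \<bullet> (A *\<^sub>v (?u + ?v)) = ?u \<bullet> (A *\<^sub>v ?u) + ?u \<bullet> (A *\<^sub>v ?v) + (?v \<bullet> (A *\<^sub>v ?u) + ?v \<bullet> (A *\<^sub>v ?v))"
    using C by (simp add: mult_add_distrib_mat_vec[of _ n n] add_scalar_prod_distrib[of _ n]
        scalar_prod_add_distrib[of _ n])
  moreover have "(?u + ?v) \<bullet> (A *\<^sub>v (?u + ?v)) = 0" by (rule alternate_matsD(2)[OF A]) simp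
  ultimately have "A $$ (i, j) + A $$ (j, i) = 0"
    unfolding scalar_prod_mult_unit_vec[OF C i i] scalar_prod_mult_unit_vec[OF C i j]
      scalar_prod_mult_unit_vec[OF C j i] scalar_prod_mult_unit_vec[OF C j j] d[OF i] d[OF j] by simp
  then show "A $$ (i, j) = - A $$ (j, i)" by (simp add: eq_neg_iff_add_eq_0)
qed

text \<open>With \<open>u\<close> dual to \<open>x\<close> and \<open>w\<close> orthogonal to
  \<open>x\<close>, the matrix \<open>w u^T - u w^T\<close> sends \<open>x\<close> to
  \<open>w\<close>; this is how alternate matrices with a prescribed value are produced.\<close>

lemma outer_alternate:
  assumes w: "w \<in> carrier_vec n" and u: "u \<in> carrier_vec n"
  shows "outer w u - outer u w \<in> alternate_mats n"
    "x \<in> carrier_vec n \<Longrightarrow> (outer w u - outer u w) *\<^sub>v x = (u \<bullet> x) \<cdot>\<^sub>v w - (w \<bullet> x) \<cdot>\<^sub>v u"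
proof -
  note o = outer_carrier[OF w u] outer_carrier[OF u w]
  have e: "(outer w u - outer u w) *\<^sub>v x = (u \<bullet> x) \<cdot>\<^sub>v w - (w \<bullet> x) \<cdot>\<^sub>v u" if x: "x \<in> carrier_vec n" for x
    using minus_mult_distrib_mat_vec[OF o x] outer_mult_vec[OF w u x] outer_mult_vec[OF u w x] by simp
  show "x \<in> carrier_vec n \<Longrightarrow> (outer w u - outer u w) *\<^sub>v x = (u \<bullet> x) \<cdot>\<^sub>v w - (w \<bullet> x) \<cdot>\<^sub>v u" by (rule e)
  have "x \<bullet> ((outer w u - outer u w) *\<^sub>v x) = 0" if x: "x \<in> carrier_vec n" for x
    unfolding e[OF x] using w u x
    by (simp add: scalar_prod_minus_distrib[of _ n] comm_scalar_prod[OF x w] comm_scalar_prod[OF x u] mult.commute)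
  then show "outer w u - outer u w \<in> alternate_mats n" unfolding alternate_mats_def using o by auto
qed

lemma alternate_congruence:
  assumes A: "A \<in> alternate_mats n" and R: "R \<in> carrier_mat n n"
  shows "R\<^sup>T * A * R \<in> alternate_mats n"
proof -
  note C = alternate_matsD(1)[OF A]
  have "x \<bullet> ((R\<^sup>T * A * R) *\<^sub>v x) = 0" if x: "x \<in> carrier_vec n" for x
  proof -
    have "(R\<^sup>T * A * R) *\<^sub>v x = R\<^sup>T *\<^sub>v (A *\<^sub>v (R *\<^sub>v x))"
      using C R x by (simp add: square_mult[where n = n])
    then have "x \<bullet> ((R\<^sup>T * A * R) *\<^sub>v x) = (R *\<^sub>v x) \<bullet> (A *\<^sub>v (R *\<^sub>v x))"
      using transpose_vec_mult_scalar[of "R\<^sup>T" n n "A *\<^sub>v (R *\<^sub>v x)" x] C R x by simp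
    then show ?thesis using alternate_matsD(2)[OF A, of "R *\<^sub>v x"] R x by simp
  qed
  then show ?thesis unfolding alternate_mats_def using C R by auto
qed

lemma mult_alternate_carrier: "P \<in> carrier_mat n n \<Longrightarrow> mult_alternate n P \<subseteq> carrier_mat n n"
  unfolding mult_alternate_def using alternate_matsD(1)[of _ n] square_mult(1)[of P n] by blast

lemma zero_mult_alternate: "P \<in> carrier_mat n n \<Longrightarrow> 0\<^sub>m n n \<in> mult_alternate n P"
  unfolding mult_alternate_def using zero_alternate[of n] right_mult_zero_mat[of P n n n] by (metis (mono_tags, lifting) mem_Collect_eq)

text \<open>\<open>R P A R\<^sup>-\<^sup>1 = (R P R\<^sup>T) (R\<^sup>-\<^sup>T A R\<^sup>-\<^sup>1)\<close>, so similarity of spaces \<open>P A\<^sub>n\<close> is congruence of matrices.\<close>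

lemma conj_mult_alternate:
  assumes R: "mutual_inverse n R S" and P: "P \<in> carrier_mat n n"
  shows "conj_mats R S (mult_alternate n P) = mult_alternate n (R * P * R\<^sup>T)"
proof -
  note D = mutual_inverseD[OF R]
  have RT: "R\<^sup>T * S\<^sup>T = 1\<^sub>m n" using transpose_mult[OF D(2,1)] D(4) by simp
  have 1: "R * (P * A) * S = R * P * R\<^sup>T * (S\<^sup>T * A * S)" if A: "A \<in> carrier_mat n n" for A
  proof -
    have "R * P * R\<^sup>T * (S\<^sup>T * A * S) = R * (P * ((R\<^sup>T * S\<^sup>T) * (A * S)))"
      using D(1,2) P A by (simp add: square_mult[where n = n])
    then show ?thesis unfolding RT using D(1,2) P A by (simp add: square_mult[where n = n])
  qed
  have 2: "S\<^sup>T * (R\<^sup>T * A * R) * S = A" if A: "A \<in> carrier_mat n n" for A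
  proof -
    have ST: "S\<^sup>T * R\<^sup>T = 1\<^sub>m n" using transpose_mult[OF D(1,2)] D(3) by simp
    have "S\<^sup>T * (R\<^sup>T * A * R) * S = (S\<^sup>T * R\<^sup>T) * (A * (R * S))"
      using D(1,2) A by (simp add: square_mult[where n = n])
    then show ?thesis unfolding ST D(3) using A by simp
  qed
  show ?thesis
  proof
    show "conj_mats R S (mult_alternate n P) \<subseteq> mult_alternate n (R * P * R\<^sup>T)"
      unfolding conj_mats_def mult_alternate_def
      using 1 alternate_matsD(1) alternate_congruence[OF _ D(2)] by blast
    show "mult_alternate n (R * P * R\<^sup>T) \<subseteq> conj_mats R S (mult_alternate n P)"
    proof
      fix X assume "X \<in> mult_alternate n (R * P * R\<^sup>T)"
      then obtain A where A: "A \<in> alternate_mats n" "X = R * P * R\<^sup>T * A" unfolding mult_alternate_def by blast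
      let ?A = "R\<^sup>T * A * R"
      have A': "?A \<in> alternate_mats n" by (rule alternate_congruence[OF A(1) D(1)])
      have "X = R * (P * ?A) * S"
        using 1[OF alternate_matsD(1)[OF A']] 2[OF alternate_matsD(1)[OF A(1)]] A(2) by simp
      then show "X \<in> conj_mats R S (mult_alternate n P)"
        unfolding conj_mats_def mult_alternate_def using A' by blast
    qed
  qed
qed

lemma smult_alternate:
  assumes "A \<in> alternate_mats n"
  shows "c \<cdot>\<^sub>m A \<in> alternate_mats n"
proof -
  note C = alternate_matsD(1)[OF assms]
  have "x \<bullet> ((c \<cdot>\<^sub>m A) *\<^sub>v x) = 0" if x: "x \<in> carrier_vec n" for x
  proof -
    have "(c \<cdot>\<^sub>m A) *\<^sub>v x = c \<cdot>\<^sub>v (A *\<^sub>v x)" using C x by (intro eq_vecI) auto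
    then show ?thesis using alternate_matsD(2)[OF assms x] C x by simp
  qed
  then show ?thesis unfolding alternate_mats_def using C by auto
qed

lemma mult_alternate_smult:
  assumes P: "P \<in> carrier_mat n n" and c: "c \<noteq> 0"
  shows "mult_alternate n (c \<cdot>\<^sub>m P) = mult_alternate n P"
proof -
  have 1: "(c \<cdot>\<^sub>m P) * A = P * (c \<cdot>\<^sub>m A)" if "A \<in> alternate_mats n" for A
    using P alternate_matsD(1)[OF that] by (simp add: mult_smult_assoc_mat[of _ n n _ n] mult_smult_distrib[of _ n n _ n])
  have 2: "(c \<cdot>\<^sub>m P) * (inverse c \<cdot>\<^sub>m A) = P * A" if "A \<in> alternate_mats n" for A
  proof -
    have "c \<cdot>\<^sub>m (inverse c \<cdot>\<^sub>m A) = A" using c by (intro eq_matI) auto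
    then show ?thesis using 1[OF smult_alternate[OF that, of "inverse c"]] by simp
  qed
  show ?thesis
  proof
    show "mult_alternate n (c \<cdot>\<^sub>m P) \<subseteq> mult_alternate n P"
      unfolding mult_alternate_def using 1 smult_alternate by blast
    show "mult_alternate n P \<subseteq> mult_alternate n (c \<cdot>\<^sub>m P)"
      unfolding mult_alternate_def using 2[symmetric] smult_alternate by blast
  qed
qed

section \<open>Non-isotropic matrices and the spaces they define\<close>

lemma non_isotropicD:
  assumes "non_isotropic n P"
  shows "P \<in> carrier_mat n n" "x \<in> carrier_vec n \<Longrightarrow> x \<noteq> 0\<^sub>v n \<Longrightarrow> x \<bullet> (P *\<^sub>v x) \<noteq> 0"
  using assms by (auto simp: non_isotropic_def)

lemma non_isotropic_inverse:
  fixes P :: "'a::field mat"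
  assumes P: "non_isotropic n P"
  shows "\<exists>Q. mutual_inverse n P Q"
proof (rule inverse_exists[OF non_isotropicD(1)[OF P]])
  fix x :: "'a vec" assume "x \<in> carrier_vec n" "P *\<^sub>v x = 0\<^sub>v n"
  then show "x = 0\<^sub>v n" using non_isotropicD(2)[OF P, of x] by auto
qed

text \<open>With \<open>y = P x\<close>, hence \<open>x = Q y\<close>, the scalars
  \<open>x . P x\<close> and \<open>y . Q y\<close> coincide.\<close>

lemma inverse_non_isotropic:
  fixes P Q :: "'a::field mat"
  assumes Q: "non_isotropic n Q" and i: "mutual_inverse n P Q"
  shows "non_isotropic n P"
  unfolding non_isotropic_def
proof (intro conjI ballI impI)
  note D = mutual_inverseD[OF i]
  show "P \<in> carrier_mat n n" by (rule D(1))
  fix x :: "'a vec" assume x: "x \<in> carrier_vec n" "x \<noteq> 0\<^sub>v n"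
  let ?y = "P *\<^sub>v x"
  have y: "?y \<in> carrier_vec n" using D(1) x by simp
  have xy: "x = Q *\<^sub>v ?y" using mutual_inverse_vec[OF mutual_inverse_sym[OF i] x(1)] by simp
  have "?y \<noteq> 0\<^sub>v n" using xy x(2) D(2) by auto
  then have "?y \<bullet> (Q *\<^sub>v ?y) \<noteq> 0" using non_isotropicD(2)[OF Q y] by blast
  then show "x \<bullet> (P *\<^sub>v x) \<noteq> 0" using xy comm_scalar_prod[OF x(1) y] by simp
qed

text \<open>Left multiplication by \<open>M = Q' * P\<close> preserves alternate matrices. Testing
  it on \<open>E_ij - E_ji\<close> kills the entry \<open>(j, i)\<close> of \<open>M\<close> and
  equates two diagonal entries, so \<open>M\<close> is scalar; for \<open>n = 1\<close> this is
  automatic.\<close>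

lemma mult_alternate_scalar:
  assumes P: "mutual_inverse n P P'" and Q: "mutual_inverse n Q Q'" and n: "0 < n"
    and sub: "mult_alternate n P \<subseteq> mult_alternate n Q"
  shows "\<exists>c. c \<noteq> 0 \<and> P = c \<cdot>\<^sub>m Q"
proof -
  note D = mutual_inverseD[OF P] and E = mutual_inverseD[OF Q]
  define M where "M = Q' * P"
  have M: "M \<in> carrier_mat n n" unfolding M_def using D E by simp
  have QM: "Q * M = P" unfolding M_def using D E by (metis assoc_mult_mat left_mult_one_mat)
  have alt: "M * A \<in> alternate_mats n" if A: "A \<in> alternate_mats n" for A
  proof -
    have "P * A \<in> mult_alternate n Q" using sub A unfolding mult_alternate_def by blast
    then obtain B where B: "B \<in> alternate_mats n" "P * A = Q * B" unfolding mult_alternate_def by blast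
    have "M * A = Q' * (P * A)" unfolding M_def using D E alternate_matsD(1)[OF A] by (simp add: square_mult[where n = n])
    also have "\<dots> = (Q' * Q) * B" unfolding B(2) using E(1,2) alternate_matsD(1)[OF B(1)] by (simp add: square_mult[where n = n])
    finally show ?thesis using E B alternate_matsD(1)[OF B(1)] by simp
  qed
  have ent: "(M * (outer (unit_vec n i) (unit_vec n j) - outer (unit_vec n j) (unit_vec n i))) $$ (k, l)
      = (if l = j then M $$ (k, i) else 0) - (if l = i then M $$ (k, j) else 0)"
    if "i < n" "j < n" "k < n" "l < n" for i j k l
  proof -
    have 1: "outer (unit_vec n i) (unit_vec n j) $$ (m, l) = (if m = i then (if l = j then 1 else 0) else (0::'a))"
      if "i < n" "j < n" "m < n" "l < n" for i j m l
      using that by (simp add: outer_def)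
    have "(M * (outer (unit_vec n i) (unit_vec n j) - outer (unit_vec n j) (unit_vec n i))) $$ (k, l)
      = (\<Sum>m = 0..<n. M $$ (k, m) * (outer (unit_vec n i) (unit_vec n j) $$ (m, l) - outer (unit_vec n j) (unit_vec n i) $$ (m, l)))"
      using M that by (simp add: scalar_prod_def outer_def)
    also have "\<dots> = (\<Sum>m = 0..<n. (if m = i then (if l = j then M $$ (k, i) else 0) else 0)
        - (if m = j then (if l = i then M $$ (k, j) else 0) else 0))"
      by (rule sum.cong) (use that in \<open>auto simp: 1\<close>)
    also have "\<dots> = (if l = j then M $$ (k, i) else 0) - (if l = i then M $$ (k, j) else 0)"
      unfolding sum_subtractf using that by simp
    finally show ?thesis .
  qed
  have off: "M $$ (j, i) = 0" if ij: "i < n" "j < n" "i \<noteq> j" for i j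
    using alternate_entries(1)[OF alt[OF outer_alternate(1)[of "unit_vec n i" n "unit_vec n j"]] ij(2) ij(2)]
      ent[OF ij(1,2) ij(2,2)] ij by simp
  have dg: "M $$ (i, i) = M $$ (j, j)" if ij: "i < n" "j < n" "i \<noteq> j" for i j
    using alternate_entries(2)[OF alt[OF outer_alternate(1)[of "unit_vec n i" n "unit_vec n j"]] ij(1) ij(2)]
      ent[OF ij(1,2) ij(1,2)] ent[OF ij(1,2) ij(2,1)] ij by simp
  define c where "c = M $$ (0, 0)"
  have Mc: "M = c \<cdot>\<^sub>m 1\<^sub>m n"
  proof (rule eq_matI)
    fix i j assume "i < dim_row (c \<cdot>\<^sub>m 1\<^sub>m n)" "j < dim_col (c \<cdot>\<^sub>m 1\<^sub>m n)"
    then have ij: "i < n" "j < n" by auto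
    show "M $$ (i, j) = (c \<cdot>\<^sub>m 1\<^sub>m n) $$ (i, j)"
    proof (cases "i = j")
      case True
      then show ?thesis using dg[of i 0] ij n by (cases "i = 0") (auto simp: c_def)
    next
      case False
      then show ?thesis using off[of j i] ij by simp
    qed
  qed (use M in auto)
  have PQ: "P = c \<cdot>\<^sub>m Q" using QM E unfolding Mc by (simp add: mult_smult_distrib[of _ n n _ n])
  moreover have "c \<noteq> 0"
  proof
    assume "c = 0"
    then have "P = 0\<^sub>m n n" using PQ E by (intro eq_matI) auto
    then have "0\<^sub>m n n = (1\<^sub>m n :: 'a mat)" using D(2,3) by simp
    then have "(0\<^sub>m n n :: 'a mat) $$ (0, 0) = 1\<^sub>m n $$ (0, 0)" by simp
    then show False using n by simp
  qed
  ultimately show ?thesis by blast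
qed

text \<open>\<open>z - c x\<close> is reached from \<open>x\<close> as soon as its preimage
  \<open>w\<close> under \<open>P\<close> is orthogonal to \<open>x\<close>, and non-isotropy of the
  inverse \<open>Q\<close> permits such a choice of \<open>c\<close>.\<close>

lemma mult_alternate_transitive:
  assumes P: "non_isotropic n P" and x: "x \<in> carrier_vec n" "x \<noteq> 0\<^sub>v n" and z: "z \<in> carrier_vec n"
  shows "\<exists>c. \<exists>A\<in>mult_alternate n P. z = c \<cdot>\<^sub>v x + A *\<^sub>v x"
proof -
  obtain Q where i: "mutual_inverse n P Q" using non_isotropic_inverse[OF P] by blast
  note D = mutual_inverseD[OF i]
  have Q: "non_isotropic n Q" using inverse_non_isotropic[OF P mutual_inverse_sym[OF i]] .
  have q: "x \<bullet> (Q *\<^sub>v x) \<noteq> 0" using non_isotropicD(2)[OF Q x] .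
  define c where "c = (x \<bullet> (Q *\<^sub>v z)) / (x \<bullet> (Q *\<^sub>v x))"
  define w where "w = Q *\<^sub>v z - c \<cdot>\<^sub>v (Q *\<^sub>v x)"
  have w: "w \<in> carrier_vec n" unfolding w_def using D x z by simp
  have "x \<bullet> w = 0" unfolding w_def using D x z q
    by (simp add: scalar_prod_minus_distrib[of _ n] c_def)
  then have wx: "w \<bullet> x = 0" using comm_scalar_prod[OF w x(1)] by simp
  obtain u where u: "u \<in> carrier_vec n" "u \<bullet> x = 1" using dual_vec_exists[OF x] by blast
  let ?B = "outer w u - outer u w"
  note o = outer_alternate(1)[OF w u(1)]
  have Bx: "?B *\<^sub>v x = w" unfolding outer_alternate(2)[OF w u(1) x(1)] u(2) wx using w u by auto
  have "(P * ?B) *\<^sub>v x = P *\<^sub>v w" using Bx D(1) alternate_matsD(1)[OF o] x by (metis assoc_mult_mat_vec)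
  also have "\<dots> = P *\<^sub>v (Q *\<^sub>v z) - c \<cdot>\<^sub>v (P *\<^sub>v (Q *\<^sub>v x))"
    unfolding w_def using D x z by (simp add: mult_minus_distrib_mat_vec[of _ n n] mult_mat_vec[of _ n n])
  also have "\<dots> = z - c \<cdot>\<^sub>v x" using mutual_inverse_vec[OF i] x z by simp
  finally have "z = c \<cdot>\<^sub>v x + (P * ?B) *\<^sub>v x" using x z by (intro eq_vecI) auto
  then show ?thesis unfolding mult_alternate_def using o by blast
qed

section \<open>Joins of matrix spaces\<close>

lemma mat_join_eq:
  assumes "V \<subseteq> carrier_mat a a" "W \<subseteq> carrier_mat m m"
  shows "mat_join V W = {four_block_mat A B (0\<^sub>m m a) C | A B C. A \<in> V \<and> B \<in> carrier_mat a m \<and> C \<in> W}"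
proof -
  have V: "dim_row A = a" "dim_col A = a" if "A \<in> V" for A using that assms(1) by auto
  have W: "dim_row C = m" "dim_col C = m" if "C \<in> W" for C using that assms(2) by auto
  show ?thesis unfolding mat_join_def using V W by (auto; metis)
qed

lemma mat_joinI:
  assumes "V \<subseteq> carrier_mat a a" "W \<subseteq> carrier_mat m m" "A \<in> V" "B \<in> carrier_mat a m" "C \<in> W"
  shows "four_block_mat A B (0\<^sub>m m a) C \<in> mat_join V W"
  unfolding mat_join_eq[OF assms(1,2)] using assms by blast

lemma mat_joinE:
  assumes "X \<in> mat_join V W" "V \<subseteq> carrier_mat a a" "W \<subseteq> carrier_mat m m"
  obtains A B C where "X = four_block_mat A B (0\<^sub>m m a) C" "A \<in> V" "B \<in> carrier_mat a m" "C \<in> W"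
    "A \<in> carrier_mat a a" "C \<in> carrier_mat m m"
  using assms unfolding mat_join_eq[OF assms(2,3)] by blast

lemma mat_join_carrier:
  assumes "V \<subseteq> carrier_mat a a" "W \<subseteq> carrier_mat m m"
  shows "mat_join V W \<subseteq> carrier_mat (a + m) (a + m)"
proof
  fix X assume "X \<in> mat_join V W"
  then obtain A B C where "X = four_block_mat A B (0\<^sub>m m a) C" "A \<in> V" "B \<in> carrier_mat a m" "C \<in> W"
    "A \<in> carrier_mat a a" "C \<in> carrier_mat m m" by (rule mat_joinE[OF _ assms])
  then show "X \<in> carrier_mat (a + m) (a + m)" by simp
qed

lemma four_block_inj:
  assumes eq: "four_block_mat A B C D = four_block_mat A' B' C' D'"
    and c: "A \<in> carrier_mat a k" "B \<in> carrier_mat a l" "C \<in> carrier_mat m k" "D \<in> carrier_mat m l"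
    and c': "A' \<in> carrier_mat a k" "B' \<in> carrier_mat a l" "C' \<in> carrier_mat m k" "D' \<in> carrier_mat m l"
  shows "A = A'" "B = B'" "C = C'" "D = D'"
proof -
  have e: "four_block_mat A B C D $$ (i, j) = four_block_mat A' B' C' D' $$ (i, j)" for i j
    using eq by simp
  show "A = A'"
  proof (rule eq_matI)
    fix i j assume "i < dim_row A'" "j < dim_col A'"
    then show "A $$ (i, j) = A' $$ (i, j)" using e[of i j] c c' by simp
  qed (use c c' in auto)
  show "B = B'"
  proof (rule eq_matI)
    fix i j assume "i < dim_row B'" "j < dim_col B'"
    then show "B $$ (i, j) = B' $$ (i, j)" using e[of i "k + j"] c c' by simp
  qed (use c c' in auto)
  show "C = C'"
  proof (rule eq_matI)
    fix i j assume "i < dim_row C'" "j < dim_col C'"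
    then show "C $$ (i, j) = C' $$ (i, j)" using e[of "a + i" j] c c' by simp
  qed (use c c' in auto)
  show "D = D'"
  proof (rule eq_matI)
    fix i j assume "i < dim_row D'" "j < dim_col D'"
    then show "D $$ (i, j) = D' $$ (i, j)" using e[of "a + i" "k + j"] c c' by simp
  qed (use c c' in auto)
qed

lemma split_blocks:
  assumes "A \<in> carrier_mat (a + m) (k + l)"
  obtains A1 A2 A3 A4 where "A1 \<in> carrier_mat a k" "A2 \<in> carrier_mat a l"
    "A3 \<in> carrier_mat m k" "A4 \<in> carrier_mat m l" "A = four_block_mat A1 A2 A3 A4"
proof -
  obtain A1 A2 A3 A4 where s: "split_block A a k = (A1, A2, A3, A4)" by (metis prod_cases4)
  show ?thesis by (rule that; rule split_block[OF s, of m l]) (use assms in auto)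
qed

lemma upper_block_mult:
  assumes c: "A \<in> carrier_mat a k" "B \<in> carrier_mat a l" "D \<in> carrier_mat m l"
    and c': "A' \<in> carrier_mat k p" "B' \<in> carrier_mat k q" "D' \<in> carrier_mat l q"
  shows "four_block_mat A B (0\<^sub>m m k) D * four_block_mat A' B' (0\<^sub>m l p) D'
    = four_block_mat (A * A') (A * B' + B * D') (0\<^sub>m m p) (D * D')"
proof -
  have "A * A' + B * 0\<^sub>m l p = A * A'" "0\<^sub>m m k * A' + D * 0\<^sub>m l p = 0\<^sub>m m p"
    "0\<^sub>m m k * B' + D * D' = D * D'" using c c' by auto
  then show ?thesis using mult_four_block_mat[OF c(1,2) zero_carrier_mat c(3) c'(1,2) zero_carrier_mat c'(3)]
    by simp
qed

lemma mat_join_assoc: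
  assumes U: "U \<subseteq> carrier_mat a a" and V: "V \<subseteq> carrier_mat m m" and W: "W \<subseteq> carrier_mat k k"
  shows "mat_join U (mat_join V W) = mat_join (mat_join U V) W"
proof
  note vw = mat_join_carrier[OF V W] and uv = mat_join_carrier[OF U V]
  show "mat_join U (mat_join V W) \<subseteq> mat_join (mat_join U V) W"
  proof
    fix X assume "X \<in> mat_join U (mat_join V W)"
    then obtain A B Y where X: "X = four_block_mat A B (0\<^sub>m (m + k) a) Y" "A \<in> U" "B \<in> carrier_mat a (m + k)"
      "Y \<in> mat_join V W" "A \<in> carrier_mat a a" "Y \<in> carrier_mat (m + k) (m + k)"
      by (rule mat_joinE[OF _ U vw])
    obtain C D G where Y: "Y = four_block_mat C D (0\<^sub>m k m) G" "C \<in> V" "D \<in> carrier_mat m k" "G \<in> W"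
      "C \<in> carrier_mat m m" "G \<in> carrier_mat k k" by (rule mat_joinE[OF X(4) V W])
    define B1 where "B1 = mat a m (\<lambda>(i, j). B $$ (i, j))"
    define B2 where "B2 = mat a k (\<lambda>(i, j). B $$ (i, m + j))"
    have B12: "B1 \<in> carrier_mat a m" "B2 \<in> carrier_mat a k" unfolding B1_def B2_def by auto
    \<comment> \<open>Right-hand blocks of width 0 let \<open>four_block_mat\<close> stack
      \<open>B2\<close> on top of \<open>D\<close>.\<close>
    define Z where "Z = four_block_mat B2 (0\<^sub>m a 0) D (0\<^sub>m m 0)"
    have Z: "Z \<in> carrier_mat (a + m) k" unfolding Z_def using B12 Y by auto
    have "X = four_block_mat (four_block_mat A B1 (0\<^sub>m m a) C) Z (0\<^sub>m k (a + m)) G"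
      unfolding X(1) Y(1) using X Y B12 Z
      by (intro eq_matI) (auto simp: B1_def B2_def Z_def)
    then show "X \<in> mat_join (mat_join U V) W"
      using mat_joinI[OF uv W mat_joinI[OF U V X(2) B12(1) Y(2)] Z Y(4)] by simp
  qed
  show "mat_join (mat_join U V) W \<subseteq> mat_join U (mat_join V W)"
  proof
    fix X assume "X \<in> mat_join (mat_join U V) W"
    then obtain Y Z G where X: "X = four_block_mat Y Z (0\<^sub>m k (a + m)) G" "Y \<in> mat_join U V" "Z \<in> carrier_mat (a + m) k"
      "G \<in> W" "Y \<in> carrier_mat (a + m) (a + m)" "G \<in> carrier_mat k k"
      by (rule mat_joinE[OF _ uv W])
    obtain A B C where Y: "Y = four_block_mat A B (0\<^sub>m m a) C" "A \<in> U" "B \<in> carrier_mat a m" "C \<in> V"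
      "A \<in> carrier_mat a a" "C \<in> carrier_mat m m" by (rule mat_joinE[OF X(2) U V])
    define D where "D = mat m k (\<lambda>(i, j). Z $$ (a + i, j))"
    have D: "D \<in> carrier_mat m k" unfolding D_def by auto
    define B' where "B' = mat a (m + k) (\<lambda>(i, j). if j < m then B $$ (i, j) else Z $$ (i, j - m))"
    have B': "B' \<in> carrier_mat a (m + k)" unfolding B'_def by auto
    have "X = four_block_mat A B' (0\<^sub>m (m + k) a) (four_block_mat C D (0\<^sub>m k m) G)"
      unfolding X(1) Y(1) using X Y D B'
      by (intro eq_matI) (auto simp: B'_def D_def)
    then show "X \<in> mat_join U (mat_join V W)"
      using mat_joinI[OF U vw Y(2) B' mat_joinI[OF V W Y(4) D X(4)]] by simp
  qed
qed

lemma mat_join_empty: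
  assumes V: "V \<subseteq> carrier_mat a a"
  shows "mat_join V (carrier_mat 0 0) = V" "mat_join (carrier_mat 0 0) V = V"
proof -
  have z: "C = 0\<^sub>m 0 0" if "C \<in> carrier_mat 0 0" for C :: "'a mat" using that by (intro eq_matI) auto
  have 1: "four_block_mat A B (0\<^sub>m 0 a) (0\<^sub>m 0 0) = A" if "A \<in> carrier_mat a a" for A B :: "'a mat"
    using that by (intro eq_matI) auto
  have 2: "four_block_mat (0\<^sub>m 0 0) B (0\<^sub>m a 0) A = A" if "A \<in> carrier_mat a a" for A B :: "'a mat"
    using that by (intro eq_matI) auto
  have c0: "(0\<^sub>m 0 0 :: 'a mat) \<in> carrier_mat 0 0" by simp
  show "mat_join V (carrier_mat 0 0) = V"
  proof
    show "mat_join V (carrier_mat 0 0) \<subseteq> V"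
      unfolding mat_join_eq[OF V order_refl] using 1 V z by auto
    show "V \<subseteq> mat_join V (carrier_mat 0 0)"
    proof
      fix A assume A: "A \<in> V"
      then show "A \<in> mat_join V (carrier_mat 0 0)"
        using mat_joinI[OF V order_refl A zero_carrier_mat c0] 1[of A "0\<^sub>m a 0"] V by auto
    qed
  qed
  show "mat_join (carrier_mat 0 0) V = V"
  proof
    show "mat_join (carrier_mat 0 0) V \<subseteq> V"
      unfolding mat_join_eq[OF order_refl V] using 2 V z by auto
    show "V \<subseteq> mat_join (carrier_mat 0 0) V"
    proof
      fix A assume A: "A \<in> V"
      then show "A \<in> mat_join (carrier_mat 0 0) V"
        using mat_joinI[OF order_refl V c0 zero_carrier_mat A] 2[of A "0\<^sub>m 0 a"] V by auto
    qed
  qed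
qed

lemma alternate_join_Nil: "alternate_join [] Ps = carrier_mat 0 0"
  by (simp add: alternate_join_def mat_joins_def)

lemma alternate_join_Cons:
  "alternate_join (n # ns) (P # Ps) = mat_join (mult_alternate n P) (alternate_join ns Ps)"
  by (simp add: alternate_join_def mat_joins_def)

text \<open>Membership of the zero matrix makes the join non-empty, from which
  \<open>alternate_join_size\<close> reads off its size; it also fills blocks that an argument
  leaves aside.\<close>

lemma alternate_join_carrier:
  assumes "length Ps = length ns" "\<And>k. k < length ns \<Longrightarrow> Ps ! k \<in> carrier_mat (ns ! k) (ns ! k)"
  shows "alternate_join ns Ps \<subseteq> carrier_mat (sum_list ns) (sum_list ns)"
    "0\<^sub>m (sum_list ns) (sum_list ns) \<in> alternate_join ns Ps"
proof -
  have "alternate_join ns Ps \<subseteq> carrier_mat (sum_list ns) (sum_list ns) \<and>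
    0\<^sub>m (sum_list ns) (sum_list ns) \<in> alternate_join ns Ps"
    using assms
  proof (induction ns arbitrary: Ps)
    case Nil
    then show ?case by (simp add: alternate_join_Nil)
  next
    case (Cons n ns)
    obtain P Qs where Ps: "Ps = P # Qs" "length Qs = length ns" using Cons.prems(1) by (cases Ps) auto
    have P: "P \<in> carrier_mat n n" using Cons.prems(2)[of 0] Ps by simp
    have "Qs ! k \<in> carrier_mat (ns ! k) (ns ! k)" if "k < length ns" for k
      using Cons.prems(2)[of "Suc k"] that Ps by simp
    note IH = Cons.IH[OF Ps(2) this]
    note mc = mult_alternate_carrier[OF P]
    have "0\<^sub>m (n + sum_list ns) (n + sum_list ns) \<in> mat_join (mult_alternate n P) (alternate_join ns Qs)"
      using mat_joinI[OF mc conjunct1[OF IH] zero_mult_alternate[OF P] zero_carrier_mat conjunct2[OF IH]]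
      by simp
    then show ?case using mat_join_carrier[OF mc conjunct1[OF IH]] Ps(1)
      by (simp add: alternate_join_Cons)
  qed
  then show "alternate_join ns Ps \<subseteq> carrier_mat (sum_list ns) (sum_list ns)"
    "0\<^sub>m (sum_list ns) (sum_list ns) \<in> alternate_join ns Ps" by auto
qed

lemma non_isotropic_list_carrier:
  assumes "non_isotropic_list ns Ps"
  shows "length Ps = length ns" "k < length ns \<Longrightarrow> Ps ! k \<in> carrier_mat (ns ! k) (ns ! k)"
  using assms non_isotropicD(1) unfolding non_isotropic_list_def by auto

lemma non_isotropic_join_carrier:
  assumes "non_isotropic_list ns Ps"
  shows "alternate_join ns Ps \<subseteq> carrier_mat (sum_list ns) (sum_list ns)"
    "0\<^sub>m (sum_list ns) (sum_list ns) \<in> alternate_join ns Ps"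
  using alternate_join_carrier[of Ps ns] non_isotropic_list_carrier[OF assms] by auto

lemma non_isotropic_list_Cons:
  "non_isotropic_list (n # ns) Qs \<longleftrightarrow>
    (\<exists>P Ps. Qs = P # Ps \<and> 0 < n \<and> non_isotropic n P \<and> non_isotropic_list ns Ps)"
  unfolding non_isotropic_list_def by (cases Qs) (auto simp: All_less_Suc2)

text \<open>\<open>mat_joins\<close> nests to the right and so exposes the first block, while the
  existence proof adds the last one.\<close>

lemma alternate_join_snoc:
  assumes "length Ps = length ns" "\<And>k. k < length ns \<Longrightarrow> Ps ! k \<in> carrier_mat (ns ! k) (ns ! k)"
    and P: "P \<in> carrier_mat n n"
  shows "alternate_join (ns @ [n]) (Ps @ [P]) = mat_join (alternate_join ns Ps) (mult_alternate n P)"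
  using assms(1,2)
proof (induction ns arbitrary: Ps)
  case Nil
  then show ?case using mat_join_empty[OF mult_alternate_carrier[OF P]]
    by (simp add: alternate_join_Nil alternate_join_Cons)
next
  case (Cons m ns)
  obtain Q Qs where Ps: "Ps = Q # Qs" "length Qs = length ns" using Cons.prems(1) by (cases Ps) auto
  have Q: "Q \<in> carrier_mat m m" using Cons.prems(2)[of 0] Ps by simp
  have c: "Qs ! k \<in> carrier_mat (ns ! k) (ns ! k)" if "k < length ns" for k
    using Cons.prems(2)[of "Suc k"] that Ps by simp
  note IH = Cons.IH[OF Ps(2) c]
  show ?case
    using IH mat_join_assoc[OF mult_alternate_carrier[OF Q] alternate_join_carrier(1)[OF Ps(2) c] mult_alternate_carrier[OF P]]
    unfolding Ps(1) by (simp add: alternate_join_Cons)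
qed

text \<open>Conjugation by the block diagonal matrix of \<open>R\<close> and \<open>T\<close> sends
  the free corner \<open>B\<close> to \<open>R * B * U\<close>, which again ranges over all
  matrices.\<close>

lemma similar_mat_join:
  assumes s1: "similar_subspaces a V V'" and s2: "similar_subspaces m W W'"
  shows "similar_subspaces (a + m) (mat_join V W) (mat_join V' W')"
proof -
  obtain R S where R: "mutual_inverse a R S" "V' = conj_mats R S V" using s1 unfolding similar_subspaces_iff by blast
  obtain T U where T: "mutual_inverse m T U" "W' = conj_mats T U W" using s2 unfolding similar_subspaces_iff by blast
  have c: "V \<subseteq> carrier_mat a a" "V' \<subseteq> carrier_mat a a" "W \<subseteq> carrier_mat m m" "W' \<subseteq> carrier_mat m m"
    using s1 s2 unfolding similar_subspaces_iff by auto
  note DR = mutual_inverseD[OF R(1)] and DT = mutual_inverseD[OF T(1)]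
  let ?R = "four_block_mat R (0\<^sub>m a m) (0\<^sub>m m a) T" and ?S = "four_block_mat S (0\<^sub>m a m) (0\<^sub>m m a) U"
  have "?R * ?S = 1\<^sub>m (a + m)" "?S * ?R = 1\<^sub>m (a + m)"
    using upper_block_mult[OF DR(1) zero_carrier_mat DT(1) DR(2) zero_carrier_mat DT(2)]
      upper_block_mult[OF DR(2) zero_carrier_mat DT(2) DR(1) zero_carrier_mat DT(1)] DR DT
    by (simp_all add: left_mult_zero_mat[of _ m m] right_mult_zero_mat[of _ a a])
  then have mi: "mutual_inverse (a + m) ?R ?S" unfolding mutual_inverse_def using DR DT by simp
  have blk: "?R * four_block_mat A B (0\<^sub>m m a) C * ?S = four_block_mat (R * A * S) (R * B * U) (0\<^sub>m m a) (T * C * U)"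
    if "A \<in> carrier_mat a a" "B \<in> carrier_mat a m" "C \<in> carrier_mat m m" for A B C
  proof -
    have 1: "?R * four_block_mat A B (0\<^sub>m m a) C = four_block_mat (R * A) (R * B) (0\<^sub>m m a) (T * C)"
      using upper_block_mult[OF DR(1) zero_carrier_mat DT(1) that] that DR DT by simp
    have c: "R * A \<in> carrier_mat a a" "R * B \<in> carrier_mat a m" "T * C \<in> carrier_mat m m"
      using that DR DT by auto
    show ?thesis unfolding 1
      using upper_block_mult[OF c DR(2) zero_carrier_mat DT(2)] that DR DT by simp
  qed
  have "mat_join V' W' = conj_mats ?R ?S (mat_join V W)"
  proof
    show "mat_join V' W' \<subseteq> conj_mats ?R ?S (mat_join V W)"
    proof
      fix X assume "X \<in> mat_join V' W'"
      then obtain A' B C' where X: "X = four_block_mat A' B (0\<^sub>m m a) C'" "A' \<in> V'" "B \<in> carrier_mat a m" "C' \<in> W'"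
        "A' \<in> carrier_mat a a" "C' \<in> carrier_mat m m" by (rule mat_joinE[OF _ c(2,4)])
      obtain A where A: "A \<in> V" "A' = R * A * S" using X(2) R(2) unfolding conj_mats_def by blast
      obtain C where C: "C \<in> W" "C' = T * C * U" using X(4) T(2) unfolding conj_mats_def by blast
      \<comment> \<open>\<open>S * B * T\<close> is the corner that the conjugation carries to
        \<open>B\<close>.\<close>
      have Bc: "S * B * T \<in> carrier_mat a m" using DR DT X(3) by simp
      have BT: "B * T \<in> carrier_mat a m" using DT X(3) by simp
      have "R * (S * B * T) = R * (S * (B * T))" using DR DT X(3) by (simp add: assoc_mult_mat[of _ a a _ m _ m])
      also have "\<dots> = R * S * (B * T)" by (rule assoc_mult_mat[OF DR(1,2) BT, symmetric])
      also have "\<dots> = B * T" unfolding DR(3) by (rule left_mult_one_mat[OF BT])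
      finally have "R * (S * B * T) * U = B * (T * U)" using DT X(3) by (simp add: assoc_mult_mat[of _ a m _ m _ m])
      then have RB: "R * (S * B * T) * U = B" unfolding DT(3) using right_mult_one_mat[OF X(3)] by simp
      have AC: "A \<in> carrier_mat a a" "C \<in> carrier_mat m m" using A C c by auto
      have "X = ?R * four_block_mat A (S * B * T) (0\<^sub>m m a) C * ?S"
        unfolding blk[OF AC(1) Bc AC(2)] RB X(1) A(2) C(2) ..
      then show "X \<in> conj_mats ?R ?S (mat_join V W)"
        unfolding conj_mats_def using mat_joinI[OF c(1,3) A(1) Bc C(1)] by blast
    qed
    show "conj_mats ?R ?S (mat_join V W) \<subseteq> mat_join V' W'"
    proof
      fix X assume "X \<in> conj_mats ?R ?S (mat_join V W)"
      then obtain Y where Y: "Y \<in> mat_join V W" "X = ?R * Y * ?S" unfolding conj_mats_def by blast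
      obtain A B C where Y': "Y = four_block_mat A B (0\<^sub>m m a) C" "A \<in> V" "B \<in> carrier_mat a m" "C \<in> W"
        "A \<in> carrier_mat a a" "C \<in> carrier_mat m m" by (rule mat_joinE[OF Y(1) c(1,3)])
      have "R * A * S \<in> V'" "T * C * U \<in> W'" using Y' R T unfolding conj_mats_def by auto
      moreover have "R * B * U \<in> carrier_mat a m" using Y' DR DT by simp
      ultimately show "X \<in> mat_join V' W'" unfolding Y(2) Y'(1) blk[OF Y'(5,3,6)]
        by (intro mat_joinI[OF c(2,4)])
    qed
  qed
  then show ?thesis unfolding similar_subspaces_iff
    using mat_join_carrier[OF c(1,3)] mat_join_carrier[OF c(2,4)] mi by blast
qed

text \<open>A zero scalar is ruled out by the invertibility of \<open>Q\<close> in positive size;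
  the rest is \<open>conj_mult_alternate\<close> for the same \<open>R\<close>.\<close>

lemma congruent_similar:
  assumes P: "P \<in> carrier_mat n n" and Q: "Q \<in> GL_mat n" "congruent_mats n Q (c \<cdot>\<^sub>m P)" and n: "0 < n"
  shows "similar_subspaces n (mult_alternate n P) (mult_alternate n Q)"
proof -
  obtain R where R: "R \<in> GL_mat n" "Q = R * (c \<cdot>\<^sub>m P) * R\<^sup>T" and Qc: "Q \<in> carrier_mat n n"
    using Q(2) unfolding congruent_mats_def by blast
  obtain S where S: "mutual_inverse n R S" using R(1) GL_mat_iff by blast
  note D = mutual_inverseD[OF S]
  have "c \<noteq> 0"
  proof
    assume "c = 0"
    then have "c \<cdot>\<^sub>m P = 0\<^sub>m n n" using P by (intro eq_matI) auto
    then have Q0: "Q = 0\<^sub>m n n" using R(2) D(1) by simp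
    obtain T where T: "mutual_inverse n Q T" using Q(1) GL_mat_iff by blast
    have "0\<^sub>m n n = (1\<^sub>m n :: 'a mat)" using mutual_inverseD(2,3)[OF T] Q0 by simp
    then have "(0\<^sub>m n n :: 'a mat) $$ (0, 0) = 1\<^sub>m n $$ (0, 0)" by simp
    then show False using n by simp
  qed
  then have "mult_alternate n Q = conj_mats R S (mult_alternate n P)"
    using conj_mult_alternate[OF S, of "c \<cdot>\<^sub>m P"] mult_alternate_smult[OF P] P R(2) by simp
  then show ?thesis unfolding similar_subspaces_iff
    using S mult_alternate_carrier[OF P] mult_alternate_carrier[OF Qc] by blast
qed

lemma congruent_join_similar:
  assumes "non_isotropic_list ns Ps" "length Qs = length ns"
    "\<And>k. k < length ns \<Longrightarrow> Qs ! k \<in> GL_mat (ns ! k) \<and> (\<exists>c. congruent_mats (ns ! k) (Qs ! k) (c \<cdot>\<^sub>m (Ps ! k)))"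
  shows "similar_subspaces (sum_list ns) (alternate_join ns Ps) (alternate_join ns Qs)"
  using assms
proof (induction ns arbitrary: Ps Qs)
  case Nil
  have "mutual_inverse 0 (1\<^sub>m 0) (1\<^sub>m 0 :: 'a mat)" by (simp add: mutual_inverse_def)
  moreover have "conj_mats (1\<^sub>m 0) (1\<^sub>m 0) (carrier_mat 0 0) = (carrier_mat 0 0 :: 'a mat set)"
    unfolding conj_mats_def by (simp add: image_def)
  ultimately show ?case unfolding similar_subspaces_iff alternate_join_Nil by fastforce
next
  case (Cons n ns)
  obtain P Ps' where P: "Ps = P # Ps'" "0 < n" "non_isotropic n P" "non_isotropic_list ns Ps'"
    using Cons.prems(1) unfolding non_isotropic_list_Cons by blast
  obtain Q Qs' where Q: "Qs = Q # Qs'" "length Qs' = length ns" using Cons.prems(2) by (cases Qs) auto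
  have q: "Q \<in> GL_mat n" "\<exists>c. congruent_mats n Q (c \<cdot>\<^sub>m P)" using Cons.prems(3)[of 0] P Q by auto
  then have "similar_subspaces n (mult_alternate n P) (mult_alternate n Q)"
    using congruent_similar[OF non_isotropicD(1)[OF P(3)]] P(2) by blast
  moreover have "similar_subspaces (sum_list ns) (alternate_join ns Ps') (alternate_join ns Qs')"
  proof (rule Cons.IH[OF P(4) Q(2)])
    fix k assume "k < length ns"
    then show "Qs' ! k \<in> GL_mat (ns ! k) \<and> (\<exists>c. congruent_mats (ns ! k) (Qs' ! k) (c \<cdot>\<^sub>m (Ps' ! k)))"
      using Cons.prems(3)[of "Suc k"] P Q by simp
  qed
  ultimately show ?case using similar_mat_join unfolding P(1) Q(1) alternate_join_Cons by simp
qed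

section \<open>Uniqueness of the blocks\<close>

lemma append_vec_inj:
  assumes "x @\<^sub>v y = x' @\<^sub>v y'" "x \<in> carrier_vec a" "x' \<in> carrier_vec a"
  shows "x = x'" "y = y'"
  using append_vec_eq[OF assms(2,3)] assms(1) by auto

text \<open>The multiple of \<open>x\<close> is there because, under a trivial spectrum, a non-zero
  \<open>x\<close> is never itself of the form \<open>A x\<close>.\<close>

definition every_vector_cyclic :: "nat \<Rightarrow> 'a::field mat set \<Rightarrow> bool" where
  "every_vector_cyclic a V \<longleftrightarrow> (\<forall>x\<in>carrier_vec a. \<forall>z\<in>carrier_vec a. x \<noteq> 0\<^sub>v a \<longrightarrow>
    (\<exists>c. \<exists>A\<in>V. z = c \<cdot>\<^sub>v x + A *\<^sub>v x))"

text \<open>If the lower component of \<open>x\<close> is non-zero, a matrix with only a corner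
  block moves \<open>x\<close> to any prescribed \<open>(z, 0)\<close>; otherwise \<open>x\<close>
  lies in the first block and cyclicity applies there.\<close>

lemma invariant_contains_first_block:
  fixes V W :: "'a::field mat set"
  assumes V: "V \<subseteq> carrier_mat a a" "0\<^sub>m a a \<in> V" and W: "W \<subseteq> carrier_mat m m" "0\<^sub>m m m \<in> W"
    and irr: "every_vector_cyclic a V"
    and U: "U \<subseteq> carrier_vec (a + m)" "\<And>x y c. x \<in> U \<Longrightarrow> y \<in> U \<Longrightarrow> c \<cdot>\<^sub>v x + y \<in> U"
      "\<And>M x. M \<in> mat_join V W \<Longrightarrow> x \<in> U \<Longrightarrow> M *\<^sub>v x \<in> U"
    and x: "x \<in> U" "x \<noteq> 0\<^sub>v (a + m)" and z: "z \<in> carrier_vec a"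
  shows "z @\<^sub>v 0\<^sub>v m \<in> U"
proof -
  have xc: "x \<in> carrier_vec (a + m)" using x U by blast
  define x1 where "x1 = vec_first x a"
  define x2 where "x2 = vec_last x m"
  have c: "x1 \<in> carrier_vec a" "x2 \<in> carrier_vec m" unfolding x1_def x2_def by auto
  have x12: "x = x1 @\<^sub>v x2" unfolding x1_def x2_def using vec_first_last_append[OF xc] by simp
  show ?thesis
  proof (cases "x2 = 0\<^sub>v m")
    case False
    obtain u where u: "u \<in> carrier_vec m" "u \<bullet> x2 = 1" using dual_vec_exists[OF c(2) False] by blast
    have o: "outer z u \<in> carrier_mat a m" by (rule outer_carrier[OF z u(1)])
    have "four_block_mat (0\<^sub>m a a) (outer z u) (0\<^sub>m m a) (0\<^sub>m m m) *\<^sub>v x = z @\<^sub>v 0\<^sub>v m"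
      unfolding x12 four_block_mat_mult_vec[OF zero_carrier_mat o zero_carrier_mat zero_carrier_mat c]
      using outer_mult_vec[OF z u(1) c(2)] u(2) c z by auto
    then show ?thesis using U(3)[OF mat_joinI[OF V(1) W(1) V(2) o W(2)] x(1)] by simp
  next
    case True
    then have "x1 \<noteq> 0\<^sub>v a" using x(2) x12 by auto
    then obtain k A where A: "A \<in> V" "z = k \<cdot>\<^sub>v x1 + A *\<^sub>v x1" using irr c(1) z unfolding every_vector_cyclic_def by blast
    have Ac: "A \<in> carrier_mat a a" using A V by blast
    let ?M = "four_block_mat A (0\<^sub>m a m) (0\<^sub>m m a) (0\<^sub>m m m)"
    have "?M *\<^sub>v x = A *\<^sub>v x1 @\<^sub>v 0\<^sub>v m"
      unfolding x12 four_block_mat_mult_vec[OF Ac zero_carrier_mat zero_carrier_mat zero_carrier_mat c]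
      using c Ac True by auto
    moreover have "k \<cdot>\<^sub>v x + (A *\<^sub>v x1 @\<^sub>v 0\<^sub>v m) = z @\<^sub>v 0\<^sub>v m"
      unfolding A(2) x12 True using c Ac by (intro eq_vecI) auto
    ultimately show ?thesis
      using U(2)[OF x(1) U(3)[OF mat_joinI[OF V(1) W(1) A(1) zero_carrier_mat W(2)] x(1)], of k] by simp
  qed
qed

text \<open>\<open>U\<close>, the image of the first block under \<open>R\<close>, is non-zero and
  invariant under the second join, so it contains the first block of that join. Hence
  \<open>S\<close> maps the first block of size \<open>a'\<close> into that of size
  \<open>a\<close>; the two sizes are not yet known to agree.\<close>

lemma conj_lower_left_zero:
  fixes V W V' W' :: "'a::field mat set"
  assumes a: "0 < a" and n: "n = a + m" "n = a' + m'"
    and V: "V \<subseteq> carrier_mat a a" and W: "W \<subseteq> carrier_mat m m"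
    and V': "V' \<subseteq> carrier_mat a' a'" "0\<^sub>m a' a' \<in> V'" and W': "W' \<subseteq> carrier_mat m' m'" "0\<^sub>m m' m' \<in> W'"
    and irr: "every_vector_cyclic a' V'"
    and R: "mutual_inverse n R S" and eq: "mat_join V' W' = conj_mats R S (mat_join V W)"
  shows "\<exists>S1 S2 S4. S1 \<in> carrier_mat a a' \<and> S2 \<in> carrier_mat a m' \<and> S4 \<in> carrier_mat m m' \<and>
    S = four_block_mat S1 S2 (0\<^sub>m m a') S4"
proof -
  note D = mutual_inverseD[OF R]
  have Dn: "R \<in> carrier_mat (a + m) (a + m)" "S \<in> carrier_mat (a + m) (a' + m')" using D n by auto
  define U where "U = {R *\<^sub>v (y @\<^sub>v 0\<^sub>v m) | y. y \<in> carrier_vec a}"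
  have Uc: "U \<subseteq> carrier_vec (a' + m')" unfolding U_def using D(1) n by auto
  have Ulin: "c \<cdot>\<^sub>v x + y \<in> U" if x: "x \<in> U" and y: "y \<in> U" for x y c
  proof -
    obtain p where p: "p \<in> carrier_vec a" "x = R *\<^sub>v (p @\<^sub>v 0\<^sub>v m)" using x unfolding U_def by blast
    obtain q where q: "q \<in> carrier_vec a" "y = R *\<^sub>v (q @\<^sub>v 0\<^sub>v m)" using y unfolding U_def by blast
    have pq: "p @\<^sub>v 0\<^sub>v m \<in> carrier_vec (a + m)" "q @\<^sub>v 0\<^sub>v m \<in> carrier_vec (a + m)" using p q by auto
    have "c \<cdot>\<^sub>v x + y = R *\<^sub>v (c \<cdot>\<^sub>v (p @\<^sub>v 0\<^sub>v m) + (q @\<^sub>v 0\<^sub>v m))"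
      unfolding p(2) q(2) using Dn(1) pq by (simp add: mult_add_distrib_mat_vec mult_mat_vec)
    also have "c \<cdot>\<^sub>v (p @\<^sub>v 0\<^sub>v m) + (q @\<^sub>v 0\<^sub>v m) = (c \<cdot>\<^sub>v p + q) @\<^sub>v 0\<^sub>v m"
      using p q by (intro eq_vecI) auto
    finally show ?thesis unfolding U_def using p q by auto
  qed
  have Uinv: "M *\<^sub>v x \<in> U" if M: "M \<in> mat_join V' W'" and x: "x \<in> U" for M x
  proof -
    obtain N where N: "N \<in> mat_join V W" "M = R * N * S" using M unfolding eq conj_mats_def by blast
    obtain A B C where ABC: "N = four_block_mat A B (0\<^sub>m m a) C" "A \<in> V" "B \<in> carrier_mat a m" "C \<in> W"
      "A \<in> carrier_mat a a" "C \<in> carrier_mat m m" by (rule mat_joinE[OF N(1) V W])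
    obtain y where y: "y \<in> carrier_vec a" "x = R *\<^sub>v (y @\<^sub>v 0\<^sub>v m)" using x unfolding U_def by blast
    have yc: "y @\<^sub>v 0\<^sub>v m \<in> carrier_vec n" using y n by auto
    have Nc: "N \<in> carrier_mat n n" using ABC n by simp
    have Sx: "S *\<^sub>v x = y @\<^sub>v 0\<^sub>v m" unfolding y(2) using mutual_inverse_vec[OF mutual_inverse_sym[OF R] yc] .
    have xc: "x \<in> carrier_vec n" unfolding y(2) using D(1) yc by simp
    have "M *\<^sub>v x = R *\<^sub>v (N *\<^sub>v (S *\<^sub>v x))" unfolding N(2) using D(1,2) Nc xc by (simp add: square_mult[where n = n])
    also have "N *\<^sub>v (S *\<^sub>v x) = A *\<^sub>v y @\<^sub>v 0\<^sub>v m"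
      unfolding Sx ABC(1) four_block_mat_mult_vec[OF ABC(5,3) zero_carrier_mat ABC(6) y(1) zero_carrier_vec]
      using ABC y by (simp add: mult_vec_zero[where n = a and m = m] mult_vec_zero[where n = m and m = m] mult_vec_zero(2)[where n = m and m = a])
    finally show ?thesis unfolding U_def using ABC(5) y(1) by auto
  qed
  let ?e = "unit_vec a 0 @\<^sub>v 0\<^sub>v m :: 'a vec"
  have ec: "?e \<in> carrier_vec n" using n by auto
  have e0: "?e \<noteq> 0\<^sub>v n"
  proof
    assume "?e = 0\<^sub>v n"
    then have "?e $ 0 = 0\<^sub>v n $ 0" by simp
    then show False using a n by simp
  qed
  have eU: "R *\<^sub>v ?e \<in> U" unfolding U_def by auto
  have Re: "R *\<^sub>v ?e \<noteq> 0\<^sub>v (a' + m')"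
  proof
    assume "R *\<^sub>v ?e = 0\<^sub>v (a' + m')"
    then have "?e = S *\<^sub>v 0\<^sub>v n" using mutual_inverse_vec[OF mutual_inverse_sym[OF R] ec] n by simp
    then show False using e0 mult_vec_zero(1)[OF D(2)] by simp
  qed
  have zU: "z @\<^sub>v 0\<^sub>v m' \<in> U" if "z \<in> carrier_vec a'" for z
    by (rule invariant_contains_first_block[OF V' W' irr Uc Ulin Uinv eU Re that])
  obtain S1 S2 S3 S4 where S: "S1 \<in> carrier_mat a a'" "S2 \<in> carrier_mat a m'"
    "S3 \<in> carrier_mat m a'" "S4 \<in> carrier_mat m m'" "S = four_block_mat S1 S2 S3 S4"
    by (rule split_blocks[OF Dn(2)])
  have "S3 *\<^sub>v z = 0\<^sub>v m" if z: "z \<in> carrier_vec a'" for z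
  proof -
    obtain y where y: "y \<in> carrier_vec a" "z @\<^sub>v 0\<^sub>v m' = R *\<^sub>v (y @\<^sub>v 0\<^sub>v m)" using zU[OF z] unfolding U_def by blast
    have yc: "y @\<^sub>v 0\<^sub>v m \<in> carrier_vec n" using y n by auto
    have "S *\<^sub>v (z @\<^sub>v 0\<^sub>v m') = y @\<^sub>v 0\<^sub>v m"
      unfolding y(2) using mutual_inverse_vec[OF mutual_inverse_sym[OF R] yc] .
    moreover have "S *\<^sub>v (z @\<^sub>v 0\<^sub>v m') = (S1 *\<^sub>v z + S2 *\<^sub>v 0\<^sub>v m') @\<^sub>v (S3 *\<^sub>v z + S4 *\<^sub>v 0\<^sub>v m')"
      unfolding S(5) by (rule four_block_mat_mult_vec[OF S(1-4) z zero_carrier_vec])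
    ultimately have "(S1 *\<^sub>v z + S2 *\<^sub>v 0\<^sub>v m') @\<^sub>v (S3 *\<^sub>v z + S4 *\<^sub>v 0\<^sub>v m') = y @\<^sub>v 0\<^sub>v m" by simp
    then have "S3 *\<^sub>v z + S4 *\<^sub>v 0\<^sub>v m' = 0\<^sub>v m"
      by (rule append_vec_inj(2)) (use S z y in auto)
    then show ?thesis using mult_vec_zero(1)[OF S(4)] right_zero_vec[of "S3 *\<^sub>v z" m] S(3) z by simp
  qed
  then have "S3 = 0\<^sub>m m a'" by (rule zero_mat_if_mult_vec_zero[OF S(3)])
  then show ?thesis using S by blast
qed

text \<open>Padding with zeros to size \<open>p\<close> keeps the product. A one-sided inverse of a
  square matrix is two-sided, but for \<open>a < p\<close> row \<open>a\<close> of \<open>S'\<close>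
  is zero.\<close>

lemma rectangular_inverse_le:
  assumes R: "R \<in> carrier_mat p a" and S: "S \<in> carrier_mat a p" and RS: "R * S = (1\<^sub>m p :: 'a::field mat)"
  shows "p \<le> a"
proof (rule ccontr)
  assume "\<not> p \<le> a"
  then obtain k where p: "p = a + k" and k: "0 < k" by (metis le_add_diff_inverse nat_le_linear not_le zero_less_diff)
  define R' where "R' = mat p p (\<lambda>(i, j). if j < a then R $$ (i, j) else 0)"
  define S' where "S' = mat p p (\<lambda>(i, j). if i < a then S $$ (i, j) else 0)"
  have c: "R' \<in> carrier_mat p p" "S' \<in> carrier_mat p p" unfolding R'_def S'_def by auto
  have "R' * S' = R * S"
  proof (rule eq_matI)
    fix i j assume "i < dim_row (R * S)" "j < dim_col (R * S)"
    then have ij: "i < p" "j < p" using R S by auto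
    have "(R' * S') $$ (i, j) = (\<Sum>l = 0..<p. R' $$ (i, l) * S' $$ (l, j))"
      using c ij by (simp add: scalar_prod_def)
    also have "\<dots> = (\<Sum>l = 0..<a. R' $$ (i, l) * S' $$ (l, j))"
      using ij p by (intro sum.mono_neutral_right) (auto simp: R'_def)
    also have "\<dots> = (\<Sum>l = 0..<a. R $$ (i, l) * S $$ (l, j))"
      using ij p by (intro sum.cong) (auto simp: R'_def S'_def)
    also have "\<dots> = (R * S) $$ (i, j)" using R S ij by (simp add: scalar_prod_def)
    finally show "(R' * S') $$ (i, j) = (R * S) $$ (i, j)" .
  qed (use c R S in auto)
  then have "S' * R' = 1\<^sub>m p" using mat_mult_left_right_inverse[OF c] RS by simp
  then have "(S' * R') $$ (a, a) = 1" using p k by simp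
  moreover have "(S' * R') $$ (a, a) = 0" using c p k by (simp add: scalar_prod_def S'_def)
  ultimately show False by simp
qed

text \<open>Used in both directions, \<open>conj_lower_left_zero\<close> makes \<open>R\<close> and
  \<open>S\<close> block upper triangular. Their diagonal blocks are then inverse to each other,
  which fixes the sizes, and the conjugation acts on each diagonal block separately.\<close>

lemma join_similarity_splits:
  fixes V W V' W' :: "'a::field mat set"
  assumes a: "0 < a" "0 < a'" and n: "n = a + m" "n = a' + m'"
    and V: "V \<subseteq> carrier_mat a a" "0\<^sub>m a a \<in> V" and W: "W \<subseteq> carrier_mat m m" "0\<^sub>m m m \<in> W"
    and V': "V' \<subseteq> carrier_mat a' a'" "0\<^sub>m a' a' \<in> V'" and W': "W' \<subseteq> carrier_mat m' m'" "0\<^sub>m m' m' \<in> W'"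
    and irr: "every_vector_cyclic a V"
    and irr': "every_vector_cyclic a' V'"
    and sim: "similar_subspaces n (mat_join V W) (mat_join V' W')"
  shows "a' = a \<and> m' = m \<and> similar_subspaces a V V' \<and> similar_subspaces m W W'"
proof -
  obtain R S where R: "mutual_inverse n R S" and eq: "mat_join V' W' = conj_mats R S (mat_join V W)"
    using sim unfolding similar_subspaces_iff by blast
  note D = mutual_inverseD[OF R]
  have VW: "mat_join V W \<subseteq> carrier_mat n n" using mat_join_carrier[OF V(1) W(1)] n by simp
  have eq': "mat_join V W = conj_mats S R (mat_join V' W')" unfolding eq conj_mats_inverse[OF R VW] ..
  obtain S1 S2 S4 where S: "S1 \<in> carrier_mat a a'" "S2 \<in> carrier_mat a m'" "S4 \<in> carrier_mat m m'"
    "S = four_block_mat S1 S2 (0\<^sub>m m a') S4"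
    using conj_lower_left_zero[OF a(1) n V(1) W(1) V' W' irr' R eq] by blast
  obtain R1 R2 R4 where Rb: "R1 \<in> carrier_mat a' a" "R2 \<in> carrier_mat a' m" "R4 \<in> carrier_mat m' m"
    "R = four_block_mat R1 R2 (0\<^sub>m m' a) R4"
    using conj_lower_left_zero[OF a(2) n(2,1) V'(1) W'(1) V W irr mutual_inverse_sym[OF R] eq'] by blast
  have one: "four_block_mat (1\<^sub>m k) (0\<^sub>m k l) (0\<^sub>m l k) (1\<^sub>m l) = (1\<^sub>m (k + l) :: 'a mat)" for k l by simp
  have e1: "four_block_mat (R1 * S1) (R1 * S2 + R2 * S4) (0\<^sub>m m' a') (R4 * S4)
      = four_block_mat (1\<^sub>m a') (0\<^sub>m a' m') (0\<^sub>m m' a') (1\<^sub>m m')"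
    unfolding one n(2)[symmetric] D(3)[symmetric] unfolding Rb(4) S(4)
    by (rule upper_block_mult[OF Rb(1-3) S(1-3), symmetric])
  have c1: "R1 * S1 \<in> carrier_mat a' a'" "R1 * S2 + R2 * S4 \<in> carrier_mat a' m'" "R4 * S4 \<in> carrier_mat m' m'"
    using Rb S by auto
  note RS = four_block_inj(1,4)[OF e1 c1(1,2) zero_carrier_mat c1(3)
      one_carrier_mat zero_carrier_mat zero_carrier_mat one_carrier_mat]
  have e2: "four_block_mat (S1 * R1) (S1 * R2 + S2 * R4) (0\<^sub>m m a) (S4 * R4)
      = four_block_mat (1\<^sub>m a) (0\<^sub>m a m) (0\<^sub>m m a) (1\<^sub>m m)"
    unfolding one n(1)[symmetric] D(4)[symmetric] unfolding Rb(4) S(4)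
    by (rule upper_block_mult[OF S(1-3) Rb(1-3), symmetric])
  have c2: "S1 * R1 \<in> carrier_mat a a" "S1 * R2 + S2 * R4 \<in> carrier_mat a m" "S4 * R4 \<in> carrier_mat m m"
    using Rb S by auto
  note SR = four_block_inj(1,4)[OF e2 c2(1,2) zero_carrier_mat c2(3)
      one_carrier_mat zero_carrier_mat zero_carrier_mat one_carrier_mat]
  have aa: "a' = a"
    using rectangular_inverse_le[OF Rb(1) S(1) RS(1)] rectangular_inverse_le[OF S(1) Rb(1) SR(1)] by simp
  then have mm: "m' = m" using n by simp
  have m1: "mutual_inverse a R1 S1" "mutual_inverse m R4 S4"
    unfolding mutual_inverse_def using Rb S RS SR aa mm by auto
  have blk: "\<exists>X\<in>carrier_mat a m. R * four_block_mat A B (0\<^sub>m m a) C * S = four_block_mat (R1 * A * S1) X (0\<^sub>m m a) (R4 * C * S4)"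
    if c: "A \<in> carrier_mat a a" "B \<in> carrier_mat a m" "C \<in> carrier_mat m m" for A B C
  proof -
    have r: "R1 \<in> carrier_mat a a" "R2 \<in> carrier_mat a m" "R4 \<in> carrier_mat m m"
      and s: "S1 \<in> carrier_mat a a" "S2 \<in> carrier_mat a m" "S4 \<in> carrier_mat m m"
      using Rb S aa mm by auto
    have 1: "R * four_block_mat A B (0\<^sub>m m a) C = four_block_mat (R1 * A) (R1 * B + R2 * C) (0\<^sub>m m a) (R4 * C)"
      unfolding Rb(4) aa mm by (rule upper_block_mult[OF r c])
    have c': "R1 * A \<in> carrier_mat a a" "R1 * B + R2 * C \<in> carrier_mat a m" "R4 * C \<in> carrier_mat m m"
      using r c by auto
    have "R * four_block_mat A B (0\<^sub>m m a) C * S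
      = four_block_mat (R1 * A * S1) (R1 * A * S2 + (R1 * B + R2 * C) * S4) (0\<^sub>m m a) (R4 * C * S4)"
      unfolding 1 S(4) aa mm by (rule upper_block_mult[OF c' s])
    moreover have "R1 * A * S2 + (R1 * B + R2 * C) * S4 \<in> carrier_mat a m" using c' s by auto
    ultimately show ?thesis by blast
  qed
  have fw: "R1 * A * S1 \<in> V' \<and> R4 * C * S4 \<in> W'" if A: "A \<in> V" and C: "C \<in> W" for A C
  proof -
    have c: "A \<in> carrier_mat a a" "C \<in> carrier_mat m m" using A C V W by auto
    obtain X where X: "X \<in> carrier_mat a m"
      "R * four_block_mat A (0\<^sub>m a m) (0\<^sub>m m a) C * S = four_block_mat (R1 * A * S1) X (0\<^sub>m m a) (R4 * C * S4)"
      using blk[OF c(1) zero_carrier_mat c(2)] by blast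
    have "R * four_block_mat A (0\<^sub>m a m) (0\<^sub>m m a) C * S \<in> mat_join V' W'"
      unfolding eq conj_mats_def using mat_joinI[OF V(1) W(1) A zero_carrier_mat C] by blast
    then obtain A' B' C' where Y: "four_block_mat (R1 * A * S1) X (0\<^sub>m m a) (R4 * C * S4) = four_block_mat A' B' (0\<^sub>m m' a') C'"
      "A' \<in> V'" "B' \<in> carrier_mat a' m'" "C' \<in> W'" "A' \<in> carrier_mat a' a'" "C' \<in> carrier_mat m' m'"
      unfolding X(2) by (rule mat_joinE[OF _ V'(1) W'(1)])
    have q: "R1 * A * S1 \<in> carrier_mat a a" "R4 * C * S4 \<in> carrier_mat m m"
      using c Rb S aa mm by auto
    have "R1 * A * S1 = A'" "R4 * C * S4 = C'"
      using four_block_inj(1,4)[OF Y(1)[unfolded aa mm] q(1) X(1) zero_carrier_mat q(2)] Y aa mm by auto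
    then show ?thesis using Y by simp
  qed
  have bw: "A' \<in> conj_mats R1 S1 V \<and> C' \<in> conj_mats R4 S4 W" if A': "A' \<in> V'" and C': "C' \<in> W'" for A' C'
  proof -
    have c: "A' \<in> carrier_mat a a" "C' \<in> carrier_mat m m" using A' C' V' W' aa mm by auto
    have "four_block_mat A' (0\<^sub>m a' m') (0\<^sub>m m' a') C' \<in> mat_join V' W'"
      by (rule mat_joinI[OF V'(1) W'(1) A' zero_carrier_mat C'])
    then obtain N where N: "N \<in> mat_join V W" "four_block_mat A' (0\<^sub>m a' m') (0\<^sub>m m' a') C' = R * N * S"
      unfolding eq conj_mats_def by blast
    obtain A B C where ABC: "N = four_block_mat A B (0\<^sub>m m a) C" "A \<in> V" "B \<in> carrier_mat a m" "C \<in> W"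
      "A \<in> carrier_mat a a" "C \<in> carrier_mat m m" by (rule mat_joinE[OF N(1) V(1) W(1)])
    obtain X where X: "X \<in> carrier_mat a m" "R * N * S = four_block_mat (R1 * A * S1) X (0\<^sub>m m a) (R4 * C * S4)"
      using blk[OF ABC(5,3,6)] ABC(1) by blast
    have q: "R1 * A * S1 \<in> carrier_mat a a" "R4 * C * S4 \<in> carrier_mat m m"
      using ABC Rb S aa mm by auto
    have "A' = R1 * A * S1" "C' = R4 * C * S4"
      using four_block_inj(1,4)[OF trans[OF N(2) X(2), unfolded aa mm] c(1) zero_carrier_mat zero_carrier_mat c(2)
          q(1) X(1) zero_carrier_mat q(2)] .
    then show ?thesis unfolding conj_mats_def using ABC by blast
  qed
  have "V' = conj_mats R1 S1 V"
  proof
    \<comment> \<open>The zero matrix serves as partner in the other diagonal block.\<close>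
    show "V' \<subseteq> conj_mats R1 S1 V" using bw[OF _ W'(2)] by blast
    show "conj_mats R1 S1 V \<subseteq> V'" unfolding conj_mats_def using fw[OF _ W(2)] by blast
  qed
  then have "similar_subspaces a V V'"
    unfolding similar_subspaces_iff using m1(1) V(1) V'(1) aa by metis
  moreover have "W' = conj_mats R4 S4 W"
  proof
    show "W' \<subseteq> conj_mats R4 S4 W" using bw[OF V'(2)] by blast
    show "conj_mats R4 S4 W \<subseteq> W'" unfolding conj_mats_def using fw[OF V(2)] by blast
  qed
  then have "similar_subspaces m W W'"
    unfolding similar_subspaces_iff using m1(2) W(1) W'(1) mm by metis
  ultimately show ?thesis using aa mm by simp
qed

lemma mult_alternate_cyclic: "non_isotropic n P \<Longrightarrow> every_vector_cyclic n (mult_alternate n P)"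
  unfolding every_vector_cyclic_def using mult_alternate_transitive by blast

lemma similar_subspaces_carrier:
  assumes "similar_subspaces n V W"
  shows "V \<subseteq> carrier_mat n n" "W \<subseteq> carrier_mat n n"
  using assms unfolding similar_subspaces_def by blast+

lemma alternate_join_size:
  assumes "non_isotropic_list ns (Ps :: 'a::field mat list)" "alternate_join ns Ps \<subseteq> carrier_mat n n"
  shows "sum_list ns = n"
  using carrier_matD(1)[OF subsetD[OF assms(2) non_isotropic_join_carrier(2)[OF assms(1)]]] by simp

text \<open>The similarity splits into one of the heads and one of the tails. For the heads it
  becomes an equality of the spaces given by \<open>P'\<close> and \<open>R * P * R\<^sup>T\<close>,
  where \<open>mult_alternate_scalar\<close> applies.\<close>

theorem alternate_join_unique:
  assumes "non_isotropic_list ns Ps" "non_isotropic_list ns' Ps'"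
    "similar_subspaces n (alternate_join ns Ps) (alternate_join ns' Ps')"
  shows "length ns' = length ns \<and> (\<forall>k < length ns. ns' ! k = ns ! k \<and>
    (\<exists>c. c \<noteq> 0 \<and> congruent_mats (ns ! k) (Ps' ! k) (c \<cdot>\<^sub>m (Ps ! k))))"
  using assms
proof (induction ns arbitrary: ns' Ps Ps' n)
  case Nil
  note J = similar_subspaces_carrier[OF Nil(3)]
  have "sum_list ns' = 0" using alternate_join_size[OF Nil(1) J(1)] alternate_join_size[OF Nil(2) J(2)] by simp
  then have "ns' = []" using Nil(2) unfolding non_isotropic_list_def by (cases ns') auto
  then show ?case by simp
  next
  case (Cons a ns)
  note J = similar_subspaces_carrier[OF Cons(4)]
  have n: "n = a + sum_list ns" "sum_list ns' = n" using alternate_join_size[OF Cons(2) J(1)] alternate_join_size[OF Cons(3) J(2)] by auto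
  obtain P Qs where P: "Ps = P # Qs" "0 < a" "non_isotropic a P" "non_isotropic_list ns Qs"
    using Cons(2) unfolding non_isotropic_list_Cons by blast
  have "ns' \<noteq> []" using n P(2) by auto
  then obtain a' ms where ns': "ns' = a' # ms" by (cases ns') auto
  obtain P' Qs' where P': "Ps' = P' # Qs'" "0 < a'" "non_isotropic a' P'" "non_isotropic_list ms Qs'"
    using Cons(3) unfolding ns' non_isotropic_list_Cons by blast
  note c = non_isotropicD(1)[OF P(3)] and c' = non_isotropicD(1)[OF P'(3)]
  note jc = non_isotropic_join_carrier[OF P(4)] and jc' = non_isotropic_join_carrier[OF P'(4)]
  have n': "n = a' + sum_list ms" using n ns' by simp
  have sim: "similar_subspaces n (mat_join (mult_alternate a P) (alternate_join ns Qs))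
      (mat_join (mult_alternate a' P') (alternate_join ms Qs'))"
    using Cons(4) unfolding P(1) P'(1) ns' alternate_join_Cons .
  have s: "a' = a \<and> sum_list ms = sum_list ns \<and> similar_subspaces a (mult_alternate a P) (mult_alternate a' P') \<and>
      similar_subspaces (sum_list ns) (alternate_join ns Qs) (alternate_join ms Qs')"
    by (rule join_similarity_splits[OF P(2) P'(2) n(1) n' mult_alternate_carrier[OF c] zero_mult_alternate[OF c]
        jc mult_alternate_carrier[OF c'] zero_mult_alternate[OF c'] jc'
        mult_alternate_cyclic[OF P(3)] mult_alternate_cyclic[OF P'(3)] sim])
  have IH: "length ms = length ns \<and> (\<forall>k < length ns. ms ! k = ns ! k \<and>
      (\<exists>c. c \<noteq> 0 \<and> congruent_mats (ns ! k) (Qs' ! k) (c \<cdot>\<^sub>m (Qs ! k))))"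
    using Cons.IH[OF P(4) P'(4)] s by blast
  obtain R S where R: "mutual_inverse a R S" "mult_alternate a P' = conj_mats R S (mult_alternate a P)"
    using s unfolding similar_subspaces_iff by blast
  note DR = mutual_inverseD[OF R(1)]
  have P'a: "P' \<in> carrier_mat a a" "non_isotropic a P'" using c' P'(3) s by auto
  let ?T = "R * P * R\<^sup>T"
  have eq: "mult_alternate a P' = mult_alternate a ?T" using R(2) conj_mult_alternate[OF R(1) c] by simp
  obtain X where X: "mutual_inverse a P' X" using non_isotropic_inverse[OF P'a(2)] by blast
  obtain Y where Y: "mutual_inverse a P Y" using non_isotropic_inverse[OF P(3)] by blast
  have "R\<^sup>T * S\<^sup>T = 1\<^sub>m a" using transpose_mult[OF DR(2,1)] unfolding DR(4) by simp
  moreover have "S\<^sup>T * R\<^sup>T = 1\<^sub>m a" using transpose_mult[OF DR(1,2)] unfolding DR(3) by simp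
  ultimately have RT: "mutual_inverse a (R\<^sup>T) (S\<^sup>T)" unfolding mutual_inverse_def using DR by simp
  have T: "mutual_inverse a ?T (S\<^sup>T * (Y * S))"
    using mutual_inverse_mult[OF RT mutual_inverse_mult[OF Y R(1)]] .
  obtain k where k: "k \<noteq> 0" "P' = k \<cdot>\<^sub>m ?T"
    using mult_alternate_scalar[OF X T P(2) eq_refl[OF eq]] by blast
  have "P' = R * (k \<cdot>\<^sub>m P) * R\<^sup>T"
    unfolding k(2) using c DR by (simp add: mult_smult_distrib[of _ a a _ a] mult_smult_assoc_mat[of _ a a _ a])
  then have "congruent_mats a P' (k \<cdot>\<^sub>m P)"
    unfolding congruent_mats_def using P'a(1) c R(1) GL_mat_iff[of R a] by auto
  then have head: "a' = a \<and> (\<exists>c. c \<noteq> 0 \<and> congruent_mats a P' (c \<cdot>\<^sub>m P))" using k(1) s by blast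
  show ?case unfolding ns' P(1) P'(1)
  proof (intro conjI allI impI)
    show "length (a' # ms) = length (a # ns)" using IH by simp
    fix k assume k: "k < length (a # ns)"
    show "(a' # ms) ! k = (a # ns) ! k"
      "\<exists>c. c \<noteq> 0 \<and> congruent_mats ((a # ns) ! k) ((P' # Qs') ! k) (c \<cdot>\<^sub>m ((P # Qs) ! k))"
      using IH head k by (cases k; simp)+
  qed
qed

section \<open>Matrices in a basis\<close>

context endo_space
begin

definition lcv :: "'b list \<Rightarrow> 'a vec \<Rightarrow> 'b" where
  "lcv bs x = (\<Sum>i<length bs. x $ i *s bs ! i)"

lemma lcv_add: "x \<in> carrier_vec (length bs) \<Longrightarrow> y \<in> carrier_vec (length bs) \<Longrightarrow> lcv bs (x + y) = lcv bs x + lcv bs y"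
  unfolding lcv_def sum.distrib[symmetric] by (rule sum.cong) (auto simp: scale_left_distrib)

lemma lcv_smult: "x \<in> carrier_vec (length bs) \<Longrightarrow> lcv bs (c \<cdot>\<^sub>v x) = c *s lcv bs x"
  unfolding lcv_def scale_sum_right by (rule sum.cong) auto

lemma lcv_zero: "lcv bs (0\<^sub>v (length bs)) = 0"
  unfolding lcv_def by simp

lemma lcv_diff:
  assumes "x \<in> carrier_vec (length bs)" "y \<in> carrier_vec (length bs)"
  shows "lcv bs (x - y) = lcv bs x - lcv bs y"
  unfolding lcv_def sum_subtractf[symmetric] using assms by (intro sum.cong) (auto simp: scale_left_diff_distrib)

lemma sum_lessThan_add: "(\<Sum>i<a + b. f i) = (\<Sum>i<a. f i) + (\<Sum>i<b. f (a + i))"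
  for f :: "nat \<Rightarrow> 'b"
  by (induction b) (auto simp: add.assoc)

lemma lcv_append:
  assumes "x \<in> carrier_vec (length bs)" "y \<in> carrier_vec (length cs)"
  shows "lcv (bs @ cs) (x @\<^sub>v y) = lcv bs x + lcv cs y"
proof -
  have "lcv (bs @ cs) (x @\<^sub>v y) = (\<Sum>i<length bs. (x @\<^sub>v y) $ i *s (bs @ cs) ! i)
      + (\<Sum>i<length cs. (x @\<^sub>v y) $ (length bs + i) *s (bs @ cs) ! (length bs + i))"
    unfolding lcv_def length_append
    by (rule sum_lessThan_add)
  then show ?thesis using assms by (simp add: lcv_def nth_append)
qed

text \<open>Phrased through the coordinate map, which makes coordinates available at once; a list
  fixes the order, on which block forms depend.\<close>

definition basis_list :: "'b set \<Rightarrow> 'b list \<Rightarrow> bool" where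
  "basis_list E bs \<longleftrightarrow> lcv bs ` carrier_vec (length bs) = E \<and>
    (\<forall>x\<in>carrier_vec (length bs). lcv bs x = 0 \<longrightarrow> x = 0\<^sub>v (length bs))"

lemma basis_list_inj:
  assumes "basis_list E bs" "x \<in> carrier_vec (length bs)" "y \<in> carrier_vec (length bs)" "lcv bs x = lcv bs y"
  shows "x = y"
proof -
  have "lcv bs (x - y) = 0" using lcv_diff[OF assms(2,3)] assms(4) by simp
  then have "x - y = 0\<^sub>v (length bs)" using assms unfolding basis_list_def by auto
  then have "x $ i = y $ i" if "i < length bs" for i
    using that assms(2,3) by (metis carrier_vecD eq_iff_diff_eq_0 index_minus_vec(1) index_zero_vec(1))
  then show ?thesis using assms(2,3) by (intro eq_vecI) auto
qed

lemma basis_list_in: "basis_list E bs \<Longrightarrow> x \<in> carrier_vec (length bs) \<Longrightarrow> lcv bs x \<in> E"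
  unfolding basis_list_def by blast

lemma basis_list_ex: "basis_list E bs \<Longrightarrow> v \<in> E \<Longrightarrow> \<exists>x\<in>carrier_vec (length bs). v = lcv bs x"
  unfolding basis_list_def by blast

lemma basis_list_exists:
  assumes "fd E"
  shows "\<exists>bs. basis_list E bs \<and> length bs = dim E"
proof -
  obtain B where B: "finite B" "independent B" "span B = E" "card B = dim E" by (rule fd_basis[OF assms])
  obtain bs where bs: "set bs = B" "distinct bs" using finite_distinct_list[OF B(1)] by blast
  have len: "length bs = card B" using bs distinct_card by fastforce
  have bij: "bij_betw ((!) bs) {..<length bs} B" using bij_betw_nth[OF bs(2) refl] bs(1) by simp
  have 1: "(\<Sum>i<length bs. f (bs ! i) *s bs ! i) = (\<Sum>b\<in>B. f b *s b)" for f
    by (rule sum.reindex_bij_betw[OF bij, of "\<lambda>b. f b *s b"])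
  define g where "g b = inv_into {..<length bs} ((!) bs) b" for b
  have g: "g (bs ! i) = i" if "i < length bs" for i
    unfolding g_def using inv_into_f_f[OF bij_betw_imp_inj_on[OF bij]] that by auto
  have lg: "lcv bs x = (\<Sum>b\<in>B. (x $ g b) *s b)" for x
    unfolding lcv_def 1[symmetric] by (rule sum.cong) (auto simp: g)
  have "lcv bs ` carrier_vec (length bs) = E"
  proof
    show "lcv bs ` carrier_vec (length bs) \<subseteq> E"
    proof
      fix v assume "v \<in> lcv bs ` carrier_vec (length bs)"
      then obtain x where "v = lcv bs x" by blast
      then have "v = (\<Sum>b\<in>B. (x $ g b) *s b)" using lg by simp
      also have "\<dots> \<in> span B" by (intro span_sum span_scale span_base)
      finally show "v \<in> E" using B(3) by simp
    qed
    show "E \<subseteq> lcv bs ` carrier_vec (length bs)"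
    proof
      fix v assume "v \<in> E"
      then obtain a where a: "v = (\<Sum>b\<in>B. a b *s b)" using span_finite[OF B(1)] B(3) by auto
      have "v = lcv bs (vec (length bs) (\<lambda>i. a (bs ! i)))" unfolding a 1[symmetric] lcv_def
        by (rule sum.cong) auto
      then show "v \<in> lcv bs ` carrier_vec (length bs)" by auto
    qed
  qed
  moreover have "x = 0\<^sub>v (length bs)" if x: "x \<in> carrier_vec (length bs)" "lcv bs x = 0" for x
  proof (rule eq_vecI)
    fix i assume "i < dim_vec (0\<^sub>v (length bs) :: 'a vec)"
    then have i: "i < length bs" by simp
    have "(\<Sum>b\<in>B. (x $ g b) *s b) = 0" using x(2) lg by simp
    then have "x $ g (bs ! i) = 0"
      using independentD[OF B(2,1) order_refl, of "\<lambda>b. x $ g b" "bs ! i"] i bs(1) nth_mem by blast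
    then show "x $ i = 0\<^sub>v (length bs) $ i" using g[OF i] i by simp
  qed (use x in auto)
  ultimately show ?thesis unfolding basis_list_def using len B(4) by (intro exI[of _ bs]) auto
qed

text \<open>A relation, so that no coordinate function has to be fixed; \<open>rep_exists\<close>,
  \<open>rep_surj\<close> and \<open>rep_unique\<close> supply the matrix of an operator, an
  operator for a matrix, and uniqueness of the matrix.\<close>

definition rep :: "'b list \<Rightarrow> ('b \<Rightarrow> 'b) \<Rightarrow> 'a mat \<Rightarrow> bool" where
  "rep bs M A \<longleftrightarrow> A \<in> carrier_mat (length bs) (length bs) \<and>
    (\<forall>x\<in>carrier_vec (length bs). M (lcv bs x) = lcv bs (A *\<^sub>v x))"

lemma lcv_mult_mat:
  assumes A: "A \<in> carrier_mat (length bs) m" and x: "x \<in> carrier_vec m"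
  shows "lcv bs (A *\<^sub>v x) = (\<Sum>j<m. x $ j *s lcv bs (col A j))"
proof -
  have "lcv bs (A *\<^sub>v x) = (\<Sum>i<length bs. \<Sum>j<m. (A $$ (i, j) * x $ j) *s bs ! i)"
    unfolding lcv_def using A x
    by (intro sum.cong) (auto simp: scalar_prod_def scale_sum_left lessThan_atLeast0 intro!: sum.cong)
  also have "\<dots> = (\<Sum>j<m. \<Sum>i<length bs. (A $$ (i, j) * x $ j) *s bs ! i)" by (rule sum.swap)
  also have "\<dots> = (\<Sum>j<m. x $ j *s lcv bs (col A j))"
    unfolding lcv_def scale_sum_right using A by (intro sum.cong) (auto simp: mult.commute)
  finally show ?thesis .
qed

lemma lcv_unit: "j < length bs \<Longrightarrow> lcv bs (unit_vec (length bs) j) = bs ! j"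
proof -
  assume j: "j < length bs"
  have "lcv bs (unit_vec (length bs) j) = (\<Sum>i<length bs. if i = j then bs ! j else 0)"
    unfolding lcv_def by (rule sum.cong) (use j in auto)
  then show ?thesis using j by simp
qed

lemma rep_exists:
  assumes b: "basis_list E bs" and sE: "subspace E" and M: "M \<in> End E"
  shows "\<exists>A. rep bs M A"
proof -
  let ?n = "length bs"
  have bE: "bs ! j \<in> E" if "j < ?n" for j using basis_list_in[OF b, of "unit_vec ?n j"] lcv_unit[OF that] by simp
  have "\<exists>y\<in>carrier_vec ?n. M (bs ! j) = lcv bs y" if "j < ?n" for j
    using basis_list_ex[OF b End_in[OF M bE[OF that]]] .
  then obtain y where y: "\<And>j. j < ?n \<Longrightarrow> y j \<in> carrier_vec ?n \<and> M (bs ! j) = lcv bs (y j)" by metis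
  define A where "A = mat ?n ?n (\<lambda>(i, j). y j $ i)"
  have A: "A \<in> carrier_mat ?n ?n" unfolding A_def by simp
  have col: "col A j = y j" if "j < ?n" for j using y[OF that] that unfolding A_def by (intro eq_vecI) auto
  have "M (lcv bs x) = lcv bs (A *\<^sub>v x)" if x: "x \<in> carrier_vec ?n" for x
  proof -
    have "M (lcv bs x) = (\<Sum>j<?n. x $ j *s M (bs ! j))"
      unfolding lcv_def by (rule lin_sum[OF End_lin[OF M] sE]) (use bE in auto)
    also have "\<dots> = (\<Sum>j<?n. x $ j *s lcv bs (col A j))" by (rule sum.cong) (use y col in auto)
    also have "\<dots> = lcv bs (A *\<^sub>v x)" by (rule lcv_mult_mat[OF A x, symmetric])
    finally show ?thesis .
  qed
  then show ?thesis unfolding rep_def using A by blast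
qed

lemma rep_surj:
  assumes b: "basis_list E bs" and A: "A \<in> carrier_mat (length bs) (length bs)"
  shows "\<exists>M\<in>End E. rep bs M A"
proof -
  let ?n = "length bs"
  define crd where "crd v = (SOME x. x \<in> carrier_vec ?n \<and> v = lcv bs x)" for v
  have crd: "crd v \<in> carrier_vec ?n \<and> v = lcv bs (crd v)" if "v \<in> E" for v
    unfolding crd_def using basis_list_ex[OF b that] by (intro someI_ex[of "\<lambda>x. x \<in> carrier_vec ?n \<and> v = lcv bs x"]) blast
  have crdl: "crd (lcv bs x) = x" if "x \<in> carrier_vec ?n" for x
    using basis_list_inj[OF b, of "crd (lcv bs x)" x] crd[OF basis_list_in[OF b that]] that by auto
  define M where "M v = (if v \<in> E then lcv bs (A *\<^sub>v crd v) else 0)" for v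
  have Ml: "M (lcv bs x) = lcv bs (A *\<^sub>v x)" if "x \<in> carrier_vec ?n" for x
    using basis_list_in[OF b that] crdl[OF that] by (simp add: M_def)
  have "M \<in> End E"
    unfolding End_def mem_Collect_eq lin_on_def
  proof (intro conjI ballI allI impI)
    fix u v assume "u \<in> E" "v \<in> E"
    then obtain x y where x: "x \<in> carrier_vec ?n" "u = lcv bs x" and y: "y \<in> carrier_vec ?n" "v = lcv bs y"
      using basis_list_ex[OF b] by blast
    have "M (u + v) = lcv bs (A *\<^sub>v (x + y))" unfolding x y using lcv_add[OF x(1) y(1)] Ml[of "x + y"] x y by simp
    also have "\<dots> = lcv bs (A *\<^sub>v x) + lcv bs (A *\<^sub>v y)"
      using x y A by (simp add: mult_add_distrib_mat_vec lcv_add)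
    finally show "M (u + v) = M u + M v" unfolding x(2) y(2) using Ml x y by simp
  next
    fix c u assume "u \<in> E"
    then obtain x where x: "x \<in> carrier_vec ?n" "u = lcv bs x" using basis_list_ex[OF b] by blast
    have "M (c *s u) = lcv bs (A *\<^sub>v (c \<cdot>\<^sub>v x))" unfolding x using lcv_smult[OF x(1)] Ml[of "c \<cdot>\<^sub>v x"] x by simp
    also have "\<dots> = c *s lcv bs (A *\<^sub>v x)" using x A by (simp add: mult_mat_vec lcv_smult)
    finally show "M (c *s u) = c *s M u" unfolding x(2) using Ml x by simp
  next
    show "M ` E \<subseteq> E" using crd basis_list_in[OF b] A by (auto simp: M_def)
    fix v assume "v \<notin> E" then show "M v = 0" by (simp add: M_def)
  qed
  then show ?thesis unfolding rep_def using Ml A by blast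
qed

lemma rep_add:
  assumes "rep bs M A" "rep bs N B"
  shows "rep bs (\<lambda>v. M v + N v) (A + B)"
  using assms unfolding rep_def by (auto simp: add_mult_distrib_mat_vec lcv_add)

lemma basis_list_append:
  assumes d: "dsum E F G" and F: "basis_list F bs" and G: "basis_list G cs"
  shows "basis_list E (bs @ cs)"
proof -
  have sub: "subspace E" "subspace F" "subspace G" "F \<subseteq> E" "G \<subseteq> E" "F \<inter> G \<subseteq> {0}"
    using d unfolding dsum_def by auto
  show ?thesis unfolding basis_list_def length_append
  proof (intro conjI ballI impI)
    show "lcv (bs @ cs) ` carrier_vec (length bs + length cs) = E"
    proof
      show "lcv (bs @ cs) ` carrier_vec (length bs + length cs) \<subseteq> E"
      proof
        fix v assume "v \<in> lcv (bs @ cs) ` carrier_vec (length bs + length cs)"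
        then obtain z where z: "z \<in> carrier_vec (length bs + length cs)" "v = lcv (bs @ cs) z" by blast
        have "v = lcv bs (vec_first z (length bs)) + lcv cs (vec_last z (length cs))"
          unfolding z(2) by (subst vec_first_last_append[OF z(1), symmetric]) (simp add: lcv_append)
        then show "v \<in> E" using basis_list_in[OF F] basis_list_in[OF G] sub
          by (metis subsetD subspace_add vec_first_carrier vec_last_carrier)
      qed
      show "E \<subseteq> lcv (bs @ cs) ` carrier_vec (length bs + length cs)"
      proof
        fix v assume v: "v \<in> E"
        note p = prj_props[OF d v]
        obtain x where x: "x \<in> carrier_vec (length bs)" "v - prj F G v = lcv bs x" using basis_list_ex[OF F p(2)] by blast
        obtain y where y: "y \<in> carrier_vec (length cs)" "prj F G v = lcv cs y" using basis_list_ex[OF G p(1)] by blast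
        have "v = lcv (bs @ cs) (x @\<^sub>v y)" using lcv_append[OF x(1) y(1)] x y by (metis diff_add_cancel)
        then show "v \<in> lcv (bs @ cs) ` carrier_vec (length bs + length cs)" using x y by auto
      qed
    qed
    fix z assume z: "z \<in> carrier_vec (length bs + length cs)" "lcv (bs @ cs) z = 0"
    define x where "x = vec_first z (length bs)"
    define y where "y = vec_last z (length cs)"
    have c: "x \<in> carrier_vec (length bs)" "y \<in> carrier_vec (length cs)" unfolding x_def y_def by auto
    have zxy: "z = x @\<^sub>v y" unfolding x_def y_def using vec_first_last_append[OF z(1)] by simp
    have s: "lcv bs x + lcv cs y = 0" using z(2) lcv_append[OF c] zxy by simp
    then have "lcv bs x = - lcv cs y" by (simp add: eq_neg_iff_add_eq_0)
    then have "lcv bs x \<in> F \<inter> G" using basis_list_in[OF F c(1)] basis_list_in[OF G c(2)] subspace_neg[OF sub(3)] by auto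
    then have "lcv bs x = 0" "lcv cs y = 0" using sub(6) s by auto
    then have "x = 0\<^sub>v (length bs)" "y = 0\<^sub>v (length cs)" using F G c unfolding basis_list_def by auto
    then show "z = 0\<^sub>v (length bs + length cs)" unfolding zxy by auto
  qed
qed


section \<open>From the invariant form to the block form\<close>

lemma pair_bf: "lin_pair scale ((*) :: 'a \<Rightarrow> 'a \<Rightarrow> 'a)"
  by unfold_locales (auto simp: algebra_simps)

lemma rep_unique:
  assumes b: "basis_list E bs" and A: "rep bs M A" and B: "rep bs M B"
  shows "A = B"
proof -
  have c: "A \<in> carrier_mat (length bs) (length bs)" "B \<in> carrier_mat (length bs) (length bs)"
    using A B unfolding rep_def by auto
  show ?thesis
  proof (rule mat_eq_if_mult_vec_eq[OF c])
    fix x :: "'a vec" assume x: "x \<in> carrier_vec (length bs)"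
    then have "lcv bs (A *\<^sub>v x) = lcv bs (B *\<^sub>v x)" using A B unfolding rep_def by metis
    then show "A *\<^sub>v x = B *\<^sub>v x" by (rule basis_list_inj[OF b, rotated 2]) (use c x in auto)
  qed
qed

text \<open>The matrix is the Gram matrix of \<open>b\<close> on \<open>cs\<close>.\<close>

lemma bil_lcv:
  assumes b: "bil E b" and sE: "subspace E" and cs: "\<And>i. i < length cs \<Longrightarrow> cs ! i \<in> E"
    and x: "x \<in> carrier_vec (length cs)" and y: "y \<in> carrier_vec (length cs)"
  shows "b (lcv cs x) (lcv cs y) = x \<bullet> (mat (length cs) (length cs) (\<lambda>(i, j). b (cs ! i) (cs ! j)) *\<^sub>v y)"
proof -
  let ?r = "length cs"
  have lE: "lcv cs z \<in> E" for z unfolding lcv_def using cs by (intro subspace_sum subspace_scale sE) auto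
  have r: "b u (lcv cs y) = (\<Sum>j<?r. y $ j * b u (cs ! j))" if "u \<in> E" for u
    unfolding lcv_def using b that cs unfolding bil_def
    by (intro lin_pair.lin_on_sum[OF pair_bf _ sE]) auto
  have "b (lcv cs x) (lcv cs y) = (\<Sum>i<?r. x $ i * b (cs ! i) (lcv cs y))"
    using lin_pair.lin_on_sum[OF pair_bf, of E "\<lambda>z. b z (lcv cs y)" "{..<?r}" "(!) cs" "\<lambda>i. x $ i"]
      b lE sE cs unfolding bil_def lcv_def[of cs x] by auto
  also have "\<dots> = (\<Sum>i<?r. x $ i * (\<Sum>j<?r. y $ j * b (cs ! i) (cs ! j)))"
    by (rule sum.cong) (use r cs in auto)
  also have "\<dots> = x \<bullet> (mat ?r ?r (\<lambda>(i, j). b (cs ! i) (cs ! j)) *\<^sub>v y)"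
    using x y by (auto simp: scalar_prod_def lessThan_atLeast0 mult.commute intro!: sum.cong)
  finally show ?thesis .
qed

text \<open>\<open>C = P * A\<close> means that \<open>Q * C\<close> is the alternate matrix
  \<open>A\<close>. With \<open>Q\<close> as Gram matrix this is the condition
  \<open>b y (M y) = 0\<close> in coordinates.\<close>

lemma mult_alternate_iff:
  assumes P: "mutual_inverse r P Q" and C: "C \<in> carrier_mat r r"
  shows "C \<in> mult_alternate r P \<longleftrightarrow> (\<forall>x\<in>carrier_vec r. x \<bullet> (Q *\<^sub>v (C *\<^sub>v x)) = 0)"
proof -
  note D = mutual_inverseD[OF P]
  have QC: "(Q * C) *\<^sub>v x = Q *\<^sub>v (C *\<^sub>v x)" if "x \<in> carrier_vec r" for x
    using square_mult(3)[OF D(2) C that] .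
  show ?thesis
  proof
    assume "C \<in> mult_alternate r P"
    then obtain A where A: "A \<in> alternate_mats r" "C = P * A" unfolding mult_alternate_def by blast
    note Ac = alternate_matsD(1)[OF A(1)]
    have "Q * C = A" unfolding A(2) using square_mult(2)[OF D(2,1) Ac] D(4) left_mult_one_mat[OF Ac] by simp
    then show "\<forall>x\<in>carrier_vec r. x \<bullet> (Q *\<^sub>v (C *\<^sub>v x)) = 0"
      using QC alternate_matsD(2)[OF A(1)] by metis
  next
    assume "\<forall>x\<in>carrier_vec r. x \<bullet> (Q *\<^sub>v (C *\<^sub>v x)) = 0"
    then have "Q * C \<in> alternate_mats r" unfolding alternate_mats_def using square_mult(1)[OF D(2) C] QC by auto
    moreover have "P * (Q * C) = C" using square_mult(2)[OF D(1,2) C] D(3) left_mult_one_mat[OF C] by simp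
    ultimately show "C \<in> mult_alternate r P" unfolding mult_alternate_def by (metis (mono_tags, lifting) mem_Collect_eq)
  qed
qed

text \<open>In a basis of \<open>F\<close> followed by one of a complement, invariance of
  \<open>F\<close> gives the zero block, the induction hypothesis the first blocks, and the form the
  last one. Conversely, every corner and every admissible last block occur, by
  \<open>flagform_saturated\<close>.\<close>

theorem alternate_form_exists:
  assumes c0: "c0 \<noteq> (0::'a)" "c0 \<noteq> 1" and "maxt E V"
  shows "\<exists>bs ns Ps. basis_list E bs \<and> length bs = sum_list ns \<and> non_isotropic_list ns Ps \<and>
    {A. \<exists>M\<in>V. rep bs M A} = alternate_join ns Ps"
  using assms(3)
proof (induction "dim E" arbitrary: E V rule: less_induct)
  case less
  note M = maxtD[OF less(2)]
  note VD = trivD[OF M(2)]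
  have sE: "subspace E" using fd_subspace[OF M(1)] .
  show ?case
  proof (cases "E = {0}")
    case True
    have "basis_list E []" unfolding basis_list_def lcv_def True by (auto intro!: image_eqI[of _ _ "0\<^sub>v 0"])
    moreover have "{A. \<exists>M\<in>V. rep [] M A} = alternate_join [] []"
    proof -
      have "M 0 = 0" if "M \<in> V" for M using lin_zero[OF End_lin[OF VD(2)[OF that]] sE] .
      then show ?thesis using op.subspace_0[OF VD(1)] unfolding alternate_join_Nil rep_def lcv_def by auto
    qed
    moreover have "non_isotropic_list [] []" unfolding non_isotropic_list_def by simp
    ultimately show ?thesis by (intro exI[of _ "[]"]) auto
  next
    case False
    obtain F b where FF: "flagform E V F b" using flagform_exists[OF c0 less(2) False] by blast
    note FD = flagformD[OF FF]
    obtain G where d: "dsum E F G" using complement_exists[OF M(1) FD(1,2)] by blast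
    have sub: "subspace F" "subspace G" "F \<subseteq> E" "G \<subseteq> E" "F \<inter> G \<subseteq> {0}" using d unfolding dsum_def by auto
    have fF: "fd F" and fG: "fd G" using fd_subset[OF M(1)] sub by auto
    have dF: "dim F < dim E"
      using dim_mono_fd[OF M(1) sub(1,3)] dim_eq_fd[OF M(1) sub(1,3)] FD(3) by (meson not_le le_less)
    have inv: "\<forall>M\<in>V. \<forall>v\<in>F. M v \<in> F" using FD(4) by blast
    obtain bs ns Ps where bs: "basis_list F bs" "length bs = sum_list ns" "non_isotropic_list ns Ps"
      "{A. \<exists>M\<in>restr F ` V. rep bs M A} = alternate_join ns Ps"
      using less(1)[OF dF maxt_invariant(1)[OF less(2) d inv]] by blast
    obtain cs where cs: "basis_list G cs" "length cs = dim G" using basis_list_exists[OF fG] by blast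
    define k where "k = length bs"
    define r where "r = length cs"
    have r0: "0 < r" using dF dim_dsum[OF M(1) d] cs(2) r_def by simp
    \<comment> \<open>The Gram matrix of \<open>b\<close> on the complement; the last block matrix
      \<open>P\<close> is its inverse.\<close>
    define Q where "Q = mat r r (\<lambda>(i, j). b (cs ! i) (cs ! j))"
    have Qc: "Q \<in> carrier_mat r r" unfolding Q_def by simp
    have csE: "cs ! i \<in> E" if "i < length cs" for i
      using basis_list_in[OF cs(1), of "unit_vec (length cs) i"] lcv_unit[OF that] sub by auto
    have bQ: "b (lcv cs x) (lcv cs y) = x \<bullet> (Q *\<^sub>v y)" if "x \<in> carrier_vec r" "y \<in> carrier_vec r" for x y
      unfolding Q_def r_def using bil_lcv[OF FD(5) sE csE] that unfolding r_def by blast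
    have lF: "lcv bs x \<in> F" "lcv bs x \<in> E" if "x \<in> carrier_vec k" for x
      using basis_list_in[OF bs(1)] that sub unfolding k_def by auto
    have lG: "lcv cs x \<in> G" "lcv cs x \<in> E" if "x \<in> carrier_vec r" for x
      using basis_list_in[OF cs(1)] that sub unfolding r_def by auto
    have niQ: "non_isotropic r Q"
      unfolding non_isotropic_def
    proof (intro conjI ballI impI Qc)
      fix x :: "'a vec" assume x: "x \<in> carrier_vec r" "x \<noteq> 0\<^sub>v r"
      have "lcv cs x \<noteq> 0" using cs(1) x unfolding basis_list_def r_def by blast
      then have "lcv cs x \<notin> F" using lG(1)[OF x(1)] sub(5) by blast
      then show "x \<bullet> (Q *\<^sub>v x) \<noteq> 0" using FD(8)[OF lG(2)[OF x(1)]] bQ[OF x(1,1)] by simp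
    qed
    obtain P where P: "mutual_inverse r P Q" using non_isotropic_inverse[OF niQ] mutual_inverse_sym by blast
    have niP: "non_isotropic r P" using inverse_non_isotropic[OF niQ P] .
    note Pc = non_isotropicD(1)[OF niP]
    have bl: "basis_list E (bs @ cs)" by (rule basis_list_append[OF d bs(1) cs(1)])
    have len: "length (bs @ cs) = k + r" by (simp add: k_def r_def)
    have la: "lcv (bs @ cs) (x @\<^sub>v y) = lcv bs x + lcv cs y" if "x \<in> carrier_vec k" "y \<in> carrier_vec r" for x y
      using lcv_append that unfolding k_def r_def by blast
    have l0: "lcv bs (0\<^sub>v k) = 0" "lcv cs (0\<^sub>v r) = 0" unfolding k_def r_def by (simp_all add: lcv_zero)
    have repv: "N (lcv bs x + lcv cs y) = lcv bs (A1 *\<^sub>v x + A2 *\<^sub>v y) + lcv cs (A3 *\<^sub>v x + A4 *\<^sub>v y)"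
      if N: "rep (bs @ cs) N (four_block_mat A1 A2 A3 A4)" and c: "A1 \<in> carrier_mat k k" "A2 \<in> carrier_mat k r"
        "A3 \<in> carrier_mat r k" "A4 \<in> carrier_mat r r" and x: "x \<in> carrier_vec k" and y: "y \<in> carrier_vec r"
      for N A1 A2 A3 A4 x y
    proof -
      have "N (lcv (bs @ cs) (x @\<^sub>v y)) = lcv (bs @ cs) (four_block_mat A1 A2 A3 A4 *\<^sub>v (x @\<^sub>v y))"
        using N x y len unfolding rep_def by auto
      then show ?thesis unfolding four_block_mat_mult_vec[OF c x y] la[OF x y] using la c x y by simp
    qed
    have dec: "\<exists>A1 B C. A = four_block_mat A1 B (0\<^sub>m r k) C \<and> A1 \<in> carrier_mat k k \<and> B \<in> carrier_mat k r \<and>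
        C \<in> mult_alternate r P \<and> rep bs (restr F N) A1"
      if N: "N \<in> V" and A: "rep (bs @ cs) N A" for N A
    proof -
      have "A \<in> carrier_mat (k + r) (k + r)" using A len unfolding rep_def by simp
      then obtain A1 A2 A3 A4 where c: "A1 \<in> carrier_mat k k" "A2 \<in> carrier_mat k r"
        "A3 \<in> carrier_mat r k" "A4 \<in> carrier_mat r r" "A = four_block_mat A1 A2 A3 A4" by (rule split_blocks)
      note rv = repv[OF A[unfolded c(5)] c(1-4)]
      have Nx: "N (lcv bs x) = lcv bs (A1 *\<^sub>v x) + lcv cs (A3 *\<^sub>v x)" if x: "x \<in> carrier_vec k" for x
        using rv[OF x zero_carrier_vec] l0 c x by (simp add: mult_vec_zero(1)[where n = k and m = k] mult_vec_zero(1)[where n = k and m = r] mult_vec_zero(1)[where n = r and m = r] mult_vec_zero(1)[where n = r and m = k])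
      have A3x: "A3 *\<^sub>v x = 0\<^sub>v r" if x: "x \<in> carrier_vec k" for x
      proof -
        have xc: "A1 *\<^sub>v x \<in> carrier_vec k" "A3 *\<^sub>v x \<in> carrier_vec r" using c x by auto
        have "N (lcv bs x) - lcv bs (A1 *\<^sub>v x) \<in> F"
          using FD(4)[OF N lF(1)[OF x]] lF(1)[OF xc(1)] subspace_diff[OF sub(1)] by blast
        then have "lcv cs (A3 *\<^sub>v x) \<in> F \<inter> G" using Nx[OF x] lG(1)[OF xc(2)] by simp
        then have "lcv cs (A3 *\<^sub>v x) = 0" using sub(5) by blast
        then show ?thesis using cs(1) xc(2) unfolding basis_list_def r_def by blast
      qed
      have A3: "A3 = 0\<^sub>m r k" by (rule zero_mat_if_mult_vec_zero[OF c(3) A3x])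
      have "rep bs (restr F N) A1" unfolding rep_def k_def[symmetric]
      proof (intro conjI ballI c(1))
        fix x :: "'a vec" assume x: "x \<in> carrier_vec k"
        show "restr F N (lcv bs x) = lcv bs (A1 *\<^sub>v x)"
          using Nx[OF x] A3x[OF x] l0 lF(1)[OF x] by (simp add: restr_def)
      qed
      moreover have "x \<bullet> (Q *\<^sub>v (A4 *\<^sub>v x)) = 0" if x: "x \<in> carrier_vec r" for x
      proof -
        have c': "A2 *\<^sub>v x \<in> carrier_vec k" "A4 *\<^sub>v x \<in> carrier_vec r" using c x by auto
        have "N (lcv cs x) = lcv bs (A2 *\<^sub>v x) + lcv cs (A4 *\<^sub>v x)"
          using rv[OF zero_carrier_vec x] l0 c c' by (simp add: mult_vec_zero(1)[where n = k and m = k] mult_vec_zero(1)[where n = k and m = r] mult_vec_zero(1)[where n = r and m = r] mult_vec_zero(1)[where n = r and m = k])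
        then have "b (lcv cs x) (N (lcv cs x)) = b (lcv cs x) (lcv bs (A2 *\<^sub>v x)) + b (lcv cs x) (lcv cs (A4 *\<^sub>v x))"
          using bilD(1)[OF FD(5) lF(2)[OF c'(1)] lG(2)[OF c'(2)] lG(2)[OF x]] by simp
        then show ?thesis using FD(9)[OF N lG(2)[OF x]] FD(7)[OF lF(1)[OF c'(1)] lG(2)[OF x]] bQ[OF x c'(2)] by simp
      qed
      then have "A4 \<in> mult_alternate r P" using mult_alternate_iff[OF P c(4)] by blast
      ultimately show ?thesis using c A3 by blast
    qed
    note jc = non_isotropic_join_carrier(1)[OF bs(3), folded bs(2), folded k_def]
    note mc = mult_alternate_carrier[OF Pc]
    have "{A. \<exists>M\<in>V. rep (bs @ cs) M A} = mat_join (alternate_join ns Ps) (mult_alternate r P)"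
    proof
      show "{A. \<exists>M\<in>V. rep (bs @ cs) M A} \<subseteq> mat_join (alternate_join ns Ps) (mult_alternate r P)"
      proof
        fix A assume "A \<in> {A. \<exists>M\<in>V. rep (bs @ cs) M A}"
        then obtain N where N: "N \<in> V" "rep (bs @ cs) N A" by blast
        obtain A1 B C where A: "A = four_block_mat A1 B (0\<^sub>m r k) C" "A1 \<in> carrier_mat k k" "B \<in> carrier_mat k r"
          "C \<in> mult_alternate r P" "rep bs (restr F N) A1" using dec[OF N] by blast
        have "A1 \<in> alternate_join ns Ps" unfolding bs(4)[symmetric] using N(1) A(5) by blast
        then show "A \<in> mat_join (alternate_join ns Ps) (mult_alternate r P)"
          unfolding A(1) by (rule mat_joinI[OF jc mc _ A(3,4)])
      qed
      show "mat_join (alternate_join ns Ps) (mult_alternate r P) \<subseteq> {A. \<exists>M\<in>V. rep (bs @ cs) M A}"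
      proof
        fix X assume "X \<in> mat_join (alternate_join ns Ps) (mult_alternate r P)"
        then obtain A1 B C where X: "X = four_block_mat A1 B (0\<^sub>m r k) C" "A1 \<in> alternate_join ns Ps"
          "B \<in> carrier_mat k r" "C \<in> mult_alternate r P" "A1 \<in> carrier_mat k k" "C \<in> carrier_mat r r"
          by (rule mat_joinE[OF _ jc mc])
        obtain N where N: "N \<in> V" "rep bs (restr F N) A1" using X(2) unfolding bs(4)[symmetric] by blast
        obtain A0 where A0: "rep (bs @ cs) N A0" using rep_exists[OF bl sE VD(2)[OF N(1)]] by blast
        obtain A1' B0 C0 where A0': "A0 = four_block_mat A1' B0 (0\<^sub>m r k) C0" "A1' \<in> carrier_mat k k" "B0 \<in> carrier_mat k r"
          "C0 \<in> mult_alternate r P" "rep bs (restr F N) A1'" using dec[OF N(1) A0] by blast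
        have A1': "A1' = A1" by (rule rep_unique[OF bs(1) A0'(5) N(2)])
        have C0: "C0 \<in> carrier_mat r r" using A0'(4) mc by blast
        \<comment> \<open>\<open>N\<close> has the right restriction to \<open>F\<close> but
          possibly wrong blocks \<open>B0\<close> and \<open>C0\<close>. The correction vanishes on
          \<open>F\<close>, and its last block \<open>C - C0\<close> is alternating for
          \<open>Q\<close>, so the operator \<open>T\<close> with this matrix belongs to
          \<open>V\<close>.\<close>
        define D where "D = four_block_mat (0\<^sub>m k k) (B - B0) (0\<^sub>m r k) (C - C0)"
        have BB: "B - B0 \<in> carrier_mat k r" "C - C0 \<in> carrier_mat r r" using X A0' C0 by auto
        have "D \<in> carrier_mat (length (bs @ cs)) (length (bs @ cs))" unfolding D_def len using BB by simp
        then obtain T where T: "T \<in> End E" "rep (bs @ cs) T D" using rep_surj[OF bl] by blast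
        note tv = repv[OF T(2)[unfolded D_def] zero_carrier_mat BB(1) zero_carrier_mat BB(2)]
        have TF: "T f = 0" if f: "f \<in> F" for f
        proof -
          obtain x where x: "x \<in> carrier_vec k" "f = lcv bs x" using basis_list_ex[OF bs(1) f] unfolding k_def by blast
          show ?thesis using tv[OF x(1) zero_carrier_vec] l0 x BB
            by (simp add: mult_vec_zero(1)[where n = k and m = k] mult_vec_zero(1)[where n = k and m = r] mult_vec_zero(1)[where n = r and m = r] mult_vec_zero(1)[where n = r and m = k] mult_vec_zero(2)[where n = k and m = k] mult_vec_zero(2)[where n = r and m = k])
        qed
        have "T \<in> V"
        proof (rule flagform_saturated[OF less(2) FF T(1) TF])
          fix w assume w: "w \<in> E"
          note p = prj_props[OF d w]
          let ?g = "prj F G w"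
          let ?f = "w - ?g"
          have gE: "?g \<in> E" "?f \<in> E" using p sub by auto
          obtain x where x: "x \<in> carrier_vec r" "?g = lcv cs x" using basis_list_ex[OF cs(1) p(1)] unfolding r_def by blast
          have c': "(B - B0) *\<^sub>v x \<in> carrier_vec k" "(C - C0) *\<^sub>v x \<in> carrier_vec r" using BB x by auto
          have "T w = T ?f + T ?g" using lin_add[OF End_lin[OF T(1)] gE(2,1)] by simp
          then have Tw: "T w = T ?g" using TF[OF p(2)] by simp
          have Tg: "T ?g = lcv bs ((B - B0) *\<^sub>v x) + lcv cs ((C - C0) *\<^sub>v x)"
            using tv[OF zero_carrier_vec x(1)] l0 x(2) c'
            by (simp add: mult_vec_zero(2)[where n = k and m = k] mult_vec_zero(2)[where n = r and m = k])
          have TE: "T ?g \<in> E" by (rule End_in[OF T(1) gE(1)])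
          have "b w (T w) = b ?f (T ?g) + b ?g (T ?g)" unfolding Tw using bilD(2)[OF FD(5) gE(2,1) TE] by simp
          also have "b ?f (T ?g) = 0" by (rule FD(6)[OF p(2) TE])
          also have "b ?g (T ?g) = b ?g (lcv bs ((B - B0) *\<^sub>v x)) + b ?g (lcv cs ((C - C0) *\<^sub>v x))"
            unfolding Tg by (rule bilD(1)[OF FD(5) lF(2)[OF c'(1)] lG(2)[OF c'(2)] gE(1)])
          also have "b ?g (lcv bs ((B - B0) *\<^sub>v x)) = 0" by (rule FD(7)[OF lF(1)[OF c'(1)] gE(1)])
          also have "b ?g (lcv cs ((C - C0) *\<^sub>v x)) = x \<bullet> (Q *\<^sub>v ((C - C0) *\<^sub>v x))" unfolding x(2) by (rule bQ[OF x(1) c'(2)])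
          also have "Q *\<^sub>v ((C - C0) *\<^sub>v x) = Q *\<^sub>v (C *\<^sub>v x) - Q *\<^sub>v (C0 *\<^sub>v x)"
            using minus_mult_distrib_mat_vec[OF X(6) C0 x(1)] mult_minus_distrib_mat_vec[OF Qc, of "C *\<^sub>v x" "C0 *\<^sub>v x"] X(6) C0 x(1) by simp
          also have "x \<bullet> (Q *\<^sub>v (C *\<^sub>v x) - Q *\<^sub>v (C0 *\<^sub>v x)) = x \<bullet> (Q *\<^sub>v (C *\<^sub>v x)) - x \<bullet> (Q *\<^sub>v (C0 *\<^sub>v x))"
            by (rule scalar_prod_minus_distrib[OF x(1)]) (use Qc X(6) C0 x(1) in auto)
          also have "\<dots> = 0" using mult_alternate_iff[OF P X(6)] mult_alternate_iff[OF P C0] X(4) A0'(4) x(1) by simp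
          finally show "b w (T w) = 0" by simp
        qed
        then have NT: "(\<lambda>v. N v + T v) \<in> V" using op_addI[OF VD(1) N(1)] by blast
        have "A0 + D = X" unfolding A0'(1) D_def A1' X(1)
        proof -
          have "four_block_mat A1 B0 (0\<^sub>m r k) C0 + four_block_mat (0\<^sub>m k k) (B - B0) (0\<^sub>m r k) (C - C0)
            = four_block_mat (A1 + 0\<^sub>m k k) (B0 + (B - B0)) (0\<^sub>m r k + 0\<^sub>m r k) (C0 + (C - C0))"
            by (rule add_four_block_mat[of _ k k _ r _ r]) (use X A0' C0 BB in auto)
          also have "A1 + 0\<^sub>m k k = A1" using X(5) by simp
          also have "B0 + (B - B0) = B" using X(3) A0'(3) by (intro eq_matI) auto
          also have "C0 + (C - C0) = C" using X(6) C0 by (intro eq_matI) auto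
          finally show "four_block_mat A1 B0 (0\<^sub>m r k) C0 + four_block_mat (0\<^sub>m k k) (B - B0) (0\<^sub>m r k) (C - C0)
            = four_block_mat A1 B (0\<^sub>m r k) C" by simp
        qed
        then have "rep (bs @ cs) (\<lambda>v. N v + T v) X" using rep_add[OF A0 T(2)] by simp
        then show "X \<in> {A. \<exists>M\<in>V. rep (bs @ cs) M A}" using NT by blast
      qed
    qed
    also have "\<dots> = alternate_join (ns @ [r]) (Ps @ [P])"
      using alternate_join_snoc[OF non_isotropic_list_carrier[OF bs(3)] Pc] by simp
    finally have "{A. \<exists>M\<in>V. rep (bs @ cs) M A} = alternate_join (ns @ [r]) (Ps @ [P])" .
    moreover have "non_isotropic_list (ns @ [r]) (Ps @ [P])"
      using bs(3) niP r0 unfolding non_isotropic_list_def by (auto simp: nth_append less_Suc_eq)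
    moreover have "length (bs @ cs) = sum_list (ns @ [r])" using bs(2) r_def by simp
    ultimately show ?thesis using bl by blast
  qed
qed

end

section \<open>From spaces of matrices to spaces of operators\<close>

lemma mat_subspaceD:
  assumes "mat_subspace n (V :: 'a::field mat set)"
  shows "V \<subseteq> carrier_mat n n" "0\<^sub>m n n \<in> V" "\<And>A B. A \<in> V \<Longrightarrow> B \<in> V \<Longrightarrow> A + B \<in> V"
    "\<And>A c. A \<in> V \<Longrightarrow> c \<cdot>\<^sub>m A \<in> V"
  using assms unfolding mat_subspace_def subspace_def submodule_def
  by (auto simp: module_mat_simps class_ring_simps)

text \<open>Generation of \<open>V\<close> by \<open>B\<close> is phrased as a closure principle, so
  that it can be verified without the module-theoretic span behind
  \<open>mat_subspace_dim\<close>.\<close>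

lemma mat_subspace_dim_le:
  fixes V :: "'a::field mat set"
  assumes V: "mat_subspace n V" and B: "finite B" "B \<subseteq> V"
    and gen: "\<And>U. 0\<^sub>m n n \<in> U \<Longrightarrow> (\<And>X Y. X \<in> U \<Longrightarrow> Y \<in> U \<Longrightarrow> X + Y \<in> U) \<Longrightarrow>
      (\<And>X c. X \<in> U \<Longrightarrow> c \<cdot>\<^sub>m X \<in> U) \<Longrightarrow> B \<subseteq> U \<Longrightarrow> U \<subseteq> V \<Longrightarrow> V \<subseteq> U"
  shows "mat_subspace_dim n V \<le> card B"
proof -
  interpret vs: vectorspace "class_ring :: 'a ring" "module_mat TYPE('a) n n" by (rule matrix_vs)
  have sub: "subspace (class_ring :: 'a ring) V (module_mat TYPE('a) n n)" using V unfolding mat_subspace_def .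
  interpret w: vectorspace "class_ring :: 'a ring" "module_mat TYPE('a) n n \<lparr>carrier := V\<rparr>"
    by (rule vs.subspace_is_vs[OF sub])
  have BV: "B \<subseteq> carrier (module_mat TYPE('a) n n \<lparr>carrier := V\<rparr>)" using B(2) by simp
  note sm = w.span_is_submodule[OF BV]
  have "V \<subseteq> w.span B"
  proof (rule gen)
    show "0\<^sub>m n n \<in> w.span B" using submodule.zero_closed[OF sm] by (simp add: module_mat_simps)
    show "X + Y \<in> w.span B" if "X \<in> w.span B" "Y \<in> w.span B" for X Y
      using submodule.m_closed[OF sm that] by (simp add: module_mat_simps)
    show "c \<cdot>\<^sub>m X \<in> w.span B" if "X \<in> w.span B" for X c
      using submodule.smult_closed[OF sm _ that, of c] by (simp add: module_mat_simps class_ring_simps)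
    show "B \<subseteq> w.span B" by (rule w.in_own_span[OF BV])
    show "w.span B \<subseteq> V" using w.span_is_subset2[OF BV] by simp
  qed
  moreover have "w.span B \<subseteq> V" using w.span_is_subset2[OF BV] by simp
  ultimately have "w.gen_set B" by simp
  then show ?thesis unfolding mat_subspace_dim_def by (rule w.gen_ge_dim[OF B(1) BV])
qed

context endo_space
begin

lemma rep_scale: "rep bs M A \<Longrightarrow> rep bs (\<lambda>v. c *s M v) (c \<cdot>\<^sub>m A)"
  unfolding rep_def
proof (intro conjI ballI)
  fix x :: "'a vec" assume a: "A \<in> carrier_mat (length bs) (length bs) \<and>
    (\<forall>x\<in>carrier_vec (length bs). M (lcv bs x) = lcv bs (A *\<^sub>v x))" and x: "x \<in> carrier_vec (length bs)"
  have "(c \<cdot>\<^sub>m A) *\<^sub>v x = c \<cdot>\<^sub>v (A *\<^sub>v x)" using a x by (intro eq_vecI) auto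
  moreover have "A *\<^sub>v x \<in> carrier_vec (length bs)" using a x by auto
  ultimately show "c *s M (lcv bs x) = lcv bs ((c \<cdot>\<^sub>m A) *\<^sub>v x)" using a x by (simp add: lcv_smult)
qed auto

lemma basis_list_fd:
  assumes b: "basis_list E bs"
  shows "fd E" "dim E \<le> length bs"
proof -
  have E: "E = lcv bs ` carrier_vec (length bs)" using b unfolding basis_list_def by simp
  have sE: "subspace E" unfolding subspace_def
  proof (intro conjI ballI allI)
    show "0 \<in> E" using basis_list_in[OF b zero_carrier_vec] by (simp add: lcv_zero)
    show "u + v \<in> E" if uv: "u \<in> E" "v \<in> E" for u v
    proof -
      obtain x y where "x \<in> carrier_vec (length bs)" "u = lcv bs x" "y \<in> carrier_vec (length bs)" "v = lcv bs y"
        using uv basis_list_ex[OF b] by meson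
      then show ?thesis using basis_list_in[OF b, of "x + y"] by (simp add: lcv_add)
    qed
    show "c *s u \<in> E" if u: "u \<in> E" for c u
    proof -
      obtain x where "x \<in> carrier_vec (length bs)" "u = lcv bs x" using u basis_list_ex[OF b] by meson
      then show ?thesis using basis_list_in[OF b, of "c \<cdot>\<^sub>v x"] by (simp add: lcv_smult)
    qed
  qed
  have sp: "E \<subseteq> span (set bs)" unfolding E
  proof
    fix v assume "v \<in> lcv bs ` carrier_vec (length bs)"
    then obtain x where "v = lcv bs x" by blast
    then show "v \<in> span (set bs)" unfolding lcv_def by (auto intro!: span_sum span_scale intro: span_base)
  qed
  show "fd E" unfolding fd_def using sE sp by blast
  show "dim E \<le> length bs" using dim_le_card[OF sp] card_length[of bs] by (meson List.finite_set order_trans)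
qed

lemma change_basis:
  assumes b: "basis_list E bs" and c: "basis_list E cs"
  shows "\<exists>R\<in>carrier_mat (length bs) (length cs). \<forall>x\<in>carrier_vec (length cs). lcv cs x = lcv bs (R *\<^sub>v x)"
proof -
  have "\<exists>y\<in>carrier_vec (length bs). cs ! j = lcv bs y" if "j < length cs" for j
    using basis_list_ex[OF b] basis_list_in[OF c, of "unit_vec (length cs) j"] lcv_unit[OF that] by simp
  then obtain y where y: "\<And>j. j < length cs \<Longrightarrow> y j \<in> carrier_vec (length bs) \<and> cs ! j = lcv bs (y j)" by metis
  define R where "R = mat (length bs) (length cs) (\<lambda>(i, j). y j $ i)"
  have R: "R \<in> carrier_mat (length bs) (length cs)" unfolding R_def by simp
  have col: "col R j = y j" if "j < length cs" for j using y[OF that] that unfolding R_def by (intro eq_vecI) auto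
  have "lcv cs x = lcv bs (R *\<^sub>v x)" if x: "x \<in> carrier_vec (length cs)" for x
    unfolding lcv_mult_mat[OF R x] lcv_def[of cs] by (rule sum.cong) (use y col in auto)
  then show ?thesis using R by blast
qed

lemma change_basis_inverse:
  assumes b: "basis_list E bs" and R: "R \<in> carrier_mat (length bs) (length cs)" "S \<in> carrier_mat (length cs) (length bs)"
    and RS: "\<forall>x\<in>carrier_vec (length cs). lcv cs x = lcv bs (R *\<^sub>v x)"
      "\<forall>x\<in>carrier_vec (length bs). lcv bs x = lcv cs (S *\<^sub>v x)"
  shows "R * S = 1\<^sub>m (length bs)"
proof (rule mat_eq_if_mult_vec_eq)
  fix x :: "'a vec" assume x: "x \<in> carrier_vec (length bs)"
  have "lcv bs (R *\<^sub>v (S *\<^sub>v x)) = lcv bs x" using RS R x by (metis mult_mat_vec_carrier)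
  then have "R *\<^sub>v (S *\<^sub>v x) = x" by (rule basis_list_inj[OF b, rotated 2]) (use R x in auto)
  then show "R * S *\<^sub>v x = 1\<^sub>m (length bs) *\<^sub>v x" using R x by (simp add: assoc_mult_mat_vec[OF R])
qed (use R in auto)

text \<open>\<open>W\<close> is \<open>V\<close> read as a space of operators on \<open>E\<close>.
  With \<open>n = length bs\<close>, the chain \<open>n choose 2 \<le> op.dim W \<le> dim E choose 2
  \<le> n choose 2\<close> makes \<open>W\<close> maximal; its block form is carried back by a
  change of basis.\<close>

lemma alternate_join_similar:
  fixes V :: "'a mat set"
  assumes c0: "c0 \<noteq> (0::'a)" "c0 \<noteq> 1" and b: "basis_list E bs" and V: "maximal_trivial_spectrum (length bs) V"
  shows "\<exists>ns Ps. sum_list ns = length bs \<and> non_isotropic_list ns Ps \<and>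
    similar_subspaces (length bs) V (alternate_join ns Ps)"
proof -
  let ?n = "length bs"
  have Vt: "mat_subspace ?n V" "mat_subspace_dim ?n V = ?n choose 2"
    "\<And>M x. M \<in> V \<Longrightarrow> x \<in> carrier_vec ?n \<Longrightarrow> M *\<^sub>v x = x \<Longrightarrow> x = 0\<^sub>v ?n"
    using V unfolding maximal_trivial_spectrum_def trivial_spectrum_def by auto
  note VD = mat_subspaceD[OF Vt(1)]
  note fE = basis_list_fd[OF b]
  have sE: "subspace E" using fd_subspace[OF fE(1)] .
  define W where "W = {M \<in> End E. \<exists>A\<in>V. rep bs M A}"
  have "op.subspace W" unfolding op.subspace_def
  proof (intro conjI ballI allI)
    have "rep bs 0 (0\<^sub>m ?n ?n)" unfolding rep_def by (simp add: mult_vec_zero(2) lcv_zero)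
    moreover have "0 \<in> End E" using subspace_0[OF sE] by (auto simp: End_def lin_on_def)
    ultimately show "0 \<in> W" unfolding W_def using VD(2) by blast
    have EA: "M + N \<in> End E" if "M \<in> End E" "N \<in> End E" for M N
      using that sE unfolding End_def lin_on_def by (auto simp: plus_fun_def scale_right_distrib subspace_add image_subset_iff)
    have ES: "opscale c M \<in> End E" if "M \<in> End E" for M c
      using that sE unfolding End_def lin_on_def by (auto simp: scale_right_distrib subspace_scale image_subset_iff mult.commute)
    fix M assume "M \<in> W"
    then obtain A where M: "M \<in> End E" "A \<in> V" "rep bs M A" unfolding W_def by blast
    show "opscale c M \<in> W" for c
      unfolding W_def using ES[OF M(1), of c] VD(4)[OF M(2), of c] rep_scale[OF M(3), of c] unfolding opscale_def by blast
    fix N assume "N \<in> W"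
    then obtain B where N: "N \<in> End E" "B \<in> V" "rep bs N B" unfolding W_def by blast
    show "M + N \<in> W"
      unfolding W_def using EA[OF M(1) N(1)] VD(3)[OF M(2) N(2)] rep_add[OF M(3) N(3)] unfolding plus_fun_def by blast
  qed
  moreover have "x = 0" if M: "M \<in> W" and x: "x \<in> E" "M x = x" for M x
  proof -
    obtain A where A: "A \<in> V" "rep bs M A" using M unfolding W_def by blast
    obtain y where y: "y \<in> carrier_vec ?n" "x = lcv bs y" using basis_list_ex[OF b x(1)] by blast
    have "lcv bs (A *\<^sub>v y) = lcv bs y" using A(2) x(2) y unfolding rep_def by simp
    then have "A *\<^sub>v y = y" by (rule basis_list_inj[OF b, rotated 2]) (use A VD(1) y in auto)
    then show ?thesis using Vt(3)[OF A(1) y(1)] y(2) lcv_zero by simp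
  qed
  ultimately have tW: "triv E W" unfolding triv_def W_def by blast
  note bd = triv_dim_bound[OF fE(1) tW]
  obtain B where B: "finite B" "op.independent B" "op.span B = W" "card B = op.dim W"
    by (rule op.fd_basis[OF conjunct1[OF bd]])
  have BW: "B \<subseteq> W" using op.span_superset[of B] unfolding B(3) .
  have "\<exists>A\<in>V. rep bs M A" if "M \<in> B" for M using BW that unfolding W_def by blast
  then obtain h where h: "\<And>M. M \<in> B \<Longrightarrow> h M \<in> V \<and> rep bs M (h M)" by metis
  \<comment> \<open>The matrices of a basis of \<open>W\<close> generate \<open>V\<close>, so the
    dimension of \<open>V\<close> is at most \<open>op.dim W\<close>; the opposite estimate is the
    dimension bound.\<close>
  have "mat_subspace_dim ?n V \<le> card (h ` B)"
  proof (rule mat_subspace_dim_le[OF Vt(1)])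
    show "finite (h ` B)" "h ` B \<subseteq> V" using B(1) h by auto
    fix U assume U: "0\<^sub>m ?n ?n \<in> U" "\<And>X Y. X \<in> U \<Longrightarrow> Y \<in> U \<Longrightarrow> X + Y \<in> U" "\<And>X c. X \<in> U \<Longrightarrow> c \<cdot>\<^sub>m X \<in> U"
      "h ` B \<subseteq> U" "U \<subseteq> V"
    have span: "\<exists>A\<in>U. rep bs M A" if "M \<in> op.span B" for M
      using that
    proof (induction rule: op.span_induct_alt)
      case base
      have "rep bs 0 (0\<^sub>m ?n ?n)" unfolding rep_def by (simp add: mult_vec_zero(2) lcv_zero)
      then show ?case using U(1) by blast
    next
      case (step c M N)
      then obtain X where X: "X \<in> U" "rep bs N X" by blast
      have "rep bs (opscale c M + N) (c \<cdot>\<^sub>m h M + X)"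
        using rep_add[OF rep_scale[of bs M "h M" c] X(2)] h[OF step(1)]
        unfolding plus_fun_def opscale_def by blast
      moreover have "c \<cdot>\<^sub>m h M + X \<in> U" using U X step(1) by blast
      ultimately show ?case by blast
    qed
    show "V \<subseteq> U"
    proof
      fix A assume A: "A \<in> V"
      obtain M where M: "M \<in> End E" "rep bs M A" using rep_surj[OF b] A VD(1) by blast
      then have "M \<in> op.span B" unfolding B(3) W_def using A by blast
      then obtain X where "X \<in> U" "rep bs M X" using span by blast
      then show "A \<in> U" using rep_unique[OF b M(2)] by blast
    qed
  qed
  also have "\<dots> \<le> op.dim W" using card_image_le[OF B(1), of h] B(4) by simp
  finally have "?n choose 2 \<le> op.dim W" using Vt(2) by simp
  moreover have "dim E choose 2 \<le> ?n choose 2" using fE(2) choose2_add[of "dim E" "?n - dim E"] by simp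
  ultimately have "maxt E W" unfolding maxt_def using fE(1) tW bd by simp
  then obtain cs ns Ps where cs: "basis_list E cs" "length cs = sum_list ns" "non_isotropic_list ns Ps"
    "{A. \<exists>M\<in>W. rep cs M A} = alternate_join ns Ps"
    using alternate_form_exists[OF c0] by blast
  obtain R where R: "R \<in> carrier_mat ?n (length cs)" "\<forall>x\<in>carrier_vec (length cs). lcv cs x = lcv bs (R *\<^sub>v x)"
    using change_basis[OF b cs(1)] by blast
  obtain S where S: "S \<in> carrier_mat (length cs) ?n" "\<forall>x\<in>carrier_vec ?n. lcv bs x = lcv cs (S *\<^sub>v x)"
    using change_basis[OF cs(1) b] by blast
  have RS: "R * S = 1\<^sub>m ?n" by (rule change_basis_inverse[OF b R(1) S(1) R(2) S(2)])
  have SR: "S * R = 1\<^sub>m (length cs)" by (rule change_basis_inverse[OF cs(1) S(1) R(1) S(2) R(2)])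
  \<comment> \<open>Rectangular matrices that are inverse to each other force the two bases to have
    equal length.\<close>
  have len: "length cs = ?n"
    using rectangular_inverse_le[OF R(1) S(1) RS] rectangular_inverse_le[OF S(1) R(1) SR] by simp
  have mi: "mutual_inverse ?n S R" unfolding mutual_inverse_def using R(1) S(1) RS SR len by simp
  have conj: "rep cs M (S * A * R)" if A: "A \<in> carrier_mat ?n ?n" and M: "rep bs M A" for A M
    unfolding rep_def len
  proof (intro conjI ballI)
    note D = mutual_inverseD[OF mi]
    show "S * A * R \<in> carrier_mat ?n ?n" using D A by simp
    fix x :: "'a vec" assume x: "x \<in> carrier_vec ?n"
    have c: "R *\<^sub>v x \<in> carrier_vec ?n" "A *\<^sub>v (R *\<^sub>v x) \<in> carrier_vec ?n" using D A x by auto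
    have "M (lcv cs x) = lcv bs (A *\<^sub>v (R *\<^sub>v x))" using R(2) x len M c unfolding rep_def by simp
    also have "\<dots> = lcv cs (S *\<^sub>v (A *\<^sub>v (R *\<^sub>v x)))" using S(2) c by simp
    also have "S *\<^sub>v (A *\<^sub>v (R *\<^sub>v x)) = (S * A * R) *\<^sub>v x" using D(1,2) A x by (simp add: square_mult[where n = ?n])
    finally show "M (lcv cs x) = lcv cs ((S * A * R) *\<^sub>v x)" .
  qed
  have "alternate_join ns Ps = conj_mats S R V"
  proof
    show "alternate_join ns Ps \<subseteq> conj_mats S R V"
    proof
      fix X assume "X \<in> alternate_join ns Ps"
      then obtain M where M: "M \<in> W" "rep cs M X" unfolding cs(4)[symmetric] by blast
      obtain A where A: "A \<in> V" "rep bs M A" using M(1) unfolding W_def by blast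
      have "X = S * A * R" using rep_unique[OF cs(1) M(2) conj[OF _ A(2)]] A(1) VD(1) by blast
      then show "X \<in> conj_mats S R V" unfolding conj_mats_def using A(1) by blast
    qed
    show "conj_mats S R V \<subseteq> alternate_join ns Ps"
    proof
      fix X assume "X \<in> conj_mats S R V"
      then obtain A where A: "A \<in> V" "X = S * A * R" unfolding conj_mats_def by blast
      have Ac: "A \<in> carrier_mat ?n ?n" using A(1) VD(1) by blast
      obtain M where M: "M \<in> End E" "rep bs M A" using rep_surj[OF b Ac] by blast
      have "M \<in> W" unfolding W_def using M A(1) by blast
      then show "X \<in> alternate_join ns Ps" unfolding cs(4)[symmetric] A(2) using conj[OF Ac M(2)] by blast
    qed
  qed
  moreover have "alternate_join ns Ps \<subseteq> carrier_mat ?n ?n"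
    using non_isotropic_join_carrier(1)[OF cs(3)] cs(2) len by simp
  ultimately have "similar_subspaces ?n V (alternate_join ns Ps)"
    unfolding similar_subspaces_iff using mi VD(1) by blast
  then show ?thesis using cs len by metis
qed

end

section \<open>Application to coordinate space and conclusion\<close>

lemma third_scalar_exists:
  assumes "infinite (UNIV :: 'a::field set) \<or> 3 \<le> card (UNIV :: 'a set)"
  shows "\<exists>c::'a. c \<noteq> 0 \<and> c \<noteq> 1"
proof (rule ccontr)
  assume "\<not> ?thesis"
  then have U: "UNIV = {0, 1 :: 'a}" by blast
  then have "finite (UNIV :: 'a set)" by (metis finite.emptyI finite.insertI)
  moreover have "card (UNIV :: 'a set) \<le> 2" unfolding U using card_insert_le_m1[of 2 "{1::'a}" 0] by simp
  ultimately show False using assms by simp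
qed

text \<open>\<open>endo_space\<close> lives on a type that is an abelian group, while vectors of
  length \<open>n\<close> form a carrier set inside \<open>'a vec\<close>. Coordinate space is
  therefore realised as the sequences supported below \<open>n\<close>, with the standard unit
  sequences as basis.\<close>

theorem alternate_join_exists:
  assumes "infinite (UNIV :: 'a::field set) \<or> 3 \<le> card (UNIV :: 'a set)"
    and V: "maximal_trivial_spectrum n (V :: 'a mat set)"
  shows "\<exists>ns Ps. sum_list ns = n \<and> non_isotropic_list ns Ps \<and> similar_subspaces n V (alternate_join ns Ps)"
proof -
  obtain c0 :: 'a where c0: "c0 \<noteq> 0" "c0 \<noteq> 1" using third_scalar_exists[OF assms(1)] by blast
  interpret fs: endo_space "\<lambda>c (f :: nat \<Rightarrow> 'a) i. c * f i"
    by unfold_locales (auto simp: fun_eq_iff plus_fun_def algebra_simps)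
  define bs where "bs = map (\<lambda>j i. if i = j then 1 else 0 :: 'a) [0..<n]"
  have len: "length bs = n" unfolding bs_def by simp
  have lcv: "fs.lcv bs x i = (if i < n then x $ i else 0)" for x i
  proof -
    have "fs.lcv bs x i = (\<Sum>j<n. x $ j * (bs ! j) i)" unfolding fs.lcv_def len
      by (induction n) (auto simp: plus_fun_def zero_fun_def)
    also have "\<dots> = (\<Sum>j<n. if j = i then x $ i else 0)" by (rule sum.cong) (auto simp: bs_def)
    finally show ?thesis by simp
  qed
  have "fs.basis_list (fs.lcv bs ` carrier_vec n) bs"
    unfolding fs.basis_list_def len
  proof (intro conjI refl ballI impI)
    fix x :: "'a vec" assume x: "x \<in> carrier_vec n" "fs.lcv bs x = 0"
    show "x = 0\<^sub>v n"
    proof (rule eq_vecI)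
      fix i assume "i < dim_vec (0\<^sub>v n :: 'a vec)"
      then show "x $ i = 0\<^sub>v n $ i" using lcv[of x i] x(2) by simp
    qed (use x in simp)
  qed
  then show ?thesis using fs.alternate_join_similar[OF c0, of _ bs V] V len by metis
qed

theorem theorem4:
  fixes V :: "'a::field mat set" and n :: nat
  assumes "infinite (UNIV :: 'a set) \<or> 3 \<le> card (UNIV :: 'a set)"
    and "maximal_trivial_spectrum n V"
  shows
    "(\<exists>ns Ps. sum_list ns = n \<and> non_isotropic_list ns Ps \<and>
        (\<forall>k < length ns. Ps ! k \<in> GL_mat (ns ! k)) \<and>
        similar_subspaces n V (alternate_join ns Ps))
     \<and>
     (\<forall>ns Ps ns' Ps'.
        non_isotropic_list ns Ps \<longrightarrow> similar_subspaces n V (alternate_join ns Ps) \<longrightarrow>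
        non_isotropic_list ns' Ps' \<longrightarrow> similar_subspaces n V (alternate_join ns' Ps') \<longrightarrow>
        length ns' = length ns \<and>
        (\<forall>k < length ns. ns' ! k = ns ! k \<and>
           (\<exists>c. c \<noteq> 0 \<and> congruent_mats (ns ! k) (Ps' ! k) (c \<cdot>\<^sub>m (Ps ! k)))))
     \<and>
     (\<forall>ns Ps Qs.
        non_isotropic_list ns Ps \<longrightarrow> similar_subspaces n V (alternate_join ns Ps) \<longrightarrow>
        length Qs = length ns \<longrightarrow>
        (\<forall>k < length ns. Qs ! k \<in> GL_mat (ns ! k) \<and>
           (\<exists>c. congruent_mats (ns ! k) (Qs ! k) (c \<cdot>\<^sub>m (Ps ! k)))) \<longrightarrow>
        similar_subspaces n V (alternate_join ns Qs))"
proof (intro conjI allI impI)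
  obtain ns Ps where e: "sum_list ns = n" "non_isotropic_list ns Ps"
    "similar_subspaces n V (alternate_join ns Ps)"
    using alternate_join_exists[OF assms] by blast
  have "Ps ! k \<in> GL_mat (ns ! k)" if "k < length ns" for k
    using e(2) that non_isotropic_inverse GL_mat_iff unfolding non_isotropic_list_def by blast
  then show "\<exists>ns Ps. sum_list ns = n \<and> non_isotropic_list ns Ps \<and>
      (\<forall>k < length ns. Ps ! k \<in> GL_mat (ns ! k)) \<and>
      similar_subspaces n V (alternate_join ns Ps)"
    using e by blast
next
  fix ns ns' :: "nat list" and Ps Ps' :: "'a mat list"
  assume a: "non_isotropic_list ns Ps" "similar_subspaces n V (alternate_join ns Ps)"
    "non_isotropic_list ns' Ps'" "similar_subspaces n V (alternate_join ns' Ps')"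
  have "similar_subspaces n (alternate_join ns Ps) (alternate_join ns' Ps')"
    by (rule similar_subspaces_trans[OF similar_subspaces_sym[OF a(2)] a(4)])
  note u = alternate_join_unique[OF a(1,3) this]
  show "length ns' = length ns" using u by blast
  fix k assume "k < length ns"
  then show "ns' ! k = ns ! k" "\<exists>c. c \<noteq> 0 \<and> congruent_mats (ns ! k) (Ps' ! k) (c \<cdot>\<^sub>m (Ps ! k))"
    using u by blast+
next
  fix ns :: "nat list" and Ps Qs :: "'a mat list"
  assume a: "non_isotropic_list ns Ps" "similar_subspaces n V (alternate_join ns Ps)" "length Qs = length ns"
    and q: "\<forall>k < length ns. Qs ! k \<in> GL_mat (ns ! k) \<and> (\<exists>c. congruent_mats (ns ! k) (Qs ! k) (c \<cdot>\<^sub>m (Ps ! k)))"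
  \<comment> \<open>The sizes are not assumed to add up to \<open>n\<close>; the similarity with
    \<open>V\<close> forces it.\<close>
  have "sum_list ns = n" by (rule alternate_join_size[OF a(1) similar_subspaces_carrier(2)[OF a(2)]])
  then have "similar_subspaces n (alternate_join ns Ps) (alternate_join ns Qs)"
    using congruent_join_similar[OF a(1,3)] q by blast
  then show "similar_subspaces n V (alternate_join ns Qs)"
    by (rule similar_subspaces_trans[OF a(2)])
qed

end
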